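(* Let $N=2$ or $N=3$, and let $g\in\mathcal{C}(\mathbb{R})$ be a $2\pi$-periodic function whose Fourier coefficients $c_m,d_m$ satisfy $c_1\ge 0$ and $d_1\ge 0$. Suppose there exists $u\in\mathcal{C}^2(\overline{\mathbb{R}^N_+})$ which solves $$-\mathrm{div}(A(x')\nabla u)=u-g(x_N)\ \text{ in }\mathbb{R}^N_+,\qquad u=0\ \text{ on }\partial\mathbb{R}^N_+,$$ and such that for every $M>0$ there exists $C(M)>0$ with $0\le u(x)\le C(M)$ for all $x\in\mathbb{R}^{N-1}\times[0,M]$. Then necessarily $c_1=d_1=0$. In this case $u$ is $1$-dimensional (it depends only on $x_N$), is $2\pi$-periodic in $x_N$, and is uniquely determined as the solution of $$\begin{cases}-u''(x_N)=u(x_N)-g(x_N)&\text{in }(0,+\infty)\\ u(0)=u(2\pi)=0\\ u'(0)=u'(2\pi)=0.\end{cases}$$ The expression of $u$ in Fourier series is $$u(x',x_N)=\frac{c_0}{2}+\Big(-\frac{c_0}{2}+\sum_{m=2}^{+\infty}\frac{c_m}{m^2-1}\Big)\cos x_N+\Big(\sum_{m=2}^{+\infty}\frac{m}{m^2-1}d_m\Big)\sin x_N-\sum_{m=2}^{+\infty}\Big(\frac{c_m}{m^2-1}\cos(mx_N)+\frac{d_m}{m^2-1}\sin(mx_N)\Big).$$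
   Context: $\mathbb{R}^N_+:=\mathbb{R}^{N-1}\times(0,+\infty)$, with points $x=(x',x_N)$, $x'\in\mathbb{R}^{N-1}$. Assumption on $A$: $A(x')=\begin{pmatrix}\widehat{A}(x')&0\\0&1\end{pmatrix}$ is an $N\times N$ matrix, where $\widehat{A}(x')=(a_{ij}(x'))$ is an $(N-1)\times(N-1)$ symmetric real matrix with entries $a_{ij}\in C^1(\mathbb{R}^{N-1})\cap L^\infty(\mathbb{R}^{N-1})$ and $\sum_{i,j=1}^{N-1}a_{ij}(x')\xi_i\xi_j>0$ for all $x'\in\mathbb{R}^{N-1}$, $\xi\in\mathbb{R}^{N-1}\setminus\{0\}$. Fourier coefficients of $g$: $c_m=\frac1\pi\int_0^{2\pi}g(t)\cos(mt)\,dt$ for $m\ge0$, and $d_m=\frac1\pi\int_0^{2\pi}g(t)\sin(mt)\,dt$ for $m\ge1$. *)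

theory Defs
  imports "HOL-Analysis.Analysis"
begin

definition partial_deriv :: "'a::euclidean_space \<Rightarrow> ('a \<Rightarrow> real) \<Rightarrow> 'a \<Rightarrow> real" where
  "partial_deriv e f x = deriv (\<lambda>s. f (x + s *\<^sub>R e)) 0"

definition grad :: "('a::euclidean_space \<Rightarrow> real) \<Rightarrow> 'a \<Rightarrow> 'a" where
  "grad f x = (\<Sum>e\<in>Basis. partial_deriv e f x *\<^sub>R e)"

definition divergence :: "('a::euclidean_space \<Rightarrow> 'a) \<Rightarrow> 'a \<Rightarrow> real" where
  "divergence F x = (\<Sum>e\<in>Basis. partial_deriv e (\<lambda>y. F y \<bullet> e) x)"

text \<open>For open \<open>\<Omega>\<close>: the partial derivatives of \<open>f\<close> up to order \<open>k\<close> exist in \<open>\<Omega>\<close> and each of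
  them extends continuously to the closure of \<open>\<Omega>\<close>.  Only the values of \<open>f\<close> inside \<open>\<Omega>\<close> matter.\<close>

primrec Ck_extends :: "nat \<Rightarrow> 'a::euclidean_space set \<Rightarrow> ('a \<Rightarrow> real) \<Rightarrow> bool" where
  "Ck_extends 0 \<Omega> f \<longleftrightarrow> (\<exists>h. continuous_on (closure \<Omega>) h \<and> (\<forall>x\<in>\<Omega>. h x = f x))"
| "Ck_extends (Suc k) \<Omega> f \<longleftrightarrow>
     (\<exists>h. continuous_on (closure \<Omega>) h \<and> (\<forall>x\<in>\<Omega>. h x = f x)) \<and>
     f differentiable_on \<Omega> \<and>
     (\<forall>e\<in>Basis. Ck_extends k \<Omega> (partial_deriv e f))"

text \<open>\<open>f \<in> C\<^sup>k(closure \<Omega>)\<close>.  For \<open>\<Omega> = UNIV\<close> this is the usual class \<open>C\<^sup>k\<close> on the whole space.\<close>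

definition Ck_closure :: "nat \<Rightarrow> 'a::euclidean_space set \<Rightarrow> ('a \<Rightarrow> real) \<Rightarrow> bool" where
  "Ck_closure k \<Omega> f \<longleftrightarrow> continuous_on (closure \<Omega>) f \<and> Ck_extends k \<Omega> f"

definition L_infinity :: "('a::euclidean_space \<Rightarrow> real) \<Rightarrow> bool" where
  "L_infinity f \<longleftrightarrow> f \<in> borel_measurable lebesgue \<and> (\<exists>C. AE x in lebesgue. \<bar>f x\<bar> \<le> C)"

text \<open>Points are pairs \<open>x = (x', x\<^sub>N)\<close>; the dimension is \<open>N = CARD('n) + 1\<close>.\<close>

definition half_space :: "((real ^ 'n) \<times> real) set" where
  "half_space = UNIV \<times> {0<..}"

text \<open>The action on vectors of the block matrix with diagonal blocks \<open>B\<close> and \<open>1\<close>.\<close>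

definition block_mult :: "real ^ 'n ^ 'n \<Rightarrow> (real ^ 'n) \<times> real \<Rightarrow> (real ^ 'n) \<times> real" where
  "block_mult B \<xi> = (B *v fst \<xi>, snd \<xi>)"

definition admissible_matrix :: "(real ^ 'n \<Rightarrow> real ^ 'n ^ 'n) \<Rightarrow> bool" where
  "admissible_matrix Ahat \<longleftrightarrow>
     (\<forall>x'. transpose (Ahat x') = Ahat x') \<and>
     (\<forall>i j. Ck_closure 1 UNIV (\<lambda>x'. Ahat x' $ i $ j) \<and> L_infinity (\<lambda>x'. Ahat x' $ i $ j)) \<and>
     (\<forall>x' \<xi>. \<xi> \<noteq> 0 \<longrightarrow> (\<Sum>i\<in>UNIV. \<Sum>j\<in>UNIV. Ahat x' $ i $ j * \<xi> $ i * \<xi> $ j) > 0)"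

definition fourier_cos :: "(real \<Rightarrow> real) \<Rightarrow> nat \<Rightarrow> real" where
  "fourier_cos g m = 1 / pi * integral {0..2*pi} (\<lambda>t. g t * cos (real m * t))"

definition fourier_sin :: "(real \<Rightarrow> real) \<Rightarrow> nat \<Rightarrow> real" where
  "fourier_sin g m = 1 / pi * integral {0..2*pi} (\<lambda>t. g t * sin (real m * t))"

text \<open>Classical solutions, of class \<open>C\<^sup>2([0,\<infinity>))\<close>; the derivative at \<open>0\<close> is one-sided.\<close>

definition solves_profile :: "(real \<Rightarrow> real) \<Rightarrow> (real \<Rightarrow> real) \<Rightarrow> bool" where
  "solves_profile g v \<longleftrightarrow>
     Ck_closure 2 {0<..} v \<and>
     (\<forall>t>0. - deriv (deriv v) t = v t - g t) \<and>
     v 0 = 0 \<and> v (2*pi) = 0 \<and>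
     (v has_real_derivative 0) (at 0 within {0..}) \<and>
     (v has_real_derivative 0) (at (2*pi))"

end

theory Submission
  imports Defs
begin

text \<open>Write points of the half-space as \<open>(x', t)\<close>.  Let \<open>T\<close> be a multiple of \<open>2\<pi>\<close> such that \<open>u\<close> vanishes on
\<open>t = T\<close>, let \<open>\<psi>'' = - m\<^sup>2 \<psi>\<close>, and consider the moment
\<open>U(x') = \<integral> u(x', T + t) \<psi>(t) dt\<close> over \<open>0 \<le> t \<le> 2\<pi>\<close>.  Integrating the equation against \<open>\<psi>\<close> and
integrating by parts twice in \<open>t\<close> gives an equation in \<open>x'\<close> alone (\<open>moment_equation\<close>):
\<open>div (Ahat \<nabla>U) = (m\<^sup>2 - 1) U + \<integral> g \<psi> - [u\<^sub>t \<psi> - u \<psi>']\<close>, with the bracket taken between the ends of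
the period.  Since \<open>U\<close> is bounded and \<open>x'\<close> has at most two coordinates, a Liouville theorem
applies (\<open>bounded_Liouville_dim_le_2\<close>): if \<open>U div (Ahat \<nabla>U) \<ge> 0\<close>, also after adding a constant to \<open>U\<close>,
then \<open>\<nabla>U\<close> and \<open>div (Ahat \<nabla>U)\<close> vanish.

For \<open>m = 1\<close> the right-hand side contains only data with a sign.  With \<open>\<psi> = sin\<close> it is
\<open>u(x', T + 2\<pi>) + \<pi> d\<^sub>1 \<ge> 0\<close>, so both terms vanish; as \<open>u \<ge> 0\<close>, also \<open>u\<^sub>t(x', T + 2\<pi>) = 0\<close>.  With
\<open>\<psi> = cos\<close> it is then \<open>u\<^sub>t(x', T) + \<pi> c\<^sub>1 \<ge> 0\<close>, and again both terms vanish.  Hence \<open>u\<close> and \<open>u\<^sub>t\<close> vanish at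
both ends of the period, no boundary term is left, and for \<open>m \<ge> 2\<close> the right-hand side is a
positive multiple of \<open>U\<close> plus a constant, which forces that sum to vanish.  So all Fourier
coefficients of \<open>u(x', T + \<cdot>)\<close> of order at least two are known and independent of \<open>x'\<close>.

The mean value is the one moment whose equation has the wrong sign.  But the Fourier series at
\<open>t = 0\<close> has the sum \<open>0\<close>, which ties the mean value to the first cosine coefficient up to a known
constant; the latter has zero gradient, hence so has the former, and then its own equation
determines it.  The first sine coefficient follows in the same way from the Fourier series of
\<open>u\<^sub>t\<close> at \<open>t = 0\<close>.  A continuous periodic function is determined by its Fourier coefficients
(\<open>fourier_coeffs_zero_imp_zero\<close>), so \<open>u\<close> is the stated series on the period, in particular
independent of \<open>x'\<close>, and it vanishes at \<open>T + 2\<pi>\<close>: induction over the periods covers the half-space.\<close>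

section \<open>Fourier series on one period\<close>

lemma cos_sin_nat_2pi: "cos (real k * (2 * pi)) = 1" "sin (real k * (2 * pi)) = 0"
  using cos_2npi[of k] sin_2npi[of k] by (simp_all only: mult_ac)

text \<open>Integer frequencies, possibly negative, so that the product formulas below need no case
distinction between sums and differences of natural frequencies.\<close>
lemma has_integral_cos_int:
  fixes k :: int
  shows "((\<lambda>t. cos (of_int k * t)) has_integral (if k = 0 then 2 * pi else 0)) {0..2*pi}"
proof (cases "k = 0")
  case True
  then show ?thesis using has_integral_const_real[of "1::real" 0 "2*pi"] by simp
next
  case False
  have "((\<lambda>t. cos (of_int k * t)) has_integral
          sin (of_int k * (2*pi)) / of_int k - sin (of_int k * 0) / of_int k) {0..2*pi}"
    using False
    by (intro fundamental_theorem_of_calculus)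
       (auto simp: has_real_derivative_iff_has_vector_derivative[symmetric]
             intro!: derivative_eq_intros)
  moreover have "sin (of_int k * (2*pi)) = 0"
    using sin_integer_2pi[of "of_int k"] by (simp add: mult_ac)
  ultimately show ?thesis using False by simp
qed

lemma has_integral_sin_int:
  fixes k :: int
  shows "((\<lambda>t. sin (of_int k * t)) has_integral 0) {0..2*pi}"
proof (cases "k = 0")
  case False
  have "((\<lambda>t. sin (of_int k * t)) has_integral
          - cos (of_int k * (2*pi)) / of_int k - - cos (of_int k * 0) / of_int k) {0..2*pi}"
    using False
    by (intro fundamental_theorem_of_calculus)
       (auto simp: has_real_derivative_iff_has_vector_derivative[symmetric]
             intro!: derivative_eq_intros)
  moreover have "cos (of_int k * (2*pi)) = 1"
    using cos_integer_2pi[of "of_int k"] by (simp add: mult_ac)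
  ultimately show ?thesis by simp
qed simp

lemma has_integral_cos_cos:
  "((\<lambda>t. cos (real i * t) * cos (real j * t)) has_integral
     (if i = j then if i = 0 then 2 * pi else pi else 0)) {0..2*pi}"
proof -
  have eq: "cos (real i * t) * cos (real j * t) =
      (cos (of_int (int i - int j) * t) + cos (of_int (int i + int j) * t)) / 2" for t
    by (simp add: cos_add cos_diff algebra_simps)
  have "((\<lambda>t. (cos (of_int (int i - int j) * t) + cos (of_int (int i + int j) * t)) / 2) has_integral
     ((if int i - int j = 0 then 2 * pi else 0) + (if int i + int j = 0 then 2 * pi else 0)) / 2) {0..2*pi}"
    by (intro has_integral_divide has_integral_add has_integral_cos_int)
  then show ?thesis unfolding eq by (rule has_integral_eq_rhs) auto
qed

lemma has_integral_sin_sin: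
  "((\<lambda>t. sin (real i * t) * sin (real j * t)) has_integral
     (if i = j \<and> i \<noteq> 0 then pi else 0)) {0..2*pi}"
proof -
  have eq: "sin (real i * t) * sin (real j * t) =
      (cos (of_int (int i - int j) * t) - cos (of_int (int i + int j) * t)) / 2" for t
    by (simp add: cos_add cos_diff algebra_simps)
  have "((\<lambda>t. (cos (of_int (int i - int j) * t) - cos (of_int (int i + int j) * t)) / 2) has_integral
     ((if int i - int j = 0 then 2 * pi else 0) - (if int i + int j = 0 then 2 * pi else 0)) / 2) {0..2*pi}"
    by (intro has_integral_divide has_integral_diff has_integral_cos_int)
  then show ?thesis unfolding eq by (rule has_integral_eq_rhs) auto
qed

lemma has_integral_sin_cos:
  "((\<lambda>t. sin (real i * t) * cos (real j * t)) has_integral 0) {0..2*pi}"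
proof -
  have eq: "sin (real i * t) * cos (real j * t) =
      (sin (of_int (int i + int j) * t) + sin (of_int (int i - int j) * t)) / 2" for t
    by (simp add: sin_add sin_diff algebra_simps)
  have "((\<lambda>t. (sin (of_int (int i + int j) * t) + sin (of_int (int i - int j) * t)) / 2) has_integral
     (0 + 0) / 2) {0..2*pi}"
    by (intro has_integral_divide has_integral_add has_integral_sin_int)
  then show ?thesis unfolding eq by (rule has_integral_eq_rhs) auto
qed

text \<open>Integer frequencies make the class stable under multiplication by \<open>cos\<close> and \<open>sin\<close> through one
product formula each.\<close>
definition trig_orthogonal :: "(real \<Rightarrow> real) \<Rightarrow> bool" where
  "trig_orthogonal w \<longleftrightarrow> (\<forall>k::int.
     ((\<lambda>t. w t * cos (of_int k * t)) has_integral 0) {0..2*pi} \<and>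
     ((\<lambda>t. w t * sin (of_int k * t)) has_integral 0) {0..2*pi})"

lemma trig_orthogonal_lincomb:
  assumes "trig_orthogonal v" "trig_orthogonal w"
  shows "trig_orthogonal (\<lambda>t. a * v t + b * w t)"
proof -
  have "((\<lambda>t. a * (v t * cos (of_int k * t)) + b * (w t * cos (of_int k * t)))
          has_integral a * 0 + b * 0) {0..2*pi}"
    "((\<lambda>t. a * (v t * sin (of_int k * t)) + b * (w t * sin (of_int k * t)))
          has_integral a * 0 + b * 0) {0..2*pi}" for k :: int
    using assms unfolding trig_orthogonal_def
    by (intro has_integral_add has_integral_mult_right; blast)+
  then show ?thesis
    unfolding trig_orthogonal_def by (simp add: algebra_simps)
qed

text \<open>Multiplication by \<open>cos\<close> or \<open>sin\<close> only shifts the frequencies \<open>k\<close> by one.\<close>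
lemma trig_orthogonal_mult_cos_sin:
  assumes "trig_orthogonal w"
  shows "trig_orthogonal (\<lambda>t. w t * cos t)" "trig_orthogonal (\<lambda>t. w t * sin t)"
proof -
  have C: "((\<lambda>t. w t * cos (of_int k * t)) has_integral 0) {0..2*pi}"
   and S: "((\<lambda>t. w t * sin (of_int k * t)) has_integral 0) {0..2*pi}" for k :: int
    using assms unfolding trig_orthogonal_def by blast+
  note add = has_integral_divide[OF has_integral_add, where c = 2, of _ "0::real" _ _ 0]
  note diff = has_integral_divide[OF has_integral_diff, where c = 2, of _ "0::real" _ _ 0]
  have "((\<lambda>t. w t * cos t * cos (of_int k * t)) has_integral 0) {0..2*pi}" for k :: int
    using add[OF C[of "k-1"] C[of "k+1"]]
    by (simp add: cos_add cos_diff algebra_simps)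
  moreover have "((\<lambda>t. w t * cos t * sin (of_int k * t)) has_integral 0) {0..2*pi}" for k :: int
    using add[OF S[of "k-1"] S[of "k+1"]]
    by (simp add: sin_add sin_diff algebra_simps)
  moreover have "((\<lambda>t. w t * sin t * cos (of_int k * t)) has_integral 0) {0..2*pi}" for k :: int
    using diff[OF S[of "k+1"] S[of "k-1"]]
    by (simp add: sin_add sin_diff algebra_simps)
  moreover have "((\<lambda>t. w t * sin t * sin (of_int k * t)) has_integral 0) {0..2*pi}" for k :: int
    using diff[OF C[of "k-1"] C[of "k+1"]]
    by (simp add: cos_add cos_diff algebra_simps)
  ultimately show "trig_orthogonal (\<lambda>t. w t * cos t)" "trig_orthogonal (\<lambda>t. w t * sin t)"
    unfolding trig_orthogonal_def by blast+
qed

text \<open>A polynomial on the plane restricted to the circle is built from \<open>cos\<close> and \<open>sin\<close> by sums and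
products, so multiplying by it preserves orthogonality.  This avoids expanding trigonometric
polynomials.\<close>
lemma trig_orthogonal_mult_polynomial:
  fixes p :: "complex \<Rightarrow> real"
  assumes "real_polynomial_function p" "trig_orthogonal w"
  shows "trig_orthogonal (\<lambda>t. w t * p (cis t))"
  using assms
proof (induction p arbitrary: w rule: real_polynomial_function.induct)
  case (linear f)
  then interpret bounded_linear f by blast
  have "f (cis t) = cos t * f 1 + sin t * f \<i>" for t
  proof -
    have "cis t = cos t *\<^sub>R 1 + sin t *\<^sub>R \<i>" by (simp add: complex_eq_iff)
    then show ?thesis by (simp only: add scaleR real_scaleR_def)
  qed
  then have "(\<lambda>t. w t * f (cis t)) = (\<lambda>t. f 1 * (w t * cos t) + f \<i> * (w t * sin t))"
    by (simp add: fun_eq_iff algebra_simps)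
  then show ?case
    using trig_orthogonal_lincomb[OF trig_orthogonal_mult_cos_sin[OF linear.prems], of "f 1" "f \<i>"]
    by (simp only:)
next
  case (const c)
  then show ?case using trig_orthogonal_lincomb[of w w c 0] by (simp add: mult.commute)
next
  case (add f g)
  then show ?case
    using trig_orthogonal_lincomb[OF add.IH(1) add.IH(2), of w w 1 1] by (simp add: algebra_simps)
next
  case (mult f g)
  show ?case using mult.IH(2)[OF mult.IH(1)[OF mult.prems]] by (simp add: algebra_simps)
qed

text \<open>The quotient map \<open>cis\<close> from the period to the circle is closed because the period is compact;
therefore a function with equal values at the two ends is continuous as a function on the circle.\<close>
lemma continuous_on_circle_lift:
  fixes w :: "real \<Rightarrow> real"
  assumes cont: "continuous_on {0..2*pi} w" and per: "w 0 = w (2*pi)"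
  obtains f :: "complex \<Rightarrow> real"
  where "continuous_on (sphere 0 1) f" "\<And>t. t \<in> {0..2*pi} \<Longrightarrow> f (cis t) = w t"
proof
  let ?f = "\<lambda>z. w (Arg2pi z)"
  show lift: "?f (cis t) = w t" if t: "t \<in> {0..2*pi}" for t
  proof (cases "t = 2*pi")
    case True
    have "cis (2*pi) = 1" by (simp add: complex_eq_iff)
    moreover have "Arg2pi 1 = 0" using Arg2pi_of_real[of 1] by simp
    ultimately show ?thesis using True per by simp
  next
    case False
    then have "Arg2pi (cis t) = t"
      using t by (intro Arg2pi_unique[of 1]) (auto simp: cis_conv_exp)
    then show ?thesis by simp
  qed
  have eq: "?f -` C \<inter> sphere 0 1 = cis ` (w -` C \<inter> {0..2*pi})" (is "?L = ?R") for C
  proof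
    show "?L \<subseteq> ?R"
    proof
      fix z assume z: "z \<in> ?L"
      then have "cis (Arg2pi z) = z"
        using complex_norm_eq_1_exp[of z] by (simp add: cis_conv_exp)
      then show "z \<in> ?R"
        using z Arg2pi[of z] by (intro image_eqI[of _ _ "Arg2pi z"]) auto
    qed
    show "?R \<subseteq> ?L" using lift by auto
  qed
  show "continuous_on (sphere 0 1) ?f"
    unfolding continuous_on_closed_vimage[OF closed_sphere]
  proof (intro allI impI)
    fix C :: "real set" assume "closed C"
    then have "closed (w -` C \<inter> {0..2*pi})"
      using cont continuous_on_closed_vimage[of "{0..2*pi}" w] by simp
    then have "compact (w -` C \<inter> {0..2*pi})"
      by (metis bounded_closed_interval bounded_Int compact_eq_bounded_closed)
    then have "compact (cis ` (w -` C \<inter> {0..2*pi}))"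
      by (intro compact_continuous_image continuous_intros)
    then show "closed (?f -` C \<inter> sphere 0 1)"
      unfolding eq by (rule compact_imp_closed)
  qed
qed

text \<open>By the Stone-Weierstrass theorem \<open>w\<close> is a uniform limit of polynomials \<open>p\<close> on the circle, and
\<open>\<integral> w p = 0\<close>.  Hence \<open>\<integral> w\<^sup>2 = 0\<close> in the limit.\<close>
lemma trig_orthogonal_imp_zero:
  assumes cont: "continuous_on {0..2*pi} w" and per: "w 0 = w (2*pi)"
    and orth: "trig_orthogonal w" and t: "t \<in> {0..2*pi}"
  shows "w t = 0"
proof -
  obtain f :: "complex \<Rightarrow> real" where f: "continuous_on (sphere 0 1) f"
    and fw: "\<And>t. t \<in> {0..2*pi} \<Longrightarrow> f (cis t) = w t"
    using continuous_on_circle_lift[OF cont per] by blast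
  define I where "I = integral {0..2*pi} (\<lambda>t. \<bar>w t\<bar>)"
  have cabs: "continuous_on {0..2*pi} (\<lambda>t. \<bar>w t\<bar>)" and csq: "continuous_on {0..2*pi} (\<lambda>t. w t * w t)"
    using cont by (auto intro!: continuous_intros)
  have I0: "I \<ge> 0" unfolding I_def by (intro integral_nonneg integrable_continuous_real cabs) auto
  have le: "integral {0..2*pi} (\<lambda>t. w t * w t) \<le> e * I" if e: "e > 0" for e
  proof -
    obtain p where p: "real_polynomial_function p" and pe: "\<And>z. z \<in> sphere 0 1 \<Longrightarrow> \<bar>f z - p z\<bar> < e"
      using Stone_Weierstrass_real_polynomial_function[OF compact_sphere f e] by metis
    have "trig_orthogonal (\<lambda>t. w t * p (cis t))"
      by (rule trig_orthogonal_mult_polynomial[OF p orth])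
    then have "((\<lambda>t. w t * p (cis t) * cos (of_int 0 * t)) has_integral 0) {0..2*pi}"
      unfolding trig_orthogonal_def by blast
    then have 0: "((\<lambda>t. w t * p (cis t)) has_integral 0) {0..2*pi}" by simp
    have "((\<lambda>t. w t * w t) has_integral integral {0..2*pi} (\<lambda>t. w t * w t)) {0..2*pi}"
      by (intro integrable_integral integrable_continuous_real csq)
    from has_integral_diff[OF this 0]
    have "((\<lambda>t. w t * w t - w t * p (cis t)) has_integral integral {0..2*pi} (\<lambda>t. w t * w t)) {0..2*pi}"
      by simp
    moreover have "((\<lambda>t. e * \<bar>w t\<bar>) has_integral e * I) {0..2*pi}"
      unfolding I_def by (intro has_integral_mult_right integrable_integral integrable_continuous_real cabs)
    ultimately show ?thesis
    proof (rule has_integral_le)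
      fix t assume "t \<in> {0..2*pi}"
      then have "\<bar>w t - p (cis t)\<bar> \<le> e" using pe[of "cis t"] fw[of t] by fastforce
      have "w t * w t - w t * p (cis t) = w t * (w t - p (cis t))" by (simp add: algebra_simps)
      also have "\<dots> \<le> \<bar>w t\<bar> * \<bar>w t - p (cis t)\<bar>"
        using abs_ge_self[of "w t * (w t - p (cis t))"] by (simp only: abs_mult)
      also have "\<dots> \<le> \<bar>w t\<bar> * e" using \<open>_ \<le> e\<close> by (intro mult_left_mono) auto
      finally show "w t * w t - w t * p (cis t) \<le> e * \<bar>w t\<bar>" by (simp only: mult.commute)
    qed
  qed
  have "integral {0..2*pi} (\<lambda>t. w t * w t) \<le> 0"
  proof (rule field_le_epsilon)
    fix e :: real assume "e > 0"
    then have "integral {0..2*pi} (\<lambda>t. w t * w t) \<le> e / (I + 1) * I" using I0 by (intro le) auto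
    also have "\<dots> \<le> e" using I0 \<open>e > 0\<close> by (simp add: field_simps)
    finally show "integral {0..2*pi} (\<lambda>t. w t * w t) \<le> 0 + e" by simp
  qed
  moreover have "integral {0..2*pi} (\<lambda>t. w t * w t) \<ge> 0"
    by (intro integral_nonneg integrable_continuous_real csq) auto
  ultimately have "integral {0..2*pi} (\<lambda>t. w t * w t) = 0" by simp
  then have "((\<lambda>t. w t * w t) has_integral 0) (cbox 0 (2*pi))"
    using integrable_integral[OF integrable_continuous_real[OF csq]] by simp
  then have "w t * w t = 0"
    using csq t pi_gt_zero
    by (intro has_integral_0_cbox_imp_0[of 0 "2*pi" "\<lambda>t. w t * w t" t]) (auto simp del: pi_gt_zero)
  then show ?thesis by simp
qed

lemma fourier_coeffs_zero_imp_zero: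
  assumes cont: "continuous_on {0..2*pi} w" and per: "w 0 = w (2*pi)"
    and C: "\<And>k. fourier_cos w k = 0" and S: "\<And>k. fourier_sin w k = 0"
    and t: "t \<in> {0..2*pi}"
  shows "w t = 0"
proof (rule trig_orthogonal_imp_zero[OF cont per _ t])
  have nat: "((\<lambda>t. w t * cos (real k * t)) has_integral 0) {0..2*pi}"
    "((\<lambda>t. w t * sin (real k * t)) has_integral 0) {0..2*pi}" for k
  proof -
    have "(\<lambda>t. w t * cos (real k * t)) integrable_on {0..2*pi}"
      "(\<lambda>t. w t * sin (real k * t)) integrable_on {0..2*pi}"
      using cont by (auto intro!: integrable_continuous_real continuous_intros)
    moreover have "integral {0..2*pi} (\<lambda>t. w t * cos (real k * t)) = 0"
      "integral {0..2*pi} (\<lambda>t. w t * sin (real k * t)) = 0"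
      using C[of k] S[of k] by (auto simp: fourier_cos_def fourier_sin_def)
    ultimately show "((\<lambda>t. w t * cos (real k * t)) has_integral 0) {0..2*pi}"
      "((\<lambda>t. w t * sin (real k * t)) has_integral 0) {0..2*pi}"
      by (metis integrable_integral)+
  qed
  show "trig_orthogonal w"
    unfolding trig_orthogonal_def
  proof
    fix k :: int
    show "((\<lambda>t. w t * cos (of_int k * t)) has_integral 0) {0..2*pi} \<and>
          ((\<lambda>t. w t * sin (of_int k * t)) has_integral 0) {0..2*pi}"
    proof (cases "k \<ge> 0")
      case True
      then have k: "real_of_int k = real (nat k)" by simp
      show ?thesis unfolding k by (intro conjI nat)
    next
      case False
      then have k: "real_of_int k = - real (nat (- k))" by simp
      show ?thesis using nat(1)[of "nat (-k)"] has_integral_neg[OF nat(2)[of "nat (-k)"]]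
        unfolding k by simp
    qed
  qed
qed

text \<open>Bessel's inequality: \<open>\<integral> (g - \<Sum>\<alpha>\<^sub>i e\<^sub>i)\<^sup>2 \<ge> 0\<close> bounds the partial sums of \<open>\<alpha>\<^sub>i\<^sup>2\<close> by \<open>\<integral> g\<^sup>2 / L\<close>.\<close>
lemma Bessel_summable:
  fixes e :: "nat \<Rightarrow> real \<Rightarrow> real"
  assumes g: "continuous_on {a..b} g" and e: "\<And>i. continuous_on {a..b} (e i)"
    and orth: "\<And>i j. ((\<lambda>t. e i t * e j t) has_integral (if i = j then L else 0)) {a..b}"
    and L: "L > 0"
  shows "summable (\<lambda>i. (integral {a..b} (\<lambda>t. g t * e i t) / L)\<^sup>2)"
proof -
  define \<alpha> where "\<alpha> i = integral {a..b} (\<lambda>t. g t * e i t) / L" for i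
  define J where "J = integral {a..b} (\<lambda>t. g t * g t)"
  have ge: "((\<lambda>t. g t * e i t) has_integral \<alpha> i * L) {a..b}" for i
    using L unfolding \<alpha>_def
    by (auto intro!: integrable_integral integrable_continuous_real continuous_intros g e)
  have gg: "((\<lambda>t. g t * g t) has_integral J) {a..b}"
    unfolding J_def by (intro integrable_integral integrable_continuous_real continuous_intros g)
  have "(\<Sum>i<n. (\<alpha> i)\<^sup>2) \<le> J / L" for n
  proof -
    have "((\<lambda>t. g t * g t - 2 * (\<Sum>i<n. \<alpha> i * (g t * e i t))
              + (\<Sum>i<n. \<Sum>j<n. \<alpha> i * \<alpha> j * (e i t * e j t)))
       has_integral J - 2 * (\<Sum>i<n. \<alpha> i * (\<alpha> i * L))
              + (\<Sum>i<n. \<Sum>j<n. \<alpha> i * \<alpha> j * (if i = j then L else 0))) {a..b}"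
      by (intro has_integral_add has_integral_diff gg has_integral_mult_right has_integral_sum ge orth) auto
    moreover have "(\<Sum>i<n. \<Sum>j<n. \<alpha> i * \<alpha> j * (if i = j then L else 0)) = (\<Sum>i<n. \<alpha> i * (\<alpha> i * L))"
      by (intro sum.cong) (auto simp: if_distrib cong: if_cong)
    moreover have "g t * g t - 2 * (\<Sum>i<n. \<alpha> i * (g t * e i t))
              + (\<Sum>i<n. \<Sum>j<n. \<alpha> i * \<alpha> j * (e i t * e j t)) = (g t - (\<Sum>i<n. \<alpha> i * e i t))\<^sup>2" for t
    proof -
      have "(\<Sum>i<n. \<alpha> i * (g t * e i t)) = g t * (\<Sum>i<n. \<alpha> i * e i t)"
        by (simp add: sum_distrib_left algebra_simps)
      moreover have "(\<Sum>i<n. \<Sum>j<n. \<alpha> i * \<alpha> j * (e i t * e j t)) = (\<Sum>i<n. \<alpha> i * e i t) * (\<Sum>i<n. \<alpha> i * e i t)"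
        unfolding sum_product by (simp add: algebra_simps)
      ultimately show ?thesis by (simp add: power2_eq_square algebra_simps)
    qed
    ultimately have "((\<lambda>t. (g t - (\<Sum>i<n. \<alpha> i * e i t))\<^sup>2) has_integral J - (\<Sum>i<n. \<alpha> i * (\<alpha> i * L))) {a..b}"
      by simp
    then have "0 \<le> J - (\<Sum>i<n. \<alpha> i * (\<alpha> i * L))"
      by (rule has_integral_nonneg) auto
    also have "(\<Sum>i<n. \<alpha> i * (\<alpha> i * L)) = (\<Sum>i<n. (\<alpha> i)\<^sup>2) * L"
      unfolding sum_distrib_right by (intro sum.cong) (auto simp: power2_eq_square)
    finally show ?thesis using L by (simp add: field_simps)
  qed
  then show ?thesis
    unfolding \<alpha>_def[symmetric]
    by (intro summableI_nonneg_bounded[of _ "J / L"]) auto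
qed

lemma summable_fourier_squares:
  assumes "continuous_on {0..2*pi} g"
  shows "summable (\<lambda>m. (fourier_cos g (m + 2))\<^sup>2)" "summable (\<lambda>m. (fourier_sin g (m + 2))\<^sup>2)"
proof -
  have "((\<lambda>t. cos (real (i + 2) * t) * cos (real (j + 2) * t)) has_integral (if i = j then pi else 0)) {0..2*pi}" for i j
    by (rule has_integral_eq_rhs[OF has_integral_cos_cos]) simp
  then have "summable (\<lambda>m. (integral {0..2*pi} (\<lambda>t. g t * cos (real (m + 2) * t)) / pi)\<^sup>2)"
    by (intro Bessel_summable assms continuous_intros) auto
  moreover have "((\<lambda>t. sin (real (i + 2) * t) * sin (real (j + 2) * t)) has_integral (if i = j then pi else 0)) {0..2*pi}" for i j
    by (rule has_integral_eq_rhs[OF has_integral_sin_sin]) simp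
  then have "summable (\<lambda>m. (integral {0..2*pi} (\<lambda>t. g t * sin (real (m + 2) * t)) / pi)\<^sup>2)"
    by (intro Bessel_summable assms continuous_intros) auto
  ultimately show "summable (\<lambda>m. (fourier_cos g (m + 2))\<^sup>2)" "summable (\<lambda>m. (fourier_sin g (m + 2))\<^sup>2)"
    unfolding fourier_cos_def fourier_sin_def by simp_all
qed

text \<open>Under absolute summability the Fourier series converges uniformly to a continuous function with
the same Fourier coefficients as \<open>v\<close>; by uniqueness it is \<open>v\<close>.\<close>
lemma fourier_series_sums:
  assumes cont: "continuous_on {0..2*pi} v" and per: "v 0 = v (2*pi)"
    and sc: "summable (\<lambda>m. \<bar>fourier_cos v m\<bar>)" and ss: "summable (\<lambda>m. \<bar>fourier_sin v m\<bar>)"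
    and t: "t \<in> {0..2*pi}"
  shows "(\<lambda>m. fourier_cos v (Suc m) * cos (real (Suc m) * t) + fourier_sin v (Suc m) * sin (real (Suc m) * t))
           sums (v t - fourier_cos v 0 / 2)"
proof -
  let ?c = "fourier_cos v" and ?d = "fourier_sin v"
  define h where "h m t = ?c (Suc m) * cos (real (Suc m) * t) + ?d (Suc m) * sin (real (Suc m) * t)" for m t
  define S where "S n t = ?c 0 / 2 + (\<Sum>m<n. h m t)" for n t
  define F where "F t = ?c 0 / 2 + (\<Sum>m. h m t)" for t
  have hb: "norm (h m t) \<le> \<bar>?c (Suc m)\<bar> + \<bar>?d (Suc m)\<bar>" for m t
  proof -
    have "\<bar>?c (Suc m) * cos (real (Suc m) * t)\<bar> \<le> \<bar>?c (Suc m)\<bar>" for m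
      unfolding abs_mult by (rule mult_left_le) auto
    moreover have "\<bar>?d (Suc m) * sin (real (Suc m) * t)\<bar> \<le> \<bar>?d (Suc m)\<bar>" for m
      unfolding abs_mult by (rule mult_left_le) auto
    ultimately show ?thesis
      unfolding h_def real_norm_def by (intro order_trans[OF abs_triangle_ineq] add_mono)
  qed
  have bs: "summable (\<lambda>m. \<bar>?c (Suc m)\<bar> + \<bar>?d (Suc m)\<bar>)"
    using sc ss by (intro summable_add) (simp_all only: summable_Suc_iff[of "\<lambda>m. \<bar>_ m\<bar>"])
  have hs: "summable (\<lambda>m. h m t)" for t
    by (rule summable_comparison_test[OF _ bs]) (use hb in blast)
  have unif: "uniform_limit UNIV S F sequentially"
    unfolding S_def F_def
    by (intro uniform_limit_add uniform_limit_const Weierstrass_m_test[OF _ bs] hb)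
  have Scont: "continuous_on A (S n)" for n A
    unfolding S_def h_def by (intro continuous_intros)
  have Fcont: "continuous_on UNIV F"
    by (rule uniform_limit_theorem[OF _ unif]) (auto intro!: always_eventually Scont)
  have Fper: "F 0 = F (2*pi)"
  proof -
    have "h m 0 = h m (2*pi)" for m unfolding h_def cos_sin_nat_2pi by simp
    then show ?thesis unfolding F_def by simp
  qed
  have Sint: "((\<lambda>t. S n t * q t) has_integral (?c 0 / 2 * q0 + (\<Sum>m<n. ?c (Suc m) * qc (Suc m) + ?d (Suc m) * qs (Suc m)))) {0..2*pi}"
    if "(q has_integral q0) {0..2*pi}" "\<And>m. ((\<lambda>t. cos (real m * t) * q t) has_integral qc m) {0..2*pi}"
      "\<And>m. ((\<lambda>t. sin (real m * t) * q t) has_integral qs m) {0..2*pi}" for q q0 qc qs n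
  proof -
    have "((\<lambda>t. ?c 0 / 2 * q t + (\<Sum>m<n. ?c (Suc m) * (cos (real (Suc m) * t) * q t) + ?d (Suc m) * (sin (real (Suc m) * t) * q t)))
      has_integral (?c 0 / 2 * q0 + (\<Sum>m<n. ?c (Suc m) * qc (Suc m) + ?d (Suc m) * qs (Suc m)))) {0..2*pi}"
      by (intro has_integral_add has_integral_mult_right has_integral_sum finite_lessThan that(1) that(2) that(3))
    then show "((\<lambda>t. S n t * q t) has_integral (?c 0 / 2 * q0 + (\<Sum>m<n. ?c (Suc m) * qc (Suc m) + ?d (Suc m) * qs (Suc m)))) {0..2*pi}"
    proof (rule has_integral_eq[rotated])
      fix t
      show "?c 0 / 2 * q t + (\<Sum>m<n. ?c (Suc m) * (cos (real (Suc m) * t) * q t) + ?d (Suc m) * (sin (real (Suc m) * t) * q t))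
        = S n t * q t"
        unfolding S_def h_def distrib_right sum_distrib_right by (simp only: mult.assoc)
    qed
  qed
  have coeff: "integral {0..2*pi} (\<lambda>t. F t * q t) = J"
    if q: "\<And>t. \<bar>q t\<bar> \<le> 1" "continuous_on UNIV q" and J: "\<And>n. n \<ge> k \<Longrightarrow> ((\<lambda>t. S n t * q t) has_integral J) {0..2*pi}" for q J k
  proof -
    have "uniform_limit {0..2*pi} (\<lambda>n t. S n t * q t) (\<lambda>t. F t * q t) sequentially"
    proof (rule uniform_limitI)
      fix e :: real assume "e > 0"
      with unif have "\<forall>\<^sub>F n in sequentially. \<forall>x\<in>UNIV. dist (S n x) (F x) < e"
        using uniform_limitD by blast
      then show "\<forall>\<^sub>F n in sequentially. \<forall>x\<in>{0..2*pi}. dist (S n x * q x) (F x * q x) < e"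
      proof eventually_elim
        case (elim n)
        show ?case
        proof
          fix x
          have "dist (S n x * q x) (F x * q x) = dist (S n x) (F x) * \<bar>q x\<bar>"
            by (simp add: dist_real_def left_diff_distrib[symmetric] abs_mult)
          also have "\<dots> \<le> dist (S n x) (F x)" using q(1)[of x] by (intro mult_left_le) auto
          finally show "dist (S n x * q x) (F x * q x) < e" using elim by (auto intro: le_less_trans)
        qed
      qed
    qed
    moreover have "continuous_on {0..2*pi} (\<lambda>t. S n t * q t)" for n
      by (rule continuous_on_mult[OF Scont continuous_on_subset[OF q(2)]]) auto
    ultimately obtain I I' where I: "\<And>n. ((\<lambda>t. S n t * q t) has_integral I n) {0..2*pi}"
        and I': "((\<lambda>t. F t * q t) has_integral I') {0..2*pi}" and lim: "I \<longlonglongrightarrow> I'"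
      by (rule uniform_limit_integral[OF _ _ trivial_limit_sequentially, where f = "\<lambda>n t. S n t * q t" and g = "\<lambda>t. F t * q t"]) (rule that)
    have "\<forall>\<^sub>F n in sequentially. I n = J"
      using eventually_ge_at_top[of k] by eventually_elim (use I J has_integral_unique in blast)
    then have "I \<longlonglongrightarrow> J" by (rule tendsto_eventually)
    then have "I' = J" using lim LIMSEQ_unique by blast
    then show ?thesis using I' by (simp add: integral_unique)
  qed
  have one: "((\<lambda>t. cos (real j * t)) has_integral (if j = 0 then 2*pi else 0)) {0..2*pi}" for j
    using has_integral_cos_int[of "int j"] by simp
  have FC: "fourier_cos F j = ?c j" for j
  proof -
    have "integral {0..2*pi} (\<lambda>t. F t * cos (real j * t)) = pi * ?c j"
    proof (rule coeff[of _ j])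
      fix n assume n: "n \<ge> j"
      show "((\<lambda>t. S n t * cos (real j * t)) has_integral pi * ?c j) {0..2*pi}"
      proof (rule has_integral_eq_rhs[OF Sint[OF one has_integral_cos_cos has_integral_sin_cos]])
        show "pi * ?c j = ?c 0 / 2 * (if j = 0 then 2*pi else 0) +
          (\<Sum>m<n. ?c (Suc m) * (if Suc m = j then if Suc m = 0 then 2 * pi else pi else 0) + ?d (Suc m) * 0)"
        proof (cases j)
          case (Suc i)
          then have "(\<Sum>m<n. ?c (Suc m) * (if Suc m = j then if Suc m = 0 then 2 * pi else pi else 0) + ?d (Suc m) * 0)
             = (\<Sum>m<n. if m = i then ?c (Suc m) * pi else 0)"
            by (intro sum.cong) auto
          also have "\<dots> = ?c j * pi" using n Suc by simp
          finally show ?thesis using Suc by simp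
        qed auto
      qed
    qed (auto intro!: continuous_intros)
    then show ?thesis by (simp add: fourier_cos_def[of F])
  qed
  have FS: "fourier_sin F j = ?d j" for j
  proof (cases j)
    case 0
    then show ?thesis by (simp add: fourier_sin_def)
  next
    case (Suc i)
    have one': "((\<lambda>t. sin (real j * t)) has_integral 0) {0..2*pi}"
      using has_integral_sin_int[of "int j"] by simp
    have cs: "((\<lambda>t. cos (real m * t) * sin (real j * t)) has_integral 0) {0..2*pi}" for m
      using has_integral_sin_cos[of j m] by (simp add: mult.commute)
    have "integral {0..2*pi} (\<lambda>t. F t * sin (real j * t)) = pi * ?d j"
    proof (rule coeff[of _ j])
      fix n assume n: "n \<ge> j"
      show "((\<lambda>t. S n t * sin (real j * t)) has_integral pi * ?d j) {0..2*pi}"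
      proof (rule has_integral_eq_rhs[OF Sint[OF one' cs has_integral_sin_sin]])
        have "(\<Sum>m<n. ?c (Suc m) * 0 + ?d (Suc m) * (if Suc m = j \<and> Suc m \<noteq> 0 then pi else 0))
             = (\<Sum>m<n. if m = i then ?d (Suc m) * pi else 0)"
          using Suc by (intro sum.cong) auto
        also have "\<dots> = ?d j * pi" using n Suc by simp
        finally show "pi * ?d j = ?c 0 / 2 * 0 +
          (\<Sum>m<n. ?c (Suc m) * 0 + ?d (Suc m) * (if Suc m = j \<and> Suc m \<noteq> 0 then pi else 0))" by simp
      qed
    qed (auto intro!: continuous_intros)
    then show ?thesis by (simp add: fourier_sin_def[of F])
  qed
  have Fc: "continuous_on {0..2*pi} F" using Fcont continuous_on_subset by blast
  have int: "(\<lambda>t. f t * cos (real k * t)) integrable_on {0..2*pi}"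
    "(\<lambda>t. f t * sin (real k * t)) integrable_on {0..2*pi}" if "continuous_on {0..2*pi} f" for f k
    using that by (auto intro!: integrable_continuous_real continuous_intros)
  have "v t - F t = 0"
  proof (rule fourier_coeffs_zero_imp_zero[OF _ _ _ _ t])
    show "continuous_on {0..2*pi} (\<lambda>t. v t - F t)" by (intro continuous_intros cont Fc)
    show "v 0 - F 0 = v (2*pi) - F (2*pi)" using per Fper by simp
    show "fourier_cos (\<lambda>t. v t - F t) k = 0" for k
    proof -
      have "fourier_cos (\<lambda>t. v t - F t) k = ?c k - fourier_cos F k"
        unfolding fourier_cos_def left_diff_distrib integral_diff[OF int(1)[OF cont] int(1)[OF Fc]]
        by (rule right_diff_distrib)
      then show ?thesis unfolding FC by simp
    qed
    show "fourier_sin (\<lambda>t. v t - F t) k = 0" for k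
    proof -
      have "fourier_sin (\<lambda>t. v t - F t) k = ?d k - fourier_sin F k"
        unfolding fourier_sin_def left_diff_distrib integral_diff[OF int(2)[OF cont] int(2)[OF Fc]]
        by (rule right_diff_distrib)
      then show ?thesis unfolding FS by simp
    qed
  qed
  then have "(\<Sum>m. h m t) = v t - ?c 0 / 2" unfolding F_def by linarith
  with summable_sums[OF hs[of t]] have "(\<lambda>m. h m t) sums (v t - ?c 0 / 2)" by (simp only:)
  then show ?thesis unfolding h_def .
qed

text \<open>Square summability of \<open>x\<close> suffices since \<open>k / (k\<^sup>2 - 1) \<le> 2 / k\<close> is square summable as well.\<close>
lemma summable_resolvent_weighted:
  fixes x :: "nat \<Rightarrow> real"
  assumes "summable (\<lambda>m. (x m)\<^sup>2)"
  shows "summable (\<lambda>m. \<bar>real (m + 2) * (x m / (real (m + 2) ^ 2 - 1))\<bar>)"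
proof (rule summable_comparison_test)
  show "\<exists>N. \<forall>n\<ge>N. norm \<bar>real (n + 2) * (x n / (real (n + 2) ^ 2 - 1))\<bar>
      \<le> (x n)\<^sup>2 / 2 + 2 * inverse (real (n + 2) ^ 2)"
  proof (intro exI[of _ 0] allI impI)
    fix n :: nat
    define k where "k = real (n + 2)"
    have k: "k \<ge> 2" by (simp add: k_def)
    then have k2: "k\<^sup>2 \<ge> 4" using power_mono[of 2 k 2] by simp
    define y where "y = k / (k\<^sup>2 - 1)"
    have y: "0 \<le> y" "y \<le> 2 / k" using k k2 by (simp_all add: y_def divide_simps power2_eq_square)
    have "y\<^sup>2 \<le> (2 / k)\<^sup>2" using y by (intro power_mono) auto
    then have "y\<^sup>2 / 2 \<le> 2 * inverse (k\<^sup>2)" by (simp add: power_divide field_simps)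
    moreover have "\<bar>x n\<bar> * y \<le> (x n)\<^sup>2 / 2 + y\<^sup>2 / 2"
      using zero_le_power2[of "\<bar>x n\<bar> - y"] by (simp add: power2_diff)
    moreover have "\<bar>k * (x n / (k\<^sup>2 - 1))\<bar> = \<bar>x n\<bar> * y"
      using k k2 by (simp add: y_def abs_mult)
    ultimately have "\<bar>k * (x n / (k\<^sup>2 - 1))\<bar> \<le> (x n)\<^sup>2 / 2 + 2 * inverse (k\<^sup>2)" by linarith
    then show "norm \<bar>real (n + 2) * (x n / (real (n + 2) ^ 2 - 1))\<bar>
      \<le> (x n)\<^sup>2 / 2 + 2 * inverse (real (n + 2) ^ 2)"
      unfolding k_def[symmetric] real_norm_def abs_idempotent .
  qed
  have "summable (\<lambda>n. inverse (real (n + 2) ^ 2))"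
    by (rule summable_iff_shift[of "\<lambda>n. inverse (real n ^ 2)" 2, THEN iffD2]) (rule inverse_power_summable, simp)
  then show "summable (\<lambda>n. (x n)\<^sup>2 / 2 + 2 * inverse (real (n + 2) ^ 2))"
    by (rule summable_add[OF summable_divide[OF assms] summable_mult])
qed

lemma summable_resolvent:
  fixes x :: "nat \<Rightarrow> real"
  assumes "summable (\<lambda>m. (x m)\<^sup>2)"
  shows "summable (\<lambda>m. \<bar>x m / (real (m + 2) ^ 2 - 1)\<bar>)"
proof (rule summable_comparison_test[OF _ summable_resolvent_weighted[OF assms]])
  have "\<bar>x n / (real (n + 2) ^ 2 - 1)\<bar> \<le> real (n + 2) * \<bar>x n / (real (n + 2) ^ 2 - 1)\<bar>" for n
    using mult_right_mono[of 1 "real (n + 2)" "\<bar>x n / (real (n + 2) ^ 2 - 1)\<bar>"] by simp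
  then show "\<exists>N. \<forall>n\<ge>N. norm \<bar>x n / (real (n + 2) ^ 2 - 1)\<bar> \<le> \<bar>real (n + 2) * (x n / (real (n + 2) ^ 2 - 1))\<bar>"
    by (intro exI[of _ 0] allI impI) (simp add: abs_mult)
qed

lemma summable_trig_series:
  fixes x y :: "nat \<Rightarrow> real"
  assumes "summable (\<lambda>m. \<bar>x m\<bar>)" "summable (\<lambda>m. \<bar>y m\<bar>)"
  shows "summable (\<lambda>m. x m * cos (\<theta> m) + y m * sin (\<theta> m))"
proof (rule summable_add)
  show "summable (\<lambda>m. x m * cos (\<theta> m))"
    by (rule summable_comparison_test[OF _ assms(1)]) (auto simp: abs_mult intro!: mult_left_le)
  show "summable (\<lambda>m. y m * sin (\<theta> m))"
    by (rule summable_comparison_test[OF _ assms(2)]) (auto simp: abs_mult intro!: mult_left_le)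
qed

lemma fourier_coeffs_derivative:
  assumes v: "continuous_on {0..2*pi} v" and v': "continuous_on {0..2*pi} v'"
    and der: "\<And>t. t \<in> {0<..<2*pi} \<Longrightarrow> (v has_real_derivative v' t) (at t)"
    and per: "v 0 = v (2*pi)"
  shows "fourier_cos v' m = real m * fourier_sin v m" "fourier_sin v' m = - real m * fourier_cos v m"
proof -
  have cos': "((\<lambda>t. cos (real m * t)) has_real_derivative - (real m * sin (real m * t))) (at t)"
    and sin': "((\<lambda>t. sin (real m * t)) has_real_derivative real m * cos (real m * t)) (at t)" for t
    by (auto intro!: derivative_eq_intros)
  have A: "((\<lambda>t. v' t * cos (real m * t) + - (real m * sin (real m * t)) * v t) has_integral
      v (2*pi) * cos (real m * (2*pi)) - v 0 * cos (real m * 0)) {0..2*pi}"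
  proof (rule fundamental_theorem_of_calculus_interior)
    show "continuous_on {0..2*pi} (\<lambda>t. v t * cos (real m * t))" by (intro continuous_intros v)
    show "((\<lambda>t. v t * cos (real m * t)) has_vector_derivative
        v' t * cos (real m * t) + - (real m * sin (real m * t)) * v t) (at t)" if "t \<in> {0<..<2*pi}" for t
      using DERIV_mult[OF der[OF that] cos'] by (simp only: has_real_derivative_iff_has_vector_derivative)
  qed simp
  have B: "((\<lambda>t. v' t * sin (real m * t) + real m * cos (real m * t) * v t) has_integral
      v (2*pi) * sin (real m * (2*pi)) - v 0 * sin (real m * 0)) {0..2*pi}"
  proof (rule fundamental_theorem_of_calculus_interior)
    show "continuous_on {0..2*pi} (\<lambda>t. v t * sin (real m * t))" by (intro continuous_intros v)
    show "((\<lambda>t. v t * sin (real m * t)) has_vector_derivative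
        v' t * sin (real m * t) + real m * cos (real m * t) * v t) (at t)" if "t \<in> {0<..<2*pi}" for t
      using DERIV_mult[OF der[OF that] sin'] by (simp only: has_real_derivative_iff_has_vector_derivative)
  qed simp
  have C: "((\<lambda>t. real m * (v t * sin (real m * t))) has_integral real m * integral {0..2*pi} (\<lambda>t. v t * sin (real m * t))) {0..2*pi}"
   and D: "((\<lambda>t. real m * (v t * cos (real m * t))) has_integral real m * integral {0..2*pi} (\<lambda>t. v t * cos (real m * t))) {0..2*pi}"
    by (intro has_integral_mult_right integrable_integral integrable_continuous_real continuous_intros v)+
  have "((\<lambda>t. v' t * cos (real m * t)) has_integral ((v (2*pi) * cos (real m * (2*pi)) - v 0 * cos (real m * 0)) + real m * integral {0..2*pi} (\<lambda>t. v t * sin (real m * t)))) {0..2*pi}"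
    by (rule has_integral_eq[OF _ has_integral_add[OF A C]]) simp
  from integral_unique[OF this] show "fourier_cos v' m = real m * fourier_sin v m"
    using per unfolding fourier_cos_def fourier_sin_def cos_sin_nat_2pi by simp
  have "((\<lambda>t. v' t * sin (real m * t)) has_integral ((v (2*pi) * sin (real m * (2*pi)) - v 0 * sin (real m * 0)) - real m * integral {0..2*pi} (\<lambda>t. v t * cos (real m * t)))) {0..2*pi}"
    by (rule has_integral_eq[OF _ has_integral_diff[OF B D]]) simp
  from integral_unique[OF this] show "fourier_sin v' m = - real m * fourier_cos v m"
    using per unfolding fourier_cos_def fourier_sin_def cos_sin_nat_2pi by simp
qed

text \<open>The coefficients of order at least two are those of a solution of \<open>v'' + v = g\<close>, where \<open>c\<close> and \<open>d\<close>
are the coefficients of \<open>g\<close>.  The end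
conditions provide the two relations for the remaining ones: the series of \<open>v\<close> and the series of
\<open>v'\<close> both have the sum \<open>0\<close> at \<open>t = 0\<close>.\<close>
lemma resolvent_fourier_series:
  fixes c d :: "nat \<Rightarrow> real"
  assumes v: "continuous_on {0..2*pi} v" and v': "continuous_on {0..2*pi} v'"
    and der: "\<And>t. t \<in> {0<..<2*pi} \<Longrightarrow> (v has_real_derivative v' t) (at t)"
    and v0: "v 0 = 0" "v (2*pi) = 0" and v'0: "v' 0 = 0" "v' (2*pi) = 0"
    and c2: "summable (\<lambda>m. (c (m + 2))\<^sup>2)" and d2: "summable (\<lambda>m. (d (m + 2))\<^sup>2)"
    and coeffs: "\<And>m. fourier_cos v (m + 2) = - (c (m + 2) / (real (m + 2) ^ 2 - 1))"
      "\<And>m. fourier_sin v (m + 2) = - (d (m + 2) / (real (m + 2) ^ 2 - 1))"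
  shows "fourier_cos v 0 / 2 + fourier_cos v 1 = (\<Sum>m. c (m + 2) / (real (m + 2) ^ 2 - 1))"
    and "fourier_sin v 1 = (\<Sum>m. real (m + 2) / (real (m + 2) ^ 2 - 1) * d (m + 2))"
    and "\<And>t. t \<in> {0..2*pi} \<Longrightarrow> v t = fourier_cos v 0 / 2 + fourier_cos v 1 * cos t + fourier_sin v 1 * sin t
        - (\<Sum>m. c (m + 2) / (real (m + 2) ^ 2 - 1) * cos (real (m + 2) * t)
               + d (m + 2) / (real (m + 2) ^ 2 - 1) * sin (real (m + 2) * t))"
proof -
  have shift: "summable (\<lambda>m. \<bar>f m\<bar>)" if "summable (\<lambda>m. \<bar>f (m + 2)\<bar>)" for f :: "nat \<Rightarrow> real"
    using that by (simp only: summable_iff_shift[of "\<lambda>m. \<bar>f m\<bar>" 2])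
  let ?v = "\<lambda>m. fourier_cos v m" and ?w = "\<lambda>m. fourier_sin v m"
  let ?C = "\<lambda>m. c (m + 2) / (real (m + 2) ^ 2 - 1)" and ?D = "\<lambda>m. d (m + 2) / (real (m + 2) ^ 2 - 1)"
  have sums: "summable (\<lambda>m. \<bar>fourier_cos v m\<bar>)" "summable (\<lambda>m. \<bar>fourier_sin v m\<bar>)"
  proof -
    have "summable (\<lambda>m. \<bar>?v (m + 2)\<bar>)" "summable (\<lambda>m. \<bar>?w (m + 2)\<bar>)"
      unfolding coeffs abs_minus using summable_resolvent[OF c2] summable_resolvent[OF d2] .
    then show "summable (\<lambda>m. \<bar>?v m\<bar>)" "summable (\<lambda>m. \<bar>?w m\<bar>)"
      using shift by blast+
  qed
  have per: "v 0 = v (2*pi)" using v0 by simp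
  have deriv_coeffs: "fourier_cos v' m = real m * fourier_sin v m"
    "fourier_sin v' m = - real m * fourier_cos v m" for m
    by (rule fourier_coeffs_derivative[OF v v' _ per], erule der)+
  have sums': "summable (\<lambda>m. \<bar>fourier_cos v' m\<bar>)" "summable (\<lambda>m. \<bar>fourier_sin v' m\<bar>)"
  proof -
    have "summable (\<lambda>m. \<bar>fourier_cos v' (m + 2)\<bar>)" "summable (\<lambda>m. \<bar>fourier_sin v' (m + 2)\<bar>)"
      unfolding deriv_coeffs coeffs mult_minus_left mult_minus_right abs_minus minus_minus
      by (rule summable_resolvent_weighted[OF d2], rule summable_resolvent_weighted[OF c2])
    then show "summable (\<lambda>m. \<bar>fourier_cos v' m\<bar>)" "summable (\<lambda>m. \<bar>fourier_sin v' m\<bar>)"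
      using shift by blast+
  qed
  have split: "(\<Sum>m. h (Suc m)) = h 1 + (\<Sum>m. h (m + 2))"
    if "summable (\<lambda>m. h (Suc m))" for h :: "nat \<Rightarrow> real"
    using suminf_split_head[OF that] by simp
  have ser: "v t = ?v 0 / 2 + ?v 1 * cos t + ?w 1 * sin t
        - (\<Sum>m. ?C m * cos (real (m + 2) * t) + ?D m * sin (real (m + 2) * t))" if "t \<in> {0..2*pi}" for t
  proof -
    let ?h = "\<lambda>m. ?v m * cos (real m * t) + ?w m * sin (real m * t)"
    have S: "(\<lambda>m. ?h (Suc m)) sums (v t - ?v 0 / 2)"
      by (rule fourier_series_sums[OF v per sums that])
    have 1: "v t - ?v 0 / 2 = ?h 1 + (\<Sum>m. ?h (m + 2))"
      using sums_unique[OF S] split[of ?h, OF sums_summable[OF S]] by (simp only:)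
    have 2: "?h (m + 2) = - (?C m * cos (real (m + 2) * t) + ?D m * sin (real (m + 2) * t))" for m
    proof -
      have "(- x) * y + (- z) * w = - (x * y + z * w)" for x y z w :: real by simp
      then show ?thesis unfolding coeffs .
    qed
    have 3: "(\<Sum>m. - (?C m * cos (real (m + 2) * t) + ?D m * sin (real (m + 2) * t)))
        = - (\<Sum>m. ?C m * cos (real (m + 2) * t) + ?D m * sin (real (m + 2) * t))"
      by (rule suminf_minus[OF summable_trig_series[OF summable_resolvent[OF c2] summable_resolvent[OF d2]]])
    show ?thesis using 1 unfolding 2 3 by simp
  qed
  then show "\<And>t. t \<in> {0..2*pi} \<Longrightarrow> v t = ?v 0 / 2 + ?v 1 * cos t + ?w 1 * sin t
        - (\<Sum>m. ?C m * cos (real (m + 2) * t) + ?D m * sin (real (m + 2) * t))" .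
  show "?v 0 / 2 + ?v 1 = (\<Sum>m. ?C m)"
    using ser[of 0] v0 by simp
  let ?h = "\<lambda>m. fourier_cos v' m * cos (real m * 0) + fourier_sin v' m * sin (real m * 0)"
  have S: "(\<lambda>m. ?h (Suc m)) sums (v' 0 - fourier_cos v' 0 / 2)"
    by (rule fourier_series_sums[OF v' _ sums']) (use v'0 in auto)
  have 1: "v' 0 - fourier_cos v' 0 / 2 = ?h 1 + (\<Sum>m. ?h (m + 2))"
    using sums_unique[OF S] split[of ?h, OF sums_summable[OF S]] by (simp only:)
  have 2: "?h (m + 2) = - (real (m + 2) / (real (m + 2) ^ 2 - 1) * d (m + 2))" for m
    unfolding deriv_coeffs coeffs by simp
  have 3: "(\<Sum>m. - (real (m + 2) / (real (m + 2) ^ 2 - 1) * d (m + 2)))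
      = - (\<Sum>m. real (m + 2) / (real (m + 2) ^ 2 - 1) * d (m + 2))"
  proof (rule suminf_minus)
    show "summable (\<lambda>m. real (m + 2) / (real (m + 2) ^ 2 - 1) * d (m + 2))"
      using summable_rabs_cancel[OF summable_resolvent_weighted[OF d2]] by simp
  qed
  have 4: "?h 1 = ?w 1" using deriv_coeffs(1)[of 1] by simp
  show "?w 1 = (\<Sum>m. real (m + 2) / (real (m + 2) ^ 2 - 1) * d (m + 2))"
    using 1 v'0 deriv_coeffs(1)[of 0] unfolding 2 3 4 by simp
qed

text \<open>The periodic solution of \<open>v'' + v = g\<close> with \<open>v(0) = v'(0) = 0\<close>, when the first Fourier
coefficients of \<open>g\<close> vanish.\<close>
definition resolvent_series :: "(real \<Rightarrow> real) \<Rightarrow> real \<Rightarrow> real" where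
  "resolvent_series g t = fourier_cos g 0 / 2
     + (- (fourier_cos g 0 / 2) + (\<Sum>m. fourier_cos g (m + 2) / (real (m + 2) ^ 2 - 1))) * cos t
     + (\<Sum>m. real (m + 2) / (real (m + 2) ^ 2 - 1) * fourier_sin g (m + 2)) * sin t
     - (\<Sum>m. fourier_cos g (m + 2) / (real (m + 2) ^ 2 - 1) * cos (real (m + 2) * t)
            + fourier_sin g (m + 2) / (real (m + 2) ^ 2 - 1) * sin (real (m + 2) * t))"

lemma resolvent_series_periodic: "resolvent_series g (t + 2 * pi) = resolvent_series g t"
proof -
  have "cos (real k * (t + 2 * pi)) = cos (real k * t)" "sin (real k * (t + 2 * pi)) = sin (real k * t)" for k
    using cos_sin_nat_2pi[of k] by (simp_all add: distrib_left cos_add sin_add)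
  then show ?thesis unfolding resolvent_series_def by (simp only: cos_periodic sin_periodic)
qed

section \<open>A Liouville theorem in dimension at most two\<close>

lemma integrable_continuous_compact_support:
  fixes f :: "'a::euclidean_space \<Rightarrow> real"
  assumes "continuous_on UNIV f" "\<And>x. norm x > r \<Longrightarrow> f x = 0"
  shows "f integrable_on UNIV"
proof -
  obtain a :: 'a where a: "cball 0 r \<subseteq> cbox (- a) a"
    using bounded_subset_cbox_symmetric[OF bounded_cball] by blast
  have "f integrable_on cbox (- a) a"
    using assms(1) by (intro integrable_continuous) (auto intro: continuous_on_subset)
  then show ?thesis
  proof (rule integrable_on_superset)
    fix x assume "x \<notin> cbox (- a) a"
    then have "x \<notin> cball 0 r" using a by blast
    then show "f x = 0" using assms(2) by simp
  qed simp
qed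

lemma has_integral_translate_UNIV:
  fixes f :: "'a::euclidean_space \<Rightarrow> real"
  assumes "continuous_on UNIV f" "\<And>x. norm x > r \<Longrightarrow> f x = 0"
  shows "((\<lambda>x. f (x + c)) has_integral integral UNIV f) UNIV"
proof -
  obtain a :: 'a where a: "cball 0 r \<subseteq> cbox (- a) a"
    using bounded_subset_cbox_symmetric[OF bounded_cball] by blast
  have out: "f x = 0" if "x \<notin> cbox (- a) a" for x
  proof -
    have "x \<notin> cball 0 r" using a that by blast
    then show "f x = 0" using assms(2) by simp
  qed
  define I where "I = integral (cbox (- a) a) f"
  have I: "(f has_integral I) (cbox (- a) a)"
    unfolding I_def using assms(1)
    by (intro integrable_integral integrable_continuous) (auto intro: continuous_on_subset)
  then have "(f has_integral I) UNIV"
    by (rule has_integral_on_superset) (use out in auto)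
  then have eq: "integral UNIV f = I" by (rule integral_unique)
  have "((\<lambda>x. f (x + c)) has_integral I) (cbox (- a - c) (a - c))"
    by (rule has_integral_shift_cbox[OF I])
  then have "((\<lambda>x. f (x + c)) has_integral I) UNIV"
  proof (rule has_integral_on_superset)
    fix x assume "x \<notin> cbox (- a - c) (a - c)"
    then have "x + c \<notin> cbox (- a) a" by (auto simp: mem_box algebra_simps)
    then show "f (x + c) = 0" by (rule out)
  qed simp
  then show ?thesis by (simp add: eq)
qed

lemma has_real_derivative_along_line:
  fixes X X' :: "'a::real_normed_vector \<Rightarrow> real"
  assumes "\<And>x. ((\<lambda>s. X (x + s *\<^sub>R e)) has_real_derivative X' x) (at 0)"
  shows "((\<lambda>s. X (x + s *\<^sub>R e)) has_real_derivative X' (x + s *\<^sub>R e)) (at s)"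
proof -
  have "((\<lambda>h. X (x + s *\<^sub>R e + h *\<^sub>R e)) has_real_derivative X' (x + s *\<^sub>R e)) (at 0)"
    by (rule assms)
  then have "((\<lambda>h. X (x + (h + s) *\<^sub>R e)) has_real_derivative X' (x + s *\<^sub>R e)) (at 0)"
    by (simp add: algebra_simps)
  then show ?thesis
    using DERIV_shift[of "\<lambda>s. X (x + s *\<^sub>R e)" "X' (x + s *\<^sub>R e)" 0 s] by simp
qed

text \<open>The integral of \<open>X(x + s e)\<close> over \<open>x\<close> does not depend on \<open>s\<close>, by translation invariance; differentiating
at \<open>s = 0\<close> under the integral sign gives the claim.  This is the divergence theorem for compactly
supported fields, one coordinate at a time.\<close>
lemma has_integral_directional_derivative_0:
  fixes X X' :: "'a::euclidean_space \<Rightarrow> real"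
  assumes X: "continuous_on UNIV X" and X': "continuous_on UNIV X'"
    and deriv: "\<And>x. ((\<lambda>s. X (x + s *\<^sub>R e)) has_real_derivative X' x) (at 0)"
    and supp: "\<And>x. norm x > r \<Longrightarrow> X x = 0"
  shows "(X' has_integral 0) UNIV"
proof -
  obtain a :: 'a where a: "cball 0 (r + norm e) \<subseteq> cbox (- a) a"
    using bounded_subset_cbox_symmetric[OF bounded_cball] by blast
  let ?B = "cbox (- a) a" and ?U = "{-1<..<1::real}"
  have out: "X (x + s *\<^sub>R e) = 0" if "x \<notin> ?B" "\<bar>s\<bar> \<le> 1" for x s
  proof (rule supp)
    have "x \<notin> cball 0 (r + norm e)" using a that(1) by blast
    then have "norm x > r + norm e" by simp
    moreover have "norm (s *\<^sub>R e) \<le> norm e" using that(2) by (simp add: mult_left_le_one_le)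
    moreover have "norm x \<le> norm (x + s *\<^sub>R e) + norm (s *\<^sub>R e)"
      by (metis add_diff_cancel_right' norm_triangle_ineq4)
    ultimately show "norm (x + s *\<^sub>R e) > r" by linarith
  qed
  have out': "X' x = 0" if "x \<notin> ?B" for x
  proof -
    have "((\<lambda>s. X (x + s *\<^sub>R e)) has_real_derivative 0) (at 0)"
      by (rule has_field_derivative_transform_within_open[OF DERIV_const open_greaterThanLessThan[of "-1" 1]])
        (use out[OF that] in auto)
    then show ?thesis using deriv DERIV_unique by blast
  qed
  have const: "integral ?B (\<lambda>x. X (x + s *\<^sub>R e)) = integral UNIV X" if "s \<in> ?U" for s
  proof -
    have "((\<lambda>x. if x \<in> ?B then X (x + s *\<^sub>R e) else 0) has_integral integral UNIV X) UNIV"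
      by (rule has_integral_eq[OF _ has_integral_translate_UNIV[OF X supp, where c = "s *\<^sub>R e"]])
        (use out that in auto)
    then have "((\<lambda>x. X (x + s *\<^sub>R e)) has_integral integral UNIV X) ?B"
      unfolding has_integral_restrict_UNIV .
    then show ?thesis by (rule integral_unique)
  qed
  have cont: "continuous_on A (\<lambda>y. f (g y))" if "continuous_on UNIV f" "continuous_on A g"
    for f :: "'a \<Rightarrow> real" and g :: "'b::topological_space \<Rightarrow> 'a" and A
    by (rule continuous_on_compose2[OF that]) simp
  have "((\<lambda>s. integral ?B (\<lambda>x. X (x + s *\<^sub>R e))) has_field_derivative
      integral ?B (\<lambda>x. X' (x + 0 *\<^sub>R e))) (at 0 within ?U)"
  proof (rule leibniz_rule_field_derivative[where f = "\<lambda>s x. X (x + s *\<^sub>R e)" and fx = "\<lambda>s x. X' (x + s *\<^sub>R e)"])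
    show "((\<lambda>s. X (x + s *\<^sub>R e)) has_field_derivative X' (x + s *\<^sub>R e)) (at s within ?U)" for s x
      using has_real_derivative_along_line[OF deriv] by (rule has_field_derivative_at_within)
    show "(\<lambda>x. X (x + s *\<^sub>R e)) integrable_on ?B" for s
      by (intro integrable_continuous cont[OF X] continuous_intros)
    show "continuous_on (?U \<times> ?B) (\<lambda>(s, x). X' (x + s *\<^sub>R e))"
      unfolding case_prod_unfold by (intro cont[OF X'] continuous_intros)
  qed auto
  then have "((\<lambda>s. integral ?B (\<lambda>x. X (x + s *\<^sub>R e))) has_field_derivative integral ?B X') (at 0)"
    by (simp add: at_within_open[of 0 ?U])
  moreover have "((\<lambda>s. integral ?B (\<lambda>x. X (x + s *\<^sub>R e))) has_field_derivative 0) (at 0)"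
    by (rule has_field_derivative_transform_within_open[OF DERIV_const open_greaterThanLessThan[of "-1" 1]])
      (use const in auto)
  ultimately have "integral ?B X' = 0" by (rule DERIV_unique)
  moreover have "X' integrable_on ?B"
    using X' by (intro integrable_continuous) (auto intro: continuous_on_subset)
  ultimately have "(X' has_integral 0) ?B" by (metis integrable_integral)
  then show ?thesis by (rule has_integral_on_superset) (use out' in auto)
qed

lemma DERIV_max_0_power2: "((\<lambda>s::real. (max 0 s)\<^sup>2) has_real_derivative 2 * max 0 s) (at s)"
proof -
  consider "s > 0" | "s < 0" | "s = 0" by linarith
  then show ?thesis
  proof cases
    case 1
    then have "((\<lambda>s. s\<^sup>2) has_real_derivative 2 * max 0 s) (at s)"
      by (auto intro!: derivative_eq_intros)
    then show ?thesis
      by (rule has_field_derivative_transform_within_open[OF _ open_greaterThan[of 0]]) (use 1 in auto)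
  next
    case 2
    then have "((\<lambda>s. 0) has_real_derivative 2 * max 0 s) (at s)" by simp
    then show ?thesis
      by (rule has_field_derivative_transform_within_open[OF _ open_lessThan[of 0]]) (use 2 in auto)
  next
    case 3
    have "((\<lambda>h. (max 0 h)\<^sup>2 / h) \<longlongrightarrow> 0) (at (0::real))"
    proof (rule Lim_null_comparison[where g = "\<lambda>h. \<bar>h\<bar>"])
      show "\<forall>\<^sub>F h::real in at 0. norm ((max 0 h)\<^sup>2 / h) \<le> \<bar>h\<bar>"
        by (auto simp: max_def power2_eq_square)
      show "((\<lambda>h. \<bar>h\<bar>) \<longlongrightarrow> 0) (at (0::real))" by (intro tendsto_eq_intros) auto
    qed
    then show ?thesis using 3 by (simp add: DERIV_def)
  qed
qed

text \<open>The quotient \<open>m(2 - s) / (m(2 - s) + m(s - 1))\<close> with \<open>m(s) = (max 0 s)\<^sup>2\<close> has all the properties: its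
denominator is positive because \<open>2 - s\<close> and \<open>s - 1\<close> cannot both be nonpositive.\<close>
lemma C1_cutoff_exists:
  obtains \<eta> \<eta>' :: "real \<Rightarrow> real" and C
  where "\<And>s. (\<eta> has_real_derivative \<eta>' s) (at s)" "continuous_on UNIV \<eta>'"
    "\<And>s. 0 \<le> \<eta> s" "\<And>s. \<eta> s \<le> 1" "\<And>s. s \<le> 1 \<Longrightarrow> \<eta> s = 1" "\<And>s. s \<ge> 2 \<Longrightarrow> \<eta> s = 0"
    "\<And>s. \<eta>' s \<noteq> 0 \<Longrightarrow> 1 \<le> s \<and> s \<le> 2" "\<And>s. \<bar>\<eta>' s\<bar> \<le> C"
proof -
  define m where "m s = (max 0 s)\<^sup>2" for s :: real
  define D where "D s = m (2 - s) + m (s - 1)" for s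
  define D' where "D' s = - 2 * max 0 (2 - s) + 2 * max 0 (s - 1)" for s :: real
  define \<eta> where "\<eta> s = m (2 - s) / D s" for s
  define \<eta>' where "\<eta>' s = (- 2 * max 0 (2 - s) * D s - m (2 - s) * D' s) / (D s * D s)" for s
  have m0: "m s \<ge> 0" for s by (simp add: m_def)
  have Dpos: "D s > 0" for s
  proof -
    have "m (2 - s) > 0 \<or> m (s - 1) > 0" by (auto simp: m_def max_def)
    then show ?thesis unfolding D_def using m0[of "2 - s"] m0[of "s - 1"] by linarith
  qed
  have d1: "((\<lambda>s. m (2 - s)) has_real_derivative - 2 * max 0 (2 - s)) (at s)" for s
    unfolding m_def by (rule DERIV_cong[OF DERIV_chain2[OF DERIV_max_0_power2 DERIV_diff[OF DERIV_const DERIV_ident]]]) simp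
  have d2: "((\<lambda>s. m (s - 1)) has_real_derivative 2 * max 0 (s - 1)) (at s)" for s
    unfolding m_def by (rule DERIV_cong[OF DERIV_chain2[OF DERIV_max_0_power2 DERIV_diff[OF DERIV_ident DERIV_const]]]) simp
  have dD: "(D has_real_derivative D' s) (at s)" for s
    unfolding D_def D'_def by (intro DERIV_add d1 d2)
  have Dne: "D s \<noteq> 0" for s using Dpos[of s] by linarith
  have der: "(\<eta> has_real_derivative \<eta>' s) (at s)" for s
    unfolding \<eta>_def \<eta>'_def by (intro DERIV_divide d1 dD Dne)
  have cont: "continuous_on UNIV \<eta>'"
    unfolding \<eta>'_def D'_def D_def m_def
    using Dne unfolding D_def m_def by (intro continuous_intros) auto
  have ran: "0 \<le> \<eta> s" "\<eta> s \<le> 1" for s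
    using Dpos[of s] m0[of "2 - s"] m0[of "s - 1"] by (auto simp: \<eta>_def D_def)
  have one: "\<eta> s = 1" if "s \<le> 1" for s
    using Dne[of s] that by (auto simp: \<eta>_def D_def m_def)
  have zero: "\<eta> s = 0" if "s \<ge> 2" for s
    using that by (auto simp: \<eta>_def m_def)
  have supp: "1 \<le> s \<and> s \<le> 2" if "\<eta>' s \<noteq> 0" for s
  proof (rule ccontr)
    assume "\<not> ?thesis"
    then have "s < 1 \<or> s > 2" by linarith
    then have "- 2 * max 0 (2 - s) * D s - m (2 - s) * D' s = 0"
      by (auto simp: D_def D'_def m_def max_def algebra_simps)
    with that show False by (simp add: \<eta>'_def)
  qed
  have "compact (\<eta>' ` {1..2})"
    by (intro compact_continuous_image continuous_on_subset[OF cont]) auto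
  then obtain C where C: "\<And>s. s \<in> {1..2} \<Longrightarrow> \<bar>\<eta>' s\<bar> \<le> C"
    unfolding compact_eq_bounded_closed bounded_iff real_norm_def by blast
  have "\<bar>\<eta>' s\<bar> \<le> C" for s
  proof (cases "\<eta>' s = 0")
    case True
    then show ?thesis using C[of 1] by auto
  next
    case False
    then show ?thesis using C[of s] supp[of s] by auto
  qed
  with der cont ran one zero supp show ?thesis by (rule that)
qed

text \<open>Expand the nonnegative value of the form at \<open>\<epsilon> s p + t q\<close> and divide by \<open>\<epsilon>\<close>.\<close>
lemma quadratic_form_Young:
  fixes B :: "'n::finite \<Rightarrow> 'n \<Rightarrow> real"
  assumes sym: "\<And>i j. B i j = B j i"
    and nonneg: "\<And>q. (\<Sum>i\<in>UNIV. \<Sum>j\<in>UNIV. B i j * q i * q j) \<ge> 0"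
    and \<epsilon>: "\<epsilon> > 0"
  shows "- 2 * s * t * (\<Sum>i\<in>UNIV. \<Sum>j\<in>UNIV. B i j * p i * q j)
    \<le> \<epsilon> * s\<^sup>2 * (\<Sum>i\<in>UNIV. \<Sum>j\<in>UNIV. B i j * p i * p j)
      + t\<^sup>2 * (\<Sum>i\<in>UNIV. \<Sum>j\<in>UNIV. B i j * q i * q j) / \<epsilon>"
proof -
  let ?Q = "\<lambda>p q. \<Sum>i\<in>UNIV. \<Sum>j\<in>UNIV. B i j * p i * q j"
  have symQ: "?Q q p = ?Q p q"
    by (subst sum.swap) (simp add: sym[of _ "_::'n"] mult_ac)
  have "?Q (\<lambda>i. \<epsilon> * s * p i + t * q i) (\<lambda>i. \<epsilon> * s * p i + t * q i)
      = (\<epsilon> * s)\<^sup>2 * ?Q p p + \<epsilon> * s * t * ?Q p q + \<epsilon> * s * t * ?Q q p + t\<^sup>2 * ?Q q q"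
    unfolding sum_distrib_left sum.distrib[symmetric]
    by (intro sum.cong refl) (simp add: algebra_simps power2_eq_square)
  then have "0 \<le> \<epsilon> * (\<epsilon> * s\<^sup>2 * ?Q p p + 2 * s * t * ?Q p q + t\<^sup>2 * ?Q q q / \<epsilon>)"
    using nonneg[of "\<lambda>i. \<epsilon> * s * p i + t * q i"] \<epsilon>
    unfolding symQ by (simp add: algebra_simps power2_eq_square)
  then show ?thesis using \<epsilon> by (simp add: zero_le_mult_iff)
qed

text \<open>Here \<open>G\<close> is the gradient of \<open>U\<close> and \<open>f i\<close> is the \<open>i\<close>-th partial derivative of the \<open>i\<close>-th component of
\<open>a \<nabla>U\<close>, so that the sign condition reads \<open>U div (a \<nabla>U) \<ge> 0\<close>.

Test with \<open>\<phi>\<^sup>2 U\<close>, where \<open>\<phi>\<close> is a cutoff at scale \<open>R\<close>.  The energy \<open>D(R) = \<integral> \<phi>\<^sup>2 Q\<close>, with \<open>Q\<close> the form \<open>a\<close> at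
\<open>\<nabla>U\<close>, is at most \<open>-2 \<integral> \<phi> U \<langle>a \<nabla>U, \<nabla>\<phi>\<rangle>\<close>, which by Young's inequality is at most \<open>\<epsilon>\<close> times the energy in
the annulus that carries \<open>\<nabla>\<phi>\<close>, plus \<open>1/\<epsilon>\<close> times \<open>\<integral> U\<^sup>2 \<langle>a \<nabla>\<phi>, \<nabla>\<phi>\<rangle>\<close>.  In dimension at most two the last
integral is bounded by a constant \<open>E\<close> independent of \<open>R\<close>, because \<open>|\<nabla>\<phi>|\<^sup>2\<close> is of order \<open>R\<^sup>-\<^sup>2\<close> on a set of
volume of order at most \<open>R\<^sup>2\<close>.  This bounds the total energy \<open>S\<close> at first, and then gives
\<open>S \<le> E / \<epsilon>\<close> for every \<open>\<epsilon>\<close>, that is, \<open>S = 0\<close>.\<close>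
theorem bounded_Liouville_dim_le_2:
  fixes a :: "'n::finite \<Rightarrow> 'n \<Rightarrow> real^'n \<Rightarrow> real" and U :: "real^'n \<Rightarrow> real"
    and G f :: "'n \<Rightarrow> real^'n \<Rightarrow> real"
  assumes dim: "CARD('n) \<le> 2"
    and a_cont: "\<And>i j. continuous_on UNIV (a i j)"
    and a_sym: "\<And>i j x. a i j x = a j i x"
    and a_bd: "\<And>i j x. \<bar>a i j x\<bar> \<le> K"
    and a_pos: "\<And>x q. q \<noteq> (\<lambda>_. 0) \<Longrightarrow> 0 < (\<Sum>i\<in>UNIV. \<Sum>j\<in>UNIV. a i j x * q i * q j)"
    and U_cont: "continuous_on UNIV U" and U_bd: "\<And>x. \<bar>U x\<bar> \<le> M"
    and U_der: "\<And>i x. ((\<lambda>s. U (x + s *\<^sub>R axis i 1)) has_real_derivative G i x) (at 0)"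
    and G_cont: "\<And>i. continuous_on UNIV (G i)"
    and flux_der: "\<And>i x. ((\<lambda>s. \<Sum>j\<in>UNIV. a i j (x + s *\<^sub>R axis i 1) * G j (x + s *\<^sub>R axis i 1))
                       has_real_derivative f i x) (at 0)"
    and f_cont: "\<And>i. continuous_on UNIV (f i)"
    and sign: "\<And>x. 0 \<le> U x * (\<Sum>i\<in>UNIV. f i x)"
  shows "G i x = 0" and "f i x = 0"
proof -
  obtain \<eta> \<eta>' :: "real \<Rightarrow> real" and C
    where \<eta>_der: "\<And>s. (\<eta> has_real_derivative \<eta>' s) (at s)" and \<eta>'_cont: "continuous_on UNIV \<eta>'"
      and \<eta>_ran: "\<And>s. 0 \<le> \<eta> s" "\<And>s. \<eta> s \<le> 1" and \<eta>_1: "\<And>s. s \<le> 1 \<Longrightarrow> \<eta> s = 1"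
      and \<eta>_0: "\<And>s. s \<ge> 2 \<Longrightarrow> \<eta> s = 0" and \<eta>'_supp: "\<And>s. \<eta>' s \<noteq> 0 \<Longrightarrow> 1 \<le> s \<and> s \<le> 2"
      and \<eta>'_bd: "\<And>s. \<bar>\<eta>' s\<bar> \<le> C"
    by (rule C1_cutoff_exists) (rule that)
  have C0: "C \<ge> 0" using \<eta>'_bd[of 0] by linarith
  have K0: "K \<ge> 0" using a_bd[of undefined undefined undefined] by linarith
  have M0: "M \<ge> 0" using U_bd[of undefined] by linarith
  have \<eta>_cont: "continuous_on UNIV \<eta>"
    using \<eta>_der by (meson DERIV_isCont continuous_at_imp_continuous_on)
  define F where "F i x = (\<Sum>j\<in>UNIV. a i j x * G j x)" for i x
  define Q where "Q x = (\<Sum>i\<in>UNIV. \<Sum>j\<in>UNIV. a i j x * G i x * G j x)" for x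
  define \<phi> where "\<phi> R x = \<eta> ((x \<bullet> x) / R\<^sup>2)" for R and x :: "real^'n"
  define \<psi> where "\<psi> R i x = \<eta>' ((x \<bullet> x) / R\<^sup>2) * (2 * x $ i / R\<^sup>2)" for R i and x :: "real^'n"
  have nonneg: "(\<Sum>i\<in>UNIV. \<Sum>j\<in>UNIV. a i j x * q i * q j) \<ge> 0" for x q
    using a_pos[of q x] by (cases "q = (\<lambda>_. 0)") auto
  have Q0: "Q x \<ge> 0" for x unfolding Q_def by (rule nonneg)
  have F_cont: "continuous_on UNIV (F i)" for i
    unfolding F_def by (intro continuous_intros a_cont G_cont)
  have Q_cont: "continuous_on UNIV Q"
    unfolding Q_def by (intro continuous_intros a_cont G_cont)
  have F_der: "((\<lambda>s. F i (x + s *\<^sub>R axis i 1)) has_real_derivative f i x) (at 0)" for i x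
    unfolding F_def by (rule flux_der)
  have \<phi>_ran: "0 \<le> \<phi> R x" "\<phi> R x \<le> 1" for R x
    unfolding \<phi>_def by (rule \<eta>_ran)+
  have \<phi>_cont: "continuous_on UNIV (\<phi> R)" and \<psi>_cont: "continuous_on UNIV (\<psi> R i)" if "R > 0" for R i
    unfolding \<phi>_def \<psi>_def using that
    by (auto intro!: continuous_intros continuous_on_compose2[OF \<eta>_cont] continuous_on_compose2[OF \<eta>'_cont])
  have \<phi>_der: "((\<lambda>s. \<phi> R (x + s *\<^sub>R axis i 1)) has_real_derivative \<psi> R i x) (at 0)" if "R > 0" for R i x
  proof -
    have eq: "(x + s *\<^sub>R axis i 1) \<bullet> (x + s *\<^sub>R axis i 1) = x \<bullet> x + 2 * s * x $ i + s\<^sup>2" for s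
      by (simp add: inner_add_left inner_add_right inner_axis inner_commute[of "axis i 1" x] inner_axis_axis power2_eq_square algebra_simps)
    have "((\<lambda>s. (x \<bullet> x + 2 * s * x $ i + s\<^sup>2) / R\<^sup>2) has_real_derivative 2 * x $ i / R\<^sup>2) (at 0)"
      using that by (auto intro!: derivative_eq_intros simp: power2_eq_square)
    from DERIV_chain2[OF \<eta>_der this]
    show ?thesis unfolding \<phi>_def \<psi>_def eq by simp
  qed
  have norm_le: "norm x \<le> 2 * R" if "R > 0" "(x \<bullet> x) / R\<^sup>2 \<le> 2" for R and x :: "real^'n"
  proof (rule power2_le_imp_le)
    have "(norm x)\<^sup>2 \<le> 2 * R\<^sup>2" using that by (simp add: power2_norm_eq_inner field_simps)
    also have "\<dots> \<le> (2 * R)\<^sup>2" by (simp add: power_mult_distrib)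
    finally show "(norm x)\<^sup>2 \<le> (2 * R)\<^sup>2" .
  qed (use that in simp)
  have \<phi>_supp: "\<phi> R x = 0" if "R > 0" "norm x > 2 * R" for R x
    unfolding \<phi>_def using norm_le[OF that(1), of x] that(2) by (intro \<eta>_0) linarith
  have \<psi>_supp: "norm x \<le> 2 * R" if "R > 0" "\<psi> R i x \<noteq> 0" for R i x
    using that(2) \<eta>'_supp by (intro norm_le that(1)) (auto simp: \<psi>_def)
  have \<psi>_bd: "\<bar>\<psi> R i x\<bar> \<le> 4 * C / R" if R: "R > 0" for R i x
  proof (cases "\<psi> R i x = 0")
    case False
    have "\<bar>2 * x $ i / R\<^sup>2\<bar> \<le> 4 / R"
      using \<psi>_supp[OF R False] component_le_norm_cart[of x i] R
      by (simp add: field_simps power2_eq_square)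
    then have "\<bar>\<psi> R i x\<bar> \<le> C * (4 / R)"
      unfolding \<psi>_def abs_mult[of "\<eta>' _"] by (intro mult_mono \<eta>'_bd) (use C0 in auto)
    then show ?thesis by (simp add: mult.commute)
  qed (use R C0 in auto)
  define D where "D R = integral UNIV (\<lambda>x. (\<phi> R x)\<^sup>2 * Q x)" for R
  have D_int: "((\<lambda>x. (\<phi> R x)\<^sup>2 * Q x) has_integral D R) UNIV" if "R > 0" for R
    unfolding D_def using \<phi>_supp[OF that]
    by (intro integrable_integral integrable_continuous_compact_support[of _ "2 * R"] continuous_intros
          \<phi>_cont[OF that] Q_cont) auto
  have energy: "((\<lambda>x. 2 * \<phi> R x * U x * (\<Sum>i\<in>UNIV. \<psi> R i x * F i x) + (\<phi> R x)\<^sup>2 * Q x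
        + (\<phi> R x)\<^sup>2 * (U x * (\<Sum>i\<in>UNIV. f i x))) has_integral 0) UNIV" if R: "R > 0" for R
  proof -
    let ?X' = "\<lambda>i x. 2 * \<phi> R x * \<psi> R i x * (U x * F i x) + (\<phi> R x)\<^sup>2 * (G i x * F i x + U x * f i x)"
    have "(?X' i has_integral 0) UNIV" for i
    proof (rule has_integral_directional_derivative_0[where X = "\<lambda>x. (\<phi> R x)\<^sup>2 * (U x * F i x)"])
      show "continuous_on UNIV (\<lambda>x. (\<phi> R x)\<^sup>2 * (U x * F i x))"
        by (intro continuous_intros \<phi>_cont R U_cont F_cont)
      show "continuous_on UNIV (?X' i)"
        by (intro continuous_intros \<phi>_cont \<psi>_cont R U_cont F_cont G_cont f_cont)
      show "((\<lambda>s. (\<phi> R (x + s *\<^sub>R axis i 1))\<^sup>2 * (U (x + s *\<^sub>R axis i 1) * F i (x + s *\<^sub>R axis i 1)))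
          has_real_derivative ?X' i x) (at 0)" for x
        by (rule DERIV_cong[OF DERIV_mult[OF DERIV_power[OF \<phi>_der[OF R]] DERIV_mult[OF U_der F_der]]])
           (simp add: algebra_simps)
      show "(\<phi> R x)\<^sup>2 * (U x * F i x) = 0" if "norm x > 2 * R" for x
        using \<phi>_supp[OF R that] by simp
    qed
    then have "((\<lambda>x. \<Sum>i\<in>UNIV. ?X' i x) has_integral (\<Sum>i\<in>(UNIV::'n set). 0)) UNIV"
      by (intro has_integral_sum) auto
    moreover have "(\<Sum>i\<in>UNIV. ?X' i x) = 2 * \<phi> R x * U x * (\<Sum>i\<in>UNIV. \<psi> R i x * F i x) + (\<phi> R x)\<^sup>2 * Q x
        + (\<phi> R x)\<^sup>2 * (U x * (\<Sum>i\<in>UNIV. f i x))" for x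
    proof -
      have "(\<Sum>i\<in>UNIV. G i x * F i x) = Q x"
        unfolding Q_def F_def sum_distrib_left by (intro sum.cong refl) (simp add: mult_ac)
      then show ?thesis
        by (simp add: sum.distrib sum_distrib_left[symmetric] distrib_left)
           (simp add: sum_distrib_left mult_ac)
    qed
    ultimately show ?thesis by simp
  qed
  define n where "n = real CARD('n)"
  define L where "L R = M\<^sup>2 * (n\<^sup>2 * (K * (4 * C / R)\<^sup>2))" for R
  define B where "B R = cbox (- ((\<chi> i. 2 * R) :: real^'n)) (\<chi> i. 2 * R)" for R
  define E where "E = 16 * (M\<^sup>2 * (n\<^sup>2 * (K * (4 * C)\<^sup>2))) + 1"
  have E_pos: "E > 0" unfolding E_def using K0 by (intro add_nonneg_pos mult_nonneg_nonneg) auto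
  have L0: "L R \<ge> 0" for R unfolding L_def using K0 by simp
  have vol: "((\<lambda>x. if x \<in> B R then L R else 0) has_integral measure lborel (B R) * L R) UNIV" for R
    unfolding has_integral_restrict_UNIV B_def using has_integral_const[of "L R"] by simp
  have vol_le: "measure lborel (B R) * L R \<le> E" if R: "R \<ge> 1" for R
  proof -
    have "measure lborel (B R) = (4 * R) ^ CARD('n)"
      unfolding B_def using R by (subst content_cbox_cart) (auto simp: interval_ne_empty_cart)
    also have "\<dots> \<le> (4 * R)\<^sup>2"
      using R dim by (intro power_increasing) auto
    finally have "measure lborel (B R) * L R \<le> (4 * R)\<^sup>2 * L R" by (intro mult_right_mono L0)
    also have "\<dots> = E - 1" using R unfolding E_def L_def by (simp add: power_mult_distrib power_divide)
    finally show ?thesis by simp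
  qed
  have P_le: "(U x)\<^sup>2 * (\<Sum>i\<in>UNIV. \<Sum>j\<in>UNIV. a i j x * \<psi> R i x * \<psi> R j x) \<le> (if x \<in> B R then L R else 0)"
    (is "_ * ?P \<le> _") if R: "R > 0" for R x
  proof (cases "x \<in> B R")
    case True
    have "a i j x * \<psi> R i x * \<psi> R j x \<le> K * (4 * C / R)\<^sup>2" for i j
    proof -
      have "\<bar>a i j x * \<psi> R i x * \<psi> R j x\<bar> \<le> K * (4 * C / R) * (4 * C / R)"
        unfolding abs_mult by (intro mult_mono a_bd \<psi>_bd R) (use K0 C0 R in auto)
      then show ?thesis by (simp add: power2_eq_square mult_ac)
    qed
    then have "?P \<le> (\<Sum>i\<in>(UNIV::'n set). \<Sum>j\<in>(UNIV::'n set). K * (4 * C / R)\<^sup>2)"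
      by (intro sum_mono)
    also have "\<dots> = n\<^sup>2 * (K * (4 * C / R)\<^sup>2)" by (simp add: n_def power2_eq_square)
    finally have P: "?P \<le> n\<^sup>2 * (K * (4 * C / R)\<^sup>2)" .
    have "(U x)\<^sup>2 \<le> M\<^sup>2" using U_bd[of x] by (simp add: abs_le_square_iff[symmetric] M0)
    then show ?thesis
      using True P nonneg[of x "\<lambda>i. \<psi> R i x"] by (auto simp: L_def intro!: mult_mono)
  next
    case False
    have "\<psi> R i x = 0" for i
    proof (rule ccontr)
      assume "\<psi> R i x \<noteq> 0"
      then have "norm x \<le> 2 * R" by (rule \<psi>_supp[OF R])
      then have "\<bar>x $ j\<bar> \<le> 2 * R" for j using component_le_norm_cart[of x j] by linarith
      then have "x \<in> B R" unfolding B_def by (simp add: mem_box_cart abs_le_iff minus_le_iff)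
      with False show False by simp
    qed
    then show ?thesis using False by simp
  qed
  \<comment> \<open>The weight \<open>\<theta>\<close> only has to dominate \<open>\<phi>\<^sup>2\<close> where \<open>\<nabla>\<phi> \<noteq> 0\<close>.  It is first \<open>\<phi>\<^sup>2\<close> itself and then a weight
    concentrated on an annulus.\<close>
  have key: "D R \<le> \<epsilon> * J + E / \<epsilon>"
    if R: "R \<ge> 1" and \<epsilon>: "\<epsilon> > 0" and J: "((\<lambda>x. \<theta> x * Q x) has_integral J) UNIV"
      and \<theta>0: "\<And>x. 0 \<le> \<theta> x" and \<theta>: "\<And>x i. \<psi> R i x \<noteq> 0 \<Longrightarrow> (\<phi> R x)\<^sup>2 \<le> \<theta> x" for R \<epsilon> \<theta> J
  proof -
    have R0: "R > 0" using R by simp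
    have "((\<lambda>x. \<epsilon> * (\<theta> x * Q x) + (if x \<in> B R then L R else 0) / \<epsilon> +
       (2 * \<phi> R x * U x * (\<Sum>i\<in>UNIV. \<psi> R i x * F i x) + (\<phi> R x)\<^sup>2 * Q x
        + (\<phi> R x)\<^sup>2 * (U x * (\<Sum>i\<in>UNIV. f i x)))) has_integral (\<epsilon> * J + measure lborel (B R) * L R / \<epsilon> + 0)) UNIV"
      by (intro has_integral_add has_integral_mult_right has_integral_divide J vol energy R0)
    then have "D R \<le> \<epsilon> * J + measure lborel (B R) * L R / \<epsilon> + 0"
    proof (rule has_integral_le[OF D_int[OF R0]])
      fix x
      have sw: "(\<Sum>i\<in>UNIV. \<Sum>j\<in>UNIV. a i j x * G i x * \<psi> R j x) = (\<Sum>i\<in>UNIV. \<psi> R i x * F i x)"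
        unfolding F_def sum_distrib_left
        by (subst sum.swap) (intro sum.cong refl, simp add: a_sym mult_ac)
      have Y: "- 2 * \<phi> R x * U x * (\<Sum>i\<in>UNIV. \<psi> R i x * F i x)
          \<le> \<epsilon> * (\<phi> R x)\<^sup>2 * Q x + (U x)\<^sup>2 * (\<Sum>i\<in>UNIV. \<Sum>j\<in>UNIV. a i j x * \<psi> R i x * \<psi> R j x) / \<epsilon>"
        using quadratic_form_Young[of "\<lambda>i j. a i j x" \<epsilon> "\<phi> R x" "U x" "\<lambda>i. G i x" "\<lambda>i. \<psi> R i x"]
          a_sym nonneg \<epsilon> unfolding sw Q_def by blast
      have "- 2 * \<phi> R x * U x * (\<Sum>i\<in>UNIV. \<psi> R i x * F i x)
          \<le> \<epsilon> * (\<theta> x * Q x) + (if x \<in> B R then L R else 0) / \<epsilon>"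
      proof (cases "\<exists>i. \<psi> R i x \<noteq> 0")
        case True
        then have "(\<phi> R x)\<^sup>2 \<le> \<theta> x" using \<theta> by blast
        then have "\<epsilon> * (\<phi> R x)\<^sup>2 * Q x \<le> \<epsilon> * (\<theta> x * Q x)"
          using \<epsilon> Q0[of x] by (simp add: mult.assoc mult_right_mono)
        moreover have "(U x)\<^sup>2 * (\<Sum>i\<in>UNIV. \<Sum>j\<in>UNIV. a i j x * \<psi> R i x * \<psi> R j x) / \<epsilon>
            \<le> (if x \<in> B R then L R else 0) / \<epsilon>"
          using P_le[OF R0] \<epsilon> by (intro divide_right_mono) auto
        ultimately show ?thesis using Y by linarith
      next
        case False
        then have "(\<Sum>i\<in>UNIV. \<psi> R i x * F i x) = 0" by simp
        moreover have "0 \<le> \<epsilon> * (\<theta> x * Q x)" using \<epsilon> \<theta>0 Q0 by simp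
        moreover have "0 \<le> (if x \<in> B R then L R else 0) / \<epsilon>" using \<epsilon> L0 by simp
        ultimately show ?thesis by simp
      qed
      moreover have "0 \<le> (\<phi> R x)\<^sup>2 * (U x * (\<Sum>i\<in>UNIV. f i x))" using sign by simp
      ultimately show "(\<phi> R x)\<^sup>2 * Q x \<le> \<epsilon> * (\<theta> x * Q x) + (if x \<in> B R then L R else 0) / \<epsilon> +
       (2 * \<phi> R x * U x * (\<Sum>i\<in>UNIV. \<psi> R i x * F i x) + (\<phi> R x)\<^sup>2 * Q x
        + (\<phi> R x)\<^sup>2 * (U x * (\<Sum>i\<in>UNIV. f i x)))" by linarith
    qed
    also have "measure lborel (B R) * L R / \<epsilon> \<le> E / \<epsilon>"
      using vol_le[OF R] \<epsilon> by (intro divide_right_mono) auto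
    finally show ?thesis by simp
  qed
  \<comment> \<open>With \<open>\<theta> = \<phi>\<^sup>2\<close> and \<open>\<epsilon> = 1/2\<close>, half of the energy is absorbed on the left.\<close>
  have D_bd: "D R \<le> 4 * E" if "R \<ge> 1" for R
  proof -
    have "D R \<le> 1/2 * D R + E / (1/2)"
      using that by (intro key[of _ _ "\<lambda>x. (\<phi> R x)\<^sup>2"] D_int) auto
    then show ?thesis by simp
  qed
  have nest: "\<phi> R x = 1" if "R > 0" "\<phi> (R / 2) x \<noteq> 0" for R x
  proof -
    have "(x \<bullet> x) / (R / 2)\<^sup>2 < 2" using that(2) \<eta>_0 unfolding \<phi>_def by (metis not_le)
    then have "x \<bullet> x * 2 < R\<^sup>2" using that(1) by (simp add: field_simps)
    then have "x \<bullet> x \<le> R\<^sup>2" using inner_ge_zero[of x] by linarith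
    then have "(x \<bullet> x) / R\<^sup>2 \<le> 1" using that(1) by simp
    then show ?thesis unfolding \<phi>_def by (rule \<eta>_1)
  qed
  have nest2: "\<phi> (R / 2) x = 0" "\<phi> (2 * R) x = 1" if R: "R > 0" and "\<psi> R i x \<noteq> 0" for R i x
  proof -
    have "1 \<le> (x \<bullet> x) / R\<^sup>2 \<and> (x \<bullet> x) / R\<^sup>2 \<le> 2"
      using that(2) by (intro \<eta>'_supp) (auto simp: \<psi>_def)
    then have "(x \<bullet> x) / (R / 2)\<^sup>2 \<ge> 2" "(x \<bullet> x) / (2 * R)\<^sup>2 \<le> 1"
      using R by (auto simp: field_simps)
    then show "\<phi> (R / 2) x = 0" "\<phi> (2 * R) x = 1"
      unfolding \<phi>_def by (auto intro: \<eta>_0 \<eta>_1)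
  qed
  \<comment> \<open>The difference of the squared cutoffs at scales \<open>2 R\<close> and \<open>R / 2\<close> is \<open>1\<close> wherever the gradient of the
    cutoff at scale \<open>R\<close> does not vanish.\<close>
  have D_step: "(1 + \<epsilon>) * D (R / 2) \<le> \<epsilon> * D (2 * R) + E / \<epsilon>" if R: "R \<ge> 1" and \<epsilon>: "\<epsilon> > 0" for R \<epsilon>
  proof -
    have R0: "R > 0" "2 * R > 0" "R / 2 > 0" using R by auto
    let ?\<theta> = "\<lambda>x. (\<phi> (2 * R) x)\<^sup>2 - (\<phi> (R / 2) x)\<^sup>2"
    have "D R \<le> \<epsilon> * (D (2 * R) - D (R / 2)) + E / \<epsilon>"
    proof (rule key[of _ _ ?\<theta>, OF R \<epsilon>])
      show "((\<lambda>x. ?\<theta> x * Q x) has_integral (D (2 * R) - D (R / 2))) UNIV"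
        unfolding left_diff_distrib by (intro has_integral_diff D_int R0)
      show "0 \<le> ?\<theta> x" for x
      proof (cases "\<phi> (R / 2) x = 0")
        case False
        then have "\<phi> R x = 1" by (rule nest[OF R0(1)])
        then have "\<phi> (2 * R) x = 1" using nest[of "2 * R" x] R0 by simp
        then show ?thesis using \<phi>_ran[of "R / 2" x] by (simp add: power_le_one)
      qed simp
      show "(\<phi> R x)\<^sup>2 \<le> ?\<theta> x" if "\<psi> R i x \<noteq> 0" for x i
        using nest2[OF R0(1) that] \<phi>_ran[of R x] by (simp add: power_le_one)
    qed
    moreover have "D (R / 2) \<le> D R"
    proof (rule has_integral_le[OF D_int[OF R0(3)] D_int[OF R0(1)]])
      fix x show "(\<phi> (R / 2) x)\<^sup>2 * Q x \<le> (\<phi> R x)\<^sup>2 * Q x"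
        using nest[OF R0(1), of x] \<phi>_ran[of "R / 2" x] Q0[of x]
        by (cases "\<phi> (R / 2) x = 0") (auto intro!: mult_left_le_one_le simp: power_le_one)
    qed
    ultimately show ?thesis by (simp add: algebra_simps)
  qed
  define S where "S = Sup (D ` {1..})"
  have bdd: "bdd_above (D ` {1..})" using D_bd by (intro bdd_aboveI2[of _ _ "4 * E"]) auto
  have D_le_S: "D R \<le> S" if "R \<ge> 1" for R
    unfolding S_def using that by (intro cSUP_upper bdd) auto
  have S_le: "S \<le> E / \<epsilon>" if \<epsilon>: "\<epsilon> > 0" for \<epsilon>
  proof -
    have "S \<le> (\<epsilon> * S + E / \<epsilon>) / (1 + \<epsilon>)"
      unfolding S_def
    proof (rule cSUP_least)
      fix r :: real assume "r \<in> {1..}"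
      then have r: "r \<ge> 1" by simp
      have "(1 + \<epsilon>) * D r \<le> \<epsilon> * D (4 * r) + E / \<epsilon>" using D_step[of "2 * r" \<epsilon>] r \<epsilon> by simp
      also have "\<epsilon> * D (4 * r) \<le> \<epsilon> * S" using D_le_S[of "4 * r"] r \<epsilon> by (intro mult_left_mono) auto
      finally have "D r * (1 + \<epsilon>) \<le> \<epsilon> * S + E / \<epsilon>" by (simp add: mult.commute)
      then show "D r \<le> (\<epsilon> * (SUP R\<in>{1..}. D R) + E / \<epsilon>) / (1 + \<epsilon>)"
        using \<epsilon> unfolding S_def by (subst pos_le_divide_eq) auto
    qed simp
    then have "S * (1 + \<epsilon>) \<le> \<epsilon> * S + E / \<epsilon>" using \<epsilon> by (simp add: pos_le_divide_eq)
    then show ?thesis by (simp add: algebra_simps)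
  qed
  have S0: "S \<le> 0"
  proof (rule ccontr)
    assume "\<not> S \<le> 0"
    then have "S > 0" by simp
    then have "S \<le> E / (2 * E / S)" using E_pos by (intro S_le) simp
    with \<open>S > 0\<close> E_pos show False by simp
  qed
  have Q_zero: "Q x = 0" for x
  proof -
    define R where "R = max 1 (norm x)"
    have R: "R \<ge> 1" "R > 0" "norm x \<le> R" by (auto simp: R_def)
    let ?q = "\<lambda>y. (\<phi> R y)\<^sup>2 * Q y"
    have "D R \<le> 0" using D_le_S[OF R(1)] S0 by linarith
    moreover have "D R \<ge> 0" by (rule has_integral_nonneg[OF D_int[OF R(2)]]) (use Q0 in simp)
    ultimately have "D R = 0" by simp
    then have 0: "(?q has_integral 0) UNIV" using D_int[OF R(2)] by simp
    have q_cont: "continuous_on UNIV ?q" by (intro continuous_intros \<phi>_cont R Q_cont)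
    obtain b :: "real^'n" where b: "cball 0 (2 * R) \<subseteq> cbox (- b) b"
      using bounded_subset_cbox_symmetric[OF bounded_cball] by blast
    have "((\<lambda>y. if y \<in> cbox (-b) b then ?q y else 0) has_integral 0) UNIV"
    proof (rule has_integral_eq[OF _ 0])
      fix y show "?q y = (if y \<in> cbox (-b) b then ?q y else 0)"
        using b \<phi>_supp[OF R(2), of y] by (auto simp: subset_eq not_le[symmetric])
    qed
    then have "(?q has_integral 0) (cbox (-b) b)" unfolding has_integral_restrict_UNIV .
    moreover have "box (-b) b \<noteq> {}"
    proof -
      have "ball 0 (2 * R) \<subseteq> interior (cbox (-b) b)"
        using b by (intro interior_maximal) auto
      then show ?thesis using R(2) by (auto simp: interior_cbox)
    qed
    moreover have "x \<in> cbox (-b) b" using b R by auto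
    ultimately have "?q x = 0"
      using Q0 by (intro has_integral_0_cbox_imp_0[of "-b" b ?q x] continuous_on_subset[OF q_cont]) auto
    moreover have "\<phi> R x = 1"
    proof -
      have "x \<bullet> x \<le> R\<^sup>2" using R unfolding power2_norm_eq_inner[symmetric] by (intro power_mono) auto
      then show ?thesis unfolding \<phi>_def using R by (intro \<eta>_1) simp
    qed
    ultimately show ?thesis by simp
  qed
  show G0: "G i x = 0" for i x
  proof -
    have "(\<lambda>i. G i x) = (\<lambda>_. 0)"
      using a_pos[of "\<lambda>i. G i x" x] Q_zero[of x] unfolding Q_def by fastforce
    then show ?thesis by (rule fun_cong)
  qed
  have "((\<lambda>s. 0) has_real_derivative f i x) (at 0)"
    using flux_der[of i x] by (simp add: G0)
  then show "f i x = 0" using DERIV_unique DERIV_const by blast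
qed

section \<open>Derivatives up to the boundary\<close>

lemma has_real_derivative_partial_deriv:
  assumes "f differentiable_on \<Omega>" "open \<Omega>" "x \<in> \<Omega>"
  shows "((\<lambda>s. f (x + s *\<^sub>R e)) has_real_derivative partial_deriv e f x) (at 0)"
proof -
  have "f differentiable (at x)"
    using assms differentiable_on_eq_differentiable_at by blast
  then have "f differentiable (at (x + 0 *\<^sub>R e))" by simp
  moreover have "(\<lambda>s. x + s *\<^sub>R e) differentiable (at 0)" by simp
  ultimately have "(f \<circ> (\<lambda>s. x + s *\<^sub>R e)) differentiable (at 0)"
    by (intro differentiable_chain_at) auto
  then have "(\<lambda>s. f (x + s *\<^sub>R e)) field_differentiable (at 0)"
    unfolding o_def field_differentiable_def real_differentiable_def .
  then show ?thesis
    unfolding partial_deriv_def by (rule field_differentiable_derivI)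
qed

lemma partial_deriv_unique:
  assumes "((\<lambda>s. f (x + s *\<^sub>R e)) has_real_derivative D) (at 0)"
  shows "partial_deriv e f x = D"
  unfolding partial_deriv_def using assms by (rule DERIV_imp_deriv)

lemma continuous_on_halfline_eq:
  fixes f g :: "real \<Rightarrow> real"
  assumes "continuous_on {0..} f" "continuous_on {0..} g" "\<And>t. t > 0 \<Longrightarrow> f t = g t" "t \<ge> 0"
  shows "f t = g t"
proof -
  have cl: "closure {0<..} = {0::real..}" by simp
  have "f t - g t = 0"
    by (rule continuous_constant_on_closure[of "{0<..}" "\<lambda>t. f t - g t"])
      (use assms in \<open>auto simp: cl intro!: continuous_intros\<close>)
  then show ?thesis by simp
qed

text \<open>For \<open>t > 0\<close> the increments of \<open>w\<close> in the direction \<open>e\<close> are integrals of \<open>w'\<close>; both sides are continuous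
in \<open>t\<close> up to \<open>0\<close>, so the same formula holds on the boundary and can be differentiated there.\<close>
lemma tangential_derivative_at_boundary:
  fixes w w' :: "'a::euclidean_space \<times> real \<Rightarrow> real"
  assumes w: "continuous_on (UNIV \<times> {0..}) w" and w': "continuous_on (UNIV \<times> {0..}) w'"
    and der: "\<And>x t. t > 0 \<Longrightarrow> ((\<lambda>s. w (x + s *\<^sub>R e, t)) has_real_derivative w' (x, t)) (at 0)"
    and t: "t \<ge> 0"
  shows "((\<lambda>s. w (x + s *\<^sub>R e, t)) has_real_derivative w' (x, t)) (at 0)"
proof -
  have cw: "continuous_on A (\<lambda>y. w (p y, q y))" if "continuous_on A p" "continuous_on A q" "\<And>y. y \<in> A \<Longrightarrow> q y \<ge> 0"
    for A :: "'b::topological_space set" and p q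
    by (rule continuous_on_compose2[OF w]) (use that in \<open>auto intro!: continuous_intros\<close>)
  have cw': "continuous_on A (\<lambda>y. w' (p y, q y))" if "continuous_on A p" "continuous_on A q" "\<And>y. y \<in> A \<Longrightarrow> q y \<ge> 0"
    for A :: "'b::topological_space set" and p q
    by (rule continuous_on_compose2[OF w']) (use that in \<open>auto intro!: continuous_intros\<close>)
  have int: "integral {-1..s} (\<lambda>r. w' (x + r *\<^sub>R e, t)) = w (x + s *\<^sub>R e, t) - w (x - e, t)"
    if s: "s \<in> {-1..1}" for s
  proof (rule continuous_on_halfline_eq[OF _ _ _ t])
    show "continuous_on {0..} (\<lambda>t. integral {-1..s} (\<lambda>r. w' (x + r *\<^sub>R e, t)))"
      unfolding cbox_interval[symmetric]
      by (rule integral_continuous_on_param, unfold case_prod_unfold, intro cw' continuous_intros) auto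
    show "continuous_on {0..} (\<lambda>t. w (x + s *\<^sub>R e, t) - w (x - e, t))"
      by (intro continuous_intros cw) auto
    fix t :: real assume "t > 0"
    have "((\<lambda>r. w' (x + r *\<^sub>R e, t)) has_integral w (x + s *\<^sub>R e, t) - w (x + (-1) *\<^sub>R e, t)) {-1..s}"
    proof (rule fundamental_theorem_of_calculus)
      show "((\<lambda>r. w (x + r *\<^sub>R e, t)) has_vector_derivative w' (x + r *\<^sub>R e, t)) (at r within {-1..s})" for r
        using has_real_derivative_along_line[of "\<lambda>y. w (y, t)" e "\<lambda>y. w' (y, t)" x r] der[OF \<open>t > 0\<close>]
        by (auto simp: has_real_derivative_iff_has_vector_derivative intro: has_vector_derivative_at_within)
    qed (use s in simp)
    then show "integral {-1..s} (\<lambda>r. w' (x + r *\<^sub>R e, t)) = w (x + s *\<^sub>R e, t) - w (x - e, t)"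
      by (simp add: integral_unique)
  qed
  have "((\<lambda>s. integral {-1..s} (\<lambda>r. w' (x + r *\<^sub>R e, t))) has_real_derivative w' (x + 0 *\<^sub>R e, t)) (at 0 within {-1..1})"
    by (rule integral_has_real_derivative) (use t in \<open>auto intro!: cw' continuous_intros\<close>)
  then have "((\<lambda>s. integral {-1..s} (\<lambda>r. w' (x + r *\<^sub>R e, t))) has_real_derivative w' (x, t)) (at 0)"
    using at_within_interior[of 0 "{-1..1::real}"] by (simp add: interior_atLeastAtMost_real)
  then have "((\<lambda>s. w (x + s *\<^sub>R e, t) - w (x - e, t)) has_real_derivative w' (x, t)) (at 0)"
    by (rule has_field_derivative_transform_within_open[OF _ open_greaterThanLessThan[of "-1" 1]])
      (use int in auto)
  then have "((\<lambda>s. (w (x + s *\<^sub>R e, t) - w (x - e, t)) + w (x - e, t)) has_real_derivative w' (x, t) + 0) (at 0)"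
    by (rule DERIV_add[OF _ DERIV_const])
  then show ?thesis by simp
qed

lemma DERIV_translate:
  fixes f :: "real \<Rightarrow> real"
  assumes "(f has_real_derivative D) (at (T + t))"
  shows "((\<lambda>t. f (T + t)) has_real_derivative D) (at t)"
proof -
  have "((\<lambda>t. T + t) has_real_derivative 1) (at t)"
    by (rule DERIV_cong[OF DERIV_add[OF DERIV_const DERIV_ident]]) simp
  from DERIV_chain2[where g = "\<lambda>t. T + t", OF assms this] show ?thesis by (simp only: mult_1_right)
qed

text \<open>The set where \<open>|f|\<close> exceeds an essential bound is open and negligible, hence empty.\<close>
lemma essentially_bounded_continuous_imp_bounded:
  fixes f :: "'a::euclidean_space \<Rightarrow> real"
  assumes "L_infinity f" "continuous_on UNIV f"
  shows "\<exists>C. \<forall>x. \<bar>f x\<bar> \<le> C"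
proof -
  obtain C where C: "AE x in lebesgue. \<bar>f x\<bar> \<le> C"
    using assms(1) by (auto simp: L_infinity_def)
  have op: "open {x. C < \<bar>f x\<bar>}"
    using assms(2) by (intro open_Collect_less continuous_intros)
  then have "{x. C < \<bar>f x\<bar>} \<in> sets lebesgue"
    by (intro sets_completionI_sets) simp
  then have "{x. C < \<bar>f x\<bar>} \<in> null_sets lebesgue"
    using C by (simp add: AE_iff_null_sets not_less)
  then have "negligible {x. C < \<bar>f x\<bar>}" by (simp add: negligible_iff_null_sets)
  then have "{x. C < \<bar>f x\<bar>} = {}"
    using open_not_negligible[OF op] by blast
  then show ?thesis by (intro exI[of _ C]) (auto simp: not_less[symmetric])
qed

lemma closure_half_space: "closure half_space = (UNIV :: (real^'n) set) \<times> {0..}"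
  unfolding half_space_def closure_Times by simp

lemma open_half_space: "open (half_space :: ((real^'n) \<times> real) set)"
  unfolding half_space_def by (intro open_Times) auto

lemma frontier_half_space: "frontier half_space = (UNIV :: (real^'n) set) \<times> {0}"
  unfolding frontier_def closure_half_space interior_open[OF open_half_space]
  by (auto simp: half_space_def)

text \<open>The partial derivatives are replaced by their continuous extensions to the closed half-space:
\<open>ut\<close> and \<open>utt\<close> for the normal ones, \<open>ux i\<close> for \<open>\<partial>\<^sub>i u\<close> and \<open>uxx i j\<close> for \<open>\<partial>\<^sub>i \<partial>\<^sub>j u\<close>.  The tangential derivatives
are claimed up to \<open>t = 0\<close> because integrals over periods that start there are going to be
differentiated in \<open>x'\<close>.\<close>
lemma C2_half_space_derivatives:
  fixes u :: "(real^'n) \<times> real \<Rightarrow> real"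
  assumes "Ck_closure 2 half_space u"
  obtains ut utt :: "(real^'n) \<times> real \<Rightarrow> real" and ux :: "'n \<Rightarrow> (real^'n) \<times> real \<Rightarrow> real"
    and uxx :: "'n \<Rightarrow> 'n \<Rightarrow> (real^'n) \<times> real \<Rightarrow> real"
  where "continuous_on (UNIV \<times> {0..}) u" "continuous_on (UNIV \<times> {0..}) ut" "continuous_on (UNIV \<times> {0..}) utt"
    "\<And>i. continuous_on (UNIV \<times> {0..}) (ux i)" "\<And>i j. continuous_on (UNIV \<times> {0..}) (uxx i j)"
    "\<And>x t. t > 0 \<Longrightarrow> ((\<lambda>t. u (x, t)) has_real_derivative ut (x, t)) (at t)"
    "\<And>x t. t > 0 \<Longrightarrow> ((\<lambda>t. ut (x, t)) has_real_derivative utt (x, t)) (at t)"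
    "\<And>i x t. t \<ge> 0 \<Longrightarrow> ((\<lambda>s. u (x + s *\<^sub>R axis i 1, t)) has_real_derivative ux i (x, t)) (at 0)"
    "\<And>i j x t. t \<ge> 0 \<Longrightarrow> ((\<lambda>s. ux j (x + s *\<^sub>R axis i 1, t)) has_real_derivative uxx i j (x, t)) (at 0)"
proof -
  let ?H = "half_space :: ((real^'n) \<times> real) set"
  have cl: "closure ?H = UNIV \<times> {0..}" by (rule closure_half_space)
  have u: "continuous_on (UNIV \<times> {0..}) u" and E: "Ck_extends (Suc (Suc 0)) ?H u"
    using assms by (auto simp: Ck_closure_def cl numeral_2_eq_2)
  have u_diff: "u differentiable_on ?H" using E by simp
  have ext1: "\<exists>h. continuous_on (UNIV \<times> {0..}) h \<and> (\<forall>x\<in>?H. h x = partial_deriv e u x)"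
    and diff1: "partial_deriv e u differentiable_on ?H"
    and ext2: "\<exists>h. continuous_on (UNIV \<times> {0..}) h \<and> (\<forall>x\<in>?H. h x = partial_deriv e' (partial_deriv e u) x)"
    if "e \<in> Basis" "e' \<in> Basis" for e e'
    using E that unfolding Ck_extends.simps cl by blast+
  have basis: "(axis i 1, 0) \<in> (Basis :: ((real^'n) \<times> real) set)" "(0, 1) \<in> (Basis :: ((real^'n) \<times> real) set)" for i
    by (auto simp: Basis_prod_def axis_in_Basis_iff)
  have "\<forall>e. \<exists>h. e \<in> Basis \<longrightarrow> continuous_on (UNIV \<times> {0..}) h \<and> (\<forall>x\<in>?H. h x = partial_deriv e u x)"
    using ext1 by blast
  then obtain D1 where D1: "\<And>e. e \<in> Basis \<Longrightarrow> continuous_on (UNIV \<times> {0..}) (D1 e)"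
    "\<And>e x. e \<in> Basis \<Longrightarrow> x \<in> ?H \<Longrightarrow> D1 e x = partial_deriv e u x" by metis
  have "\<forall>e e'. \<exists>h. e \<in> Basis \<longrightarrow> e' \<in> Basis \<longrightarrow> continuous_on (UNIV \<times> {0..}) h \<and> (\<forall>x\<in>?H. h x = partial_deriv e' (partial_deriv e u) x)"
    using ext2 by blast
  then obtain D2 where D2: "\<And>e e'. e \<in> Basis \<Longrightarrow> e' \<in> Basis \<Longrightarrow> continuous_on (UNIV \<times> {0..}) (D2 e e')"
    "\<And>e e' x. e \<in> Basis \<Longrightarrow> e' \<in> Basis \<Longrightarrow> x \<in> ?H \<Longrightarrow> D2 e e' x = partial_deriv e' (partial_deriv e u) x" by metis
  have d1: "((\<lambda>s. u (x + s *\<^sub>R e)) has_real_derivative D1 e x) (at 0)" if "e \<in> Basis" "x \<in> ?H" for e x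
    using has_real_derivative_partial_deriv[OF u_diff open_half_space that(2), of e] D1(2)[OF that] by simp
  have d2: "((\<lambda>s. D1 e (x + s *\<^sub>R e')) has_real_derivative D2 e e' x) (at 0)"
    if "e \<in> Basis" "e' \<in> Basis" "x \<in> ?H" for e e' x
  proof -
    have "((\<lambda>s. partial_deriv e u (x + s *\<^sub>R e')) has_real_derivative D2 e e' x) (at 0)"
      using has_real_derivative_partial_deriv[OF diff1[OF that(1,1)] open_half_space that(3), of e'] D2(2)[OF that] by simp
    moreover have "open ((\<lambda>s. x + s *\<^sub>R e') -` ?H)"
      by (intro open_vimage open_half_space continuous_intros)
    ultimately show ?thesis
      by (rule has_field_derivative_transform_within_open) (use that D1(2) in auto)
  qed
  have H: "(x, t) \<in> ?H \<longleftrightarrow> t > 0" for x :: "real^'n" and t by (simp add: half_space_def)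
  have shift: "((\<lambda>t. f (x, t)) has_real_derivative D) (at t)"
    if "((\<lambda>s. f ((x, t) + s *\<^sub>R (0, 1))) has_real_derivative D) (at 0)" for f :: "(real^'n) \<times> real \<Rightarrow> real" and x t D
    using that DERIV_shift[of "\<lambda>t. f (x, t)" D 0 t] by (simp add: add.commute)
  show ?thesis
  proof (rule that[of "D1 (0, 1)" "D2 (0, 1) (0, 1)" "\<lambda>i. D1 (axis i 1, 0)" "\<lambda>i j. D2 (axis j 1, 0) (axis i 1, 0)"])
    fix x :: "real^'n" and t :: real assume t: "t > 0"
    show "((\<lambda>t. u (x, t)) has_real_derivative D1 (0, 1) (x, t)) (at t)"
      using d1[OF basis(2), of "(x, t)"] t by (intro shift) (auto simp: H)
    show "((\<lambda>t. D1 (0, 1) (x, t)) has_real_derivative D2 (0, 1) (0, 1) (x, t)) (at t)"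
      using d2[OF basis(2,2), of "(x, t)"] t by (intro shift) (auto simp: H)
  next
    fix i j and x :: "real^'n" and t :: real assume t: "t \<ge> 0"
    show "((\<lambda>s. u (x + s *\<^sub>R axis i 1, t)) has_real_derivative D1 (axis i 1, 0) (x, t)) (at 0)"
    proof (rule tangential_derivative_at_boundary[OF u D1(1)[OF basis(1)] _ t])
      show "((\<lambda>s. u (x + s *\<^sub>R axis i 1, t)) has_real_derivative D1 (axis i 1, 0) (x, t)) (at 0)" if "t > 0" for x t
        using d1[OF basis(1), of "(x, t)" i] that by (auto simp: H)
    qed
    show "((\<lambda>s. D1 (axis j 1, 0) (x + s *\<^sub>R axis i 1, t)) has_real_derivative D2 (axis j 1, 0) (axis i 1, 0) (x, t)) (at 0)"
    proof (rule tangential_derivative_at_boundary[OF D1(1)[OF basis(1)] D2(1)[OF basis(1,1)] _ t])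
      show "((\<lambda>s. D1 (axis j 1, 0) (x + s *\<^sub>R axis i 1, t)) has_real_derivative D2 (axis j 1, 0) (axis i 1, 0) (x, t)) (at 0)"
        if "t > 0" for x t
        using d2[OF basis(1,1), of "(x, t)" j i] that by (auto simp: H)
    qed
  qed (use u D1(1) D2(1) basis in auto)
qed

lemma block_divergence_eq:
  fixes u :: "(real^'n) \<times> real \<Rightarrow> real" and Ahat :: "real^'n \<Rightarrow> real^'n^'n"
  assumes a_der: "\<And>i j x. ((\<lambda>s. Ahat (x + s *\<^sub>R axis i 1) $ i $ j) has_real_derivative da i j x) (at 0)"
    and u_t: "\<And>x t. t > 0 \<Longrightarrow> ((\<lambda>t. u (x, t)) has_real_derivative ut (x, t)) (at t)"
    and ut_t: "\<And>x t. t > 0 \<Longrightarrow> ((\<lambda>t. ut (x, t)) has_real_derivative utt (x, t)) (at t)"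
    and u_x: "\<And>i x t. t > 0 \<Longrightarrow> ((\<lambda>s. u (x + s *\<^sub>R axis i 1, t)) has_real_derivative ux i (x, t)) (at 0)"
    and ux_x: "\<And>i j x t. t > 0 \<Longrightarrow> ((\<lambda>s. ux j (x + s *\<^sub>R axis i 1, t)) has_real_derivative uxx i j (x, t)) (at 0)"
    and t: "t > 0"
  shows "divergence (\<lambda>y. block_mult (Ahat (fst y)) (grad u y)) (x, t)
    = (\<Sum>i\<in>UNIV. \<Sum>j\<in>UNIV. da i j x * ux j (x, t) + Ahat x $ i $ j * uxx i j (x, t)) + utt (x, t)"
proof -
  let ?F = "\<lambda>y. block_mult (Ahat (fst y)) (grad u y)"
  have sumB: "(\<Sum>e\<in>(Basis :: ((real^'n) \<times> real) set). h e) = (\<Sum>i\<in>UNIV. h (axis i 1, 0)) + h (0, 1)"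
    for h :: "(real^'n) \<times> real \<Rightarrow> 'b::comm_monoid_add"
  proof -
    have eq: "(Basis :: ((real^'n) \<times> real) set) = range (\<lambda>i. (axis i 1, 0)) \<union> {(0, 1)}"
      by (auto simp: Basis_prod_def Basis_vec_def)
    have "inj (\<lambda>i. (axis i (1::real), 0::real) :: (real^'n) \<times> real)"
      by (auto simp: inj_on_def axis_eq_axis)
    then show ?thesis
      unfolding eq by (subst sum.union_disjoint) (auto simp: sum.reindex add.commute)
  qed
  have pt: "partial_deriv (0, 1) u (y, \<tau>) = ut (y, \<tau>)" if "\<tau> > 0" for y \<tau>
    using u_t[OF that, of y] DERIV_shift[of "\<lambda>t. u (y, t)" "ut (y, \<tau>)" 0 \<tau>]
    by (intro partial_deriv_unique) (simp add: add.commute)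
  have px: "partial_deriv (axis i 1, 0) u (y, \<tau>) = ux i (y, \<tau>)" if "\<tau> > 0" for i y \<tau>
    using u_x[OF that, of y i] by (intro partial_deriv_unique) simp
  have gr: "grad u (y, \<tau>) = (\<chi> j. ux j (y, \<tau>), ut (y, \<tau>))" if "\<tau> > 0" for y \<tau>
  proof -
    have "(\<Sum>i\<in>UNIV. ux i (y, \<tau>) *\<^sub>R axis i 1) = (\<chi> j. ux j (y, \<tau>))"
      by (simp add: vec_eq_iff axis_def if_distrib cong: if_cong)
    then show ?thesis
      unfolding grad_def sumB using that
      by (simp add: pt px prod_eq_iff fst_sum snd_sum)
  qed
  have Fx: "?F (y, \<tau>) \<bullet> (axis i 1, 0) = (\<Sum>j\<in>UNIV. Ahat y $ i $ j * ux j (y, \<tau>))" if "\<tau> > 0" for i y \<tau>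
    using that by (simp add: gr block_mult_def inner_axis matrix_vector_mult_def)
  have Ft: "?F (y, \<tau>) \<bullet> (0, 1) = ut (y, \<tau>)" if "\<tau> > 0" for y \<tau>
    using that by (simp add: gr block_mult_def)
  have Dx: "partial_deriv (axis i 1, 0) (\<lambda>y. ?F y \<bullet> (axis i 1, 0)) (x, t)
      = (\<Sum>j\<in>UNIV. da i j x * ux j (x, t) + Ahat x $ i $ j * uxx i j (x, t))" for i
  proof (rule partial_deriv_unique)
    have "((\<lambda>s. \<Sum>j\<in>UNIV. Ahat (x + s *\<^sub>R axis i 1) $ i $ j * ux j (x + s *\<^sub>R axis i 1, t)) has_real_derivative
        (\<Sum>j\<in>UNIV. da i j x * ux j (x, t) + Ahat x $ i $ j * uxx i j (x, t))) (at 0)"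
      by (rule DERIV_sum, rule DERIV_cong[OF DERIV_mult[OF a_der ux_x[OF t]]]) simp
    then show "((\<lambda>s. ?F ((x, t) + s *\<^sub>R (axis i 1, 0)) \<bullet> (axis i 1, 0)) has_real_derivative
        (\<Sum>j\<in>UNIV. da i j x * ux j (x, t) + Ahat x $ i $ j * uxx i j (x, t))) (at 0)"
      using Fx[OF t] by simp
  qed
  have Dt: "partial_deriv (0, 1) (\<lambda>y. ?F y \<bullet> (0, 1)) (x, t) = utt (x, t)"
  proof (rule partial_deriv_unique)
    have "((\<lambda>s. ut (x, s + t)) has_real_derivative utt (x, t)) (at 0)"
      using ut_t[OF t, of x] DERIV_shift[of "\<lambda>t. ut (x, t)" "utt (x, t)" 0 t] by simp
    then show "((\<lambda>s. ?F ((x, t) + s *\<^sub>R (0, 1)) \<bullet> (0, 1)) has_real_derivative utt (x, t)) (at 0)"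
      by (rule has_field_derivative_transform_within_open[OF _ open_greaterThan[of "-t"]])
        (use t Ft[of "_ + t" x] in \<open>auto simp: add.commute\<close>)
  qed
  show ?thesis unfolding divergence_def sumB Dx Dt ..
qed

text \<open>Here \<open>da i j\<close> is \<open>\<partial>\<^sub>i a\<^sub>i\<^sub>j\<close>, the derivative that enters the divergence; summing the bounds of the
finitely many entries gives one bound \<open>K\<close> for all of them.\<close>
lemma admissible_matrix_derivatives:
  fixes Ahat :: "real^'n \<Rightarrow> real^'n^'n"
  assumes "admissible_matrix Ahat"
  obtains da K where
    "\<And>i j. continuous_on UNIV (\<lambda>x. Ahat x $ i $ j)" "\<And>i j. continuous_on UNIV (da i j)"
    "\<And>i j x. ((\<lambda>s. Ahat (x + s *\<^sub>R axis i 1) $ i $ j) has_real_derivative da i j x) (at 0)"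
    "\<And>i j x. \<bar>Ahat x $ i $ j\<bar> \<le> K"
    "\<And>i j x. Ahat x $ i $ j = Ahat x $ j $ i"
    "\<And>x q. q \<noteq> (\<lambda>_. 0) \<Longrightarrow> 0 < (\<Sum>i\<in>UNIV. \<Sum>j\<in>UNIV. Ahat x $ i $ j * q i * q j)"
proof -
  define da where "da i j = partial_deriv (axis i 1) (\<lambda>x. Ahat x $ i $ j)" for i j
  have E: "Ck_extends (Suc 0) UNIV (\<lambda>x. Ahat x $ i $ j)" and cont: "continuous_on UNIV (\<lambda>x. Ahat x $ i $ j)"
    and Linf: "L_infinity (\<lambda>x. Ahat x $ i $ j)" for i j
    using assms unfolding admissible_matrix_def Ck_closure_def One_nat_def closure_UNIV by blast+
  have diff: "(\<lambda>x. Ahat x $ i $ j) differentiable_on UNIV" for i j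
    using E unfolding Ck_extends.simps by blast
  have ext: "\<exists>h. continuous_on UNIV h \<and> (\<forall>x\<in>UNIV. h x = da i j x)" for i j
    using E[of i j] axis_in_Basis_iff[of i "1::real"] unfolding Ck_extends.simps closure_UNIV da_def by simp
  have da_cont: "continuous_on UNIV (da i j)" for i j
  proof -
    obtain h where "continuous_on UNIV h" "\<forall>x\<in>UNIV. h x = da i j x" using ext by blast
    moreover from this(2) have "h = da i j" by auto
    ultimately show ?thesis by simp
  qed
  have der: "((\<lambda>s. Ahat (x + s *\<^sub>R axis i 1) $ i $ j) has_real_derivative da i j x) (at 0)" for i j x
    unfolding da_def by (rule has_real_derivative_partial_deriv[OF diff open_UNIV UNIV_I])
  obtain B where B: "\<And>i j x. \<bar>Ahat x $ i $ j\<bar> \<le> B i j"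
    using essentially_bounded_continuous_imp_bounded[OF Linf cont] by metis
  have bd: "\<bar>Ahat x $ i $ j\<bar> \<le> (\<Sum>i\<in>UNIV. \<Sum>j\<in>UNIV. B i j)" for i j x
  proof -
    have B0: "B i j \<ge> 0" for i j using B[of 0 i j] by linarith
    have "B i j \<le> (\<Sum>j\<in>UNIV. B i j)" by (rule member_le_sum) (auto simp: B0)
    also have "\<dots> \<le> (\<Sum>i\<in>UNIV. \<Sum>j\<in>UNIV. B i j)"
      by (rule member_le_sum[where f = "\<lambda>i. \<Sum>j\<in>UNIV. B i j"]) (auto simp: B0 intro!: sum_nonneg)
    finally show ?thesis using B[of x i j] by linarith
  qed
  have sym: "Ahat x $ i $ j = Ahat x $ j $ i" for i j x
  proof -
    have "transpose (Ahat x) = Ahat x" using assms by (simp add: admissible_matrix_def)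
    then have "transpose (Ahat x) $ i $ j = Ahat x $ i $ j" by simp
    then show ?thesis by (simp add: transpose_def)
  qed
  have pos: "0 < (\<Sum>i\<in>UNIV. \<Sum>j\<in>UNIV. Ahat x $ i $ j * q i * q j)" if "q \<noteq> (\<lambda>_. 0)" for x q
  proof -
    have "(\<chi> i. q i) \<noteq> 0" using that by (auto simp: vec_eq_iff)
    then have "0 < (\<Sum>i\<in>UNIV. \<Sum>j\<in>UNIV. Ahat x $ i $ j * (\<chi> i. q i) $ i * (\<chi> i. q i) $ j)"
      using assms unfolding admissible_matrix_def by blast
    then show ?thesis by simp
  qed
  show ?thesis by (rule that[OF cont da_cont der bd sym pos])
qed

section \<open>Moments of a solution over one period\<close>

text \<open>The coordinate form of the hypotheses, for the coefficients \<open>a\<close> and a solution \<open>u\<close> with its derivatives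
extended to the closed half-space as in \<open>C2_half_space_derivatives\<close>; \<open>da i j\<close> is \<open>\<partial>\<^sub>i a\<^sub>i\<^sub>j\<close>.\<close>
locale half_space_solution =
  fixes a da :: "'n::finite \<Rightarrow> 'n \<Rightarrow> real^'n \<Rightarrow> real" and K :: real
    and u ut utt :: "(real^'n) \<times> real \<Rightarrow> real"
    and ux :: "'n \<Rightarrow> (real^'n) \<times> real \<Rightarrow> real"
    and uxx :: "'n \<Rightarrow> 'n \<Rightarrow> (real^'n) \<times> real \<Rightarrow> real"
    and g :: "real \<Rightarrow> real"
  assumes dim: "CARD('n) \<le> 2"
    and a_cont: "continuous_on UNIV (a i j)"
    and a_sym: "a i j x = a j i x"
    and a_bd: "\<bar>a i j x\<bar> \<le> K"
    and a_pos: "q \<noteq> (\<lambda>_. 0) \<Longrightarrow> 0 < (\<Sum>i\<in>UNIV. \<Sum>j\<in>UNIV. a i j x * q i * q j)"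
    and a_der: "((\<lambda>s. a i j (x + s *\<^sub>R axis i 1)) has_real_derivative da i j x) (at 0)"
    and da_cont: "continuous_on UNIV (da i j)"
    and u_cont: "continuous_on (UNIV \<times> {0..}) u" and ut_cont: "continuous_on (UNIV \<times> {0..}) ut"
    and utt_cont: "continuous_on (UNIV \<times> {0..}) utt"
    and ux_cont: "continuous_on (UNIV \<times> {0..}) (ux i)" and uxx_cont: "continuous_on (UNIV \<times> {0..}) (uxx i j)"
    and u_t: "t > 0 \<Longrightarrow> ((\<lambda>t. u (x, t)) has_real_derivative ut (x, t)) (at t)"
    and ut_t: "t > 0 \<Longrightarrow> ((\<lambda>t. ut (x, t)) has_real_derivative utt (x, t)) (at t)"
    and u_x: "t \<ge> 0 \<Longrightarrow> ((\<lambda>s. u (x + s *\<^sub>R axis i 1, t)) has_real_derivative ux i (x, t)) (at 0)"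
    and ux_x: "t \<ge> 0 \<Longrightarrow> ((\<lambda>s. ux j (x + s *\<^sub>R axis i 1, t)) has_real_derivative uxx i j (x, t)) (at 0)"
    and equation: "t > 0 \<Longrightarrow> (\<Sum>i\<in>UNIV. \<Sum>j\<in>UNIV. da i j x * ux j (x, t) + a i j x * uxx i j (x, t))
               + utt (x, t) + u (x, t) = g t"
    and g_cont: "continuous_on UNIV g" and g_per: "g (t + 2 * pi) = g t"
    and u_0: "u (x, 0) = 0"
    and u_nonneg: "t \<ge> 0 \<Longrightarrow> 0 \<le> u (x, t)"
    and u_bdd: "L > 0 \<Longrightarrow> \<exists>C. \<forall>x. \<forall>t\<in>{0..L}. u (x, t) \<le> C"
begin

definition moment :: "((real^'n) \<times> real \<Rightarrow> real) \<Rightarrow> real \<Rightarrow> (real \<Rightarrow> real) \<Rightarrow> real^'n \<Rightarrow> real" where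
  "moment w T \<psi> x = integral {0..2*pi} (\<lambda>t. w (x, T + t) * \<psi> t)"

lemma continuous_on_strip:
  fixes w :: "(real^'n) \<times> real \<Rightarrow> real" and A :: "'b::topological_space set"
  assumes "continuous_on (UNIV \<times> {0..}) w" "T \<ge> 0" "continuous_on UNIV \<psi>" "continuous_on A p" "continuous_on A q"
    "\<And>y. y \<in> A \<Longrightarrow> q y \<ge> 0"
  shows "continuous_on A (\<lambda>y. w (p y, T + q y) * \<psi> (q y))"
proof (rule continuous_on_mult)
  show "continuous_on A (\<lambda>y. w (p y, T + q y))"
  proof (rule continuous_on_compose2[OF assms(1)])
    show "continuous_on A (\<lambda>y. (p y, T + q y))"
      by (intro continuous_on_Pair continuous_on_add continuous_on_const assms(4,5))
    show "(\<lambda>y. (p y, T + q y)) ` A \<subseteq> UNIV \<times> {0..}"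
      using assms(2,6) by (auto intro: add_nonneg_nonneg)
  qed
  show "continuous_on A (\<lambda>y. \<psi> (q y))"
    by (rule continuous_on_compose2[OF assms(3,5)]) simp
qed

lemma has_integral_moment:
  assumes "continuous_on (UNIV \<times> {0..}) w" "T \<ge> 0" "continuous_on UNIV \<psi>"
  shows "((\<lambda>t. w (x, T + t) * \<psi> t) has_integral moment w T \<psi> x) {0..2*pi}"
  unfolding moment_def
  by (intro integrable_integral integrable_continuous_real
      continuous_on_strip[where p = "\<lambda>_. x" and q = "\<lambda>t. t"] assms continuous_intros) auto

lemma continuous_moment:
  assumes "continuous_on (UNIV \<times> {0..}) w" "T \<ge> 0" "continuous_on UNIV \<psi>"
  shows "continuous_on UNIV (moment w T \<psi>)"
  unfolding moment_def cbox_interval[symmetric]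
  by (rule integral_continuous_on_param, unfold case_prod_unfold,
      rule continuous_on_strip[where p = fst and q = snd]) (use assms in \<open>auto intro!: continuous_intros\<close>)

lemma moment_der:
  assumes w: "continuous_on (UNIV \<times> {0..}) w" and w': "continuous_on (UNIV \<times> {0..}) w'"
    and T: "T \<ge> 0" and \<psi>: "continuous_on UNIV \<psi>"
    and der: "\<And>x t. t \<ge> 0 \<Longrightarrow> ((\<lambda>s. w (x + s *\<^sub>R e, t)) has_real_derivative w' (x, t)) (at 0)"
  shows "((\<lambda>s. moment w T \<psi> (x + s *\<^sub>R e)) has_real_derivative moment w' T \<psi> x) (at 0)"
proof -
  have "((\<lambda>s. integral (cbox 0 (2*pi)) (\<lambda>t. w (x + s *\<^sub>R e, T + t) * \<psi> t)) has_field_derivative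
      integral (cbox 0 (2*pi)) (\<lambda>t. w' (x + 0 *\<^sub>R e, T + t) * \<psi> t)) (at 0 within UNIV)"
  proof (rule leibniz_rule_field_derivative[where fx = "\<lambda>s t. w' (x + s *\<^sub>R e, T + t) * \<psi> t"])
    fix s t :: real assume "t \<in> cbox 0 (2*pi)"
    then have "T + t \<ge> 0" using T by simp
    then have "((\<lambda>s. w (x + s *\<^sub>R e, T + t)) has_real_derivative w' (x + s *\<^sub>R e, T + t)) (at s)"
      by (intro has_real_derivative_along_line[where X = "\<lambda>x. w (x, T + t)" and X' = "\<lambda>x. w' (x, T + t)"] der)
    then show "((\<lambda>s. w (x + s *\<^sub>R e, T + t) * \<psi> t) has_field_derivative w' (x + s *\<^sub>R e, T + t) * \<psi> t) (at s within UNIV)"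
      by (auto intro: DERIV_cmult_right)
  next
    show "(\<lambda>t. w (x + s *\<^sub>R e, T + t) * \<psi> t) integrable_on cbox 0 (2*pi)" for s
      using has_integral_moment[OF w T \<psi>] by (auto intro: has_integral_integrable)
    show "continuous_on (UNIV \<times> cbox 0 (2*pi)) (\<lambda>(s, t). w' (x + s *\<^sub>R e, T + t) * \<psi> t)"
      unfolding case_prod_unfold
      by (rule continuous_on_strip[where p = "\<lambda>y. x + fst y *\<^sub>R e" and q = snd])
        (use w' T \<psi> in \<open>auto intro!: continuous_intros\<close>)
  qed auto
  then show ?thesis unfolding moment_def by simp
qed

text \<open>The function \<open>u\<^sub>t \<psi> - u \<psi>'\<close> is a primitive of \<open>(u\<^sub>t\<^sub>t + \<mu> u) \<psi>\<close>.\<close>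
lemma moment_by_parts:
  assumes T: "T \<ge> 0"
    and \<psi>: "\<And>t. (\<psi> has_real_derivative \<psi>' t) (at t)" and \<psi>': "\<And>t. (\<psi>' has_real_derivative - \<mu> * \<psi> t) (at t)"
  shows "moment utt T \<psi> x + \<mu> * moment u T \<psi> x
    = (ut (x, T + 2*pi) * \<psi> (2*pi) - u (x, T + 2*pi) * \<psi>' (2*pi)) - (ut (x, T) * \<psi> 0 - u (x, T) * \<psi>' 0)"
proof -
  have c: "continuous_on UNIV \<psi>" "continuous_on UNIV \<psi>'"
    using \<psi> \<psi>' by (meson DERIV_isCont continuous_at_imp_continuous_on)+
  have "((\<lambda>t. utt (x, T + t) * \<psi> t + \<mu> * (u (x, T + t) * \<psi> t)) has_integral
    (ut (x, T + 2*pi) * \<psi> (2*pi) - u (x, T + 2*pi) * \<psi>' (2*pi)) - (ut (x, T + 0) * \<psi> 0 - u (x, T + 0) * \<psi>' 0)) {0..2*pi}"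
  proof (rule fundamental_theorem_of_calculus_interior)
    show "continuous_on {0..2*pi} (\<lambda>t. ut (x, T + t) * \<psi> t - u (x, T + t) * \<psi>' t)"
      by (intro continuous_on_diff continuous_on_strip[where p = "\<lambda>_. x" and q = "\<lambda>t. t"] ut_cont u_cont T c continuous_intros) auto
    fix t assume "t \<in> {0<..<2*pi}"
    then have pos: "T + t > 0" using T by simp
    have "((\<lambda>t. u (x, T + t)) has_real_derivative ut (x, T + t)) (at t)"
      "((\<lambda>t. ut (x, T + t)) has_real_derivative utt (x, T + t)) (at t)"
      using u_t[OF pos, of x] ut_t[OF pos, of x]
        DERIV_shift[of "\<lambda>t. u (x, t)" _ t T] DERIV_shift[of "\<lambda>t. ut (x, t)" _ t T] by (simp_all add: add.commute)
    note D = DERIV_diff[OF DERIV_mult[OF this(2) \<psi>] DERIV_mult[OF this(1) \<psi>']]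
    show "((\<lambda>t. ut (x, T + t) * \<psi> t - u (x, T + t) * \<psi>' t) has_vector_derivative
        utt (x, T + t) * \<psi> t + \<mu> * (u (x, T + t) * \<psi> t)) (at t)"
      unfolding has_real_derivative_iff_has_vector_derivative[symmetric]
      by (rule DERIV_cong[OF D]) (simp add: algebra_simps)
  qed simp
  then have I: "((\<lambda>t. utt (x, T + t) * \<psi> t + \<mu> * (u (x, T + t) * \<psi> t)) has_integral
    (ut (x, T + 2*pi) * \<psi> (2*pi) - u (x, T + 2*pi) * \<psi>' (2*pi)) - (ut (x, T) * \<psi> 0 - u (x, T) * \<psi>' 0)) {0..2*pi}"
    by simp
  have "((\<lambda>t. utt (x, T + t) * \<psi> t + \<mu> * (u (x, T + t) * \<psi> t)) has_integral
      (moment utt T \<psi> x + \<mu> * moment u T \<psi> x)) {0..2*pi}"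
    by (intro has_integral_add has_integral_mult_right has_integral_moment utt_cont u_cont T c)
  from has_integral_unique[OF this I] show ?thesis .
qed

text \<open>The divergence of the flux \<open>Ahat \<nabla>U\<close> of the moment \<open>U\<close> of \<open>u\<close> when \<open>\<psi>'' = - \<mu> \<psi>\<close>, by \<open>moment_equation\<close>.\<close>
definition moment_rhs :: "real \<Rightarrow> (real \<Rightarrow> real) \<Rightarrow> (real \<Rightarrow> real) \<Rightarrow> real \<Rightarrow> real^'n \<Rightarrow> real" where
  "moment_rhs T \<psi> \<psi>' \<mu> x = integral {0..2*pi} (\<lambda>t. g (T + t) * \<psi> t) + (\<mu> - 1) * moment u T \<psi> x
    - ((ut (x, T + 2*pi) * \<psi> (2*pi) - u (x, T + 2*pi) * \<psi>' (2*pi)) - (ut (x, T) * \<psi> 0 - u (x, T) * \<psi>' 0))"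

text \<open>The \<open>i\<close>-th partial derivative of the \<open>i\<close>-th component of that flux, by \<open>moment_flux_der\<close>.\<close>
definition moment_flux :: "real \<Rightarrow> (real \<Rightarrow> real) \<Rightarrow> 'n \<Rightarrow> real^'n \<Rightarrow> real" where
  "moment_flux T \<psi> i x = (\<Sum>j\<in>UNIV. da i j x * moment (ux j) T \<psi> x + a i j x * moment (uxx i j) T \<psi> x)"

lemma moment_flux_der:
  assumes "T \<ge> 0" "continuous_on UNIV \<psi>"
  shows "((\<lambda>s. \<Sum>j\<in>UNIV. a i j (x + s *\<^sub>R axis i 1) * moment (ux j) T \<psi> (x + s *\<^sub>R axis i 1))
           has_real_derivative moment_flux T \<psi> i x) (at 0)"
  unfolding moment_flux_def
proof (rule DERIV_sum)
  fix j
  have "((\<lambda>s. moment (ux j) T \<psi> (x + s *\<^sub>R axis i 1)) has_real_derivative moment (uxx i j) T \<psi> x) (at 0)"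
    by (rule moment_der[OF ux_cont uxx_cont assms ux_x])
  then show "((\<lambda>s. a i j (x + s *\<^sub>R axis i 1) * moment (ux j) T \<psi> (x + s *\<^sub>R axis i 1)) has_real_derivative
      da i j x * moment (ux j) T \<psi> x + a i j x * moment (uxx i j) T \<psi> x) (at 0)"
    by (intro DERIV_cong[OF DERIV_mult[OF a_der]]) (assumption, simp)
qed

lemma moment_equation:
  assumes T: "T \<ge> 0"
    and \<psi>: "\<And>t. (\<psi> has_real_derivative \<psi>' t) (at t)" and \<psi>': "\<And>t. (\<psi>' has_real_derivative - \<mu> * \<psi> t) (at t)"
  shows "(\<Sum>i\<in>UNIV. moment_flux T \<psi> i x) = moment_rhs T \<psi> \<psi>' \<mu> x"
proof -
  have c: "continuous_on UNIV \<psi>"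
    using \<psi> by (meson DERIV_isCont continuous_at_imp_continuous_on)
  note mi = has_integral_moment[OF _ T c]
  have g: "((\<lambda>t. g (T + t) * \<psi> t) has_integral integral {0..2*pi} (\<lambda>t. g (T + t) * \<psi> t)) {0..2*pi}"
    by (intro integrable_integral integrable_continuous_real continuous_on_mult
        continuous_on_compose2[OF g_cont, of _ "\<lambda>t. T + t"] continuous_on_subset[OF c] continuous_intros) auto
  have 1: "((\<lambda>t. \<Sum>i\<in>UNIV. \<Sum>j\<in>UNIV. da i j x * (ux j (x, T + t) * \<psi> t) + a i j x * (uxx i j (x, T + t) * \<psi> t))
      has_integral (\<Sum>i\<in>UNIV. moment_flux T \<psi> i x)) {0..2*pi}"
    unfolding moment_flux_def
    by (intro has_integral_sum has_integral_add has_integral_mult_right mi ux_cont uxx_cont finite)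
  have 2: "((\<lambda>t. g (T + t) * \<psi> t - utt (x, T + t) * \<psi> t - u (x, T + t) * \<psi> t) has_integral
     integral {0..2*pi} (\<lambda>t. g (T + t) * \<psi> t) - moment utt T \<psi> x - moment u T \<psi> x) {0..2*pi}"
    by (intro has_integral_diff g mi utt_cont u_cont)
  have "(\<Sum>i\<in>UNIV. moment_flux T \<psi> i x)
      = integral {0..2*pi} (\<lambda>t. g (T + t) * \<psi> t) - moment utt T \<psi> x - moment u T \<psi> x"
  \<comment> \<open>At \<open>t = 0\<close> with \<open>T = 0\<close> the equation is not available; a single point does not affect the integral.\<close>
  proof (rule has_integral_unique[OF has_integral_spike_finite[OF _ _ 1] 2])
    show "finite {0::real}" by simp
    fix t assume "t \<in> {0..2*pi} - {0}"
    then have pos: "T + t > 0" using T by auto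
    have "(\<Sum>i\<in>UNIV. \<Sum>j\<in>UNIV. da i j x * (ux j (x, T + t) * \<psi> t) + a i j x * (uxx i j (x, T + t) * \<psi> t))
      = (\<Sum>i\<in>UNIV. \<Sum>j\<in>UNIV. da i j x * ux j (x, T + t) + a i j x * uxx i j (x, T + t)) * \<psi> t"
      by (simp only: sum_distrib_right) (simp add: algebra_simps)
    also have "\<dots> = (g (T + t) - utt (x, T + t) - u (x, T + t)) * \<psi> t"
      using equation[OF pos, of x] by (intro arg_cong2[of _ _ _ _ "(*)"] refl) linarith
    finally show "g (T + t) * \<psi> t - utt (x, T + t) * \<psi> t - u (x, T + t) * \<psi> t
      = (\<Sum>i\<in>UNIV. \<Sum>j\<in>UNIV. da i j x * (ux j (x, T + t) * \<psi> t) + a i j x * (uxx i j (x, T + t) * \<psi> t))"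
      by (simp add: algebra_simps)
  qed
  also have "\<dots> = moment_rhs T \<psi> \<psi>' \<mu> x"
    using moment_by_parts[OF T \<psi> \<psi>', of x] unfolding moment_rhs_def by (simp add: algebra_simps)
  finally show ?thesis .
qed

lemma moment_bounded:
  assumes T: "T \<ge> 0" and c: "continuous_on UNIV \<psi>" and b: "\<And>t. \<bar>\<psi> t\<bar> \<le> 1"
  obtains C where "\<And>x. \<bar>moment u T \<psi> x\<bar> \<le> C"
proof -
  have "T + 2*pi > 0" using T pi_gt_zero by (intro add_nonneg_pos) auto
  from u_bdd[OF this] obtain C where "\<forall>x. \<forall>t\<in>{0..T + 2*pi}. u (x, t) \<le> C" ..
  then have C: "u (x, t) \<le> C" if "0 \<le> t" "t \<le> T + 2*pi" for x t using that by simp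
  have "norm (moment u T \<psi> x) \<le> C * measure lborel (cbox 0 (2*pi))" for x
  proof (rule has_integral_bound)
    show "0 \<le> C" using C[of 0 x] u_0[of x] T \<open>T + 2*pi > 0\<close> by simp
    show "((\<lambda>t. u (x, T + t) * \<psi> t) has_integral moment u T \<psi> x) (cbox 0 (2*pi))"
      using has_integral_moment[OF u_cont T c] by simp
    fix t :: real assume "t \<in> cbox 0 (2*pi)"
    then have "0 \<le> u (x, T + t)" "u (x, T + t) \<le> C" using T by (auto intro!: u_nonneg C)
    then have "\<bar>u (x, T + t)\<bar> * \<bar>\<psi> t\<bar> \<le> C * 1" using b by (intro mult_mono) auto
    with \<open>0 \<le> u (x, T + t)\<close> show "norm (u (x, T + t) * \<psi> t) \<le> C" by (simp add: abs_mult)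
  qed
  then show ?thesis by (intro that) (simp only: real_norm_def)
qed

text \<open>The constant \<open>m\<close> may be added because it changes neither the gradient nor the flux of the moment.
It makes a moment nonnegative when \<open>moment_rhs\<close> has a sign, and it makes \<open>moment_rhs\<close> a multiple
of the shifted moment when \<open>\<mu> > 1\<close>.\<close>
lemma moment_Liouville:
  assumes T: "T \<ge> 0"
    and \<psi>: "\<And>t. (\<psi> has_real_derivative \<psi>' t) (at t)" and \<psi>': "\<And>t. (\<psi>' has_real_derivative - \<mu> * \<psi> t) (at t)"
    and b: "\<And>t. \<bar>\<psi> t\<bar> \<le> 1"
    and sign: "\<And>x. 0 \<le> (moment u T \<psi> x + m) * moment_rhs T \<psi> \<psi>' \<mu> x"
  shows "moment_rhs T \<psi> \<psi>' \<mu> x = 0" and "moment (ux i) T \<psi> x = 0"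
proof -
  have c: "continuous_on UNIV \<psi>"
    using \<psi> by (meson DERIV_isCont continuous_at_imp_continuous_on)
  obtain C where C: "\<And>x. \<bar>moment u T \<psi> x\<bar> \<le> C" using moment_bounded[OF T c b] by blast
  have der: "((\<lambda>s. moment u T \<psi> (x + s *\<^sub>R axis i 1) + m) has_real_derivative moment (ux i) T \<psi> x) (at 0)" for i x
    using DERIV_add[OF moment_der[OF u_cont ux_cont T c u_x] DERIV_const] by simp
  have bd: "\<bar>moment u T \<psi> x + m\<bar> \<le> C + \<bar>m\<bar>" for x using C[of x] by linarith
  have sign': "0 \<le> (moment u T \<psi> x + m) * (\<Sum>i\<in>UNIV. moment_flux T \<psi> i x)" for x
    unfolding moment_equation[OF T \<psi> \<psi>'] by (rule sign)
  have fc: "continuous_on UNIV (moment_flux T \<psi> i)" for i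
    unfolding moment_flux_def by (intro continuous_intros a_cont da_cont continuous_moment ux_cont uxx_cont T c)
  have uc: "continuous_on UNIV (\<lambda>x. moment u T \<psi> x + m)"
    by (intro continuous_intros continuous_moment u_cont T c)
  have L: "moment (ux i) T \<psi> x = 0 \<and> moment_flux T \<psi> i x = 0" for i x
    using bounded_Liouville_dim_le_2[where a = a and K = K and U = "\<lambda>x. moment u T \<psi> x + m" and M = "C + \<bar>m\<bar>"
        and G = "\<lambda>i. moment (ux i) T \<psi>" and f = "moment_flux T \<psi>" and i = i and x = x]
      dim a_cont a_sym a_bd a_pos uc bd der continuous_moment[OF ux_cont T c] moment_flux_der[OF T c] fc sign'
    by blast
  show "moment (ux i) T \<psi> x = 0" using L by blast
  show "moment_rhs T \<psi> \<psi>' \<mu> x = 0"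
    using moment_equation[OF T \<psi> \<psi>', of x] L by simp
qed

end

section \<open>Solutions are one-dimensional and periodic\<close>

context half_space_solution
begin

lemma ut_zero:
  assumes "t > 0" "u (x, t) = 0"
  shows "ut (x, t) = 0"
  by (rule DERIV_local_min[OF u_t[OF assms(1)] assms(1)]) (use assms u_nonneg in auto)

text \<open>At \<open>t = 0\<close> the value \<open>ut\<close> is only the limit of the normal derivatives, so a negative value is
refuted through the mean value theorem just above \<open>t\<close>.\<close>
lemma ut_nonneg:
  assumes t: "t \<ge> 0" and u: "u (x, t) = 0"
  shows "ut (x, t) \<ge> 0"
proof (rule ccontr)
  assume "\<not> ut (x, t) \<ge> 0"
  then have neg: "ut (x, t) < 0" by simp
  have c: "continuous_on {0..} (\<lambda>t. u (x, t))" "continuous_on {0..} (\<lambda>t. ut (x, t))"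
    by (rule continuous_on_compose2[OF u_cont] continuous_on_compose2[OF ut_cont];
        auto intro!: continuous_intros)+
  obtain \<delta> where \<delta>: "\<delta> > 0" "\<And>s. s \<in> {0..} \<Longrightarrow> dist s t < \<delta> \<Longrightarrow> dist (ut (x, s)) (ut (x, t)) < - ut (x, t)"
    using c(2) t neg unfolding continuous_on_iff by (metis atLeast_iff neg_0_less_iff_less)
  define h where "h = \<delta> / 2"
  have h: "h > 0" "h < \<delta>" using \<delta>(1) by (auto simp: h_def)
  have "\<exists>l z. t < z \<and> z < t + h \<and> ((\<lambda>t. u (x, t)) has_real_derivative l) (at z) \<and> u (x, t + h) - u (x, t) = (t + h - t) * l"
  proof (rule MVT)
    show "continuous_on {t..t + h} (\<lambda>t. u (x, t))" using c(1) t by (auto intro: continuous_on_subset)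
    show "(\<lambda>t. u (x, t)) differentiable (at z)" if "t < z" for z
      using u_t[of z x] that t by (auto simp: real_differentiable_def)
  qed (use h in simp)
  then obtain l z where z: "t < z" "z < t + h" "((\<lambda>t. u (x, t)) has_real_derivative l) (at z)"
    "u (x, t + h) - u (x, t) = h * l" by auto
  have "l = ut (x, z)" using z(1,3) t u_t[of z x] DERIV_unique by (metis le_less_trans)
  moreover have "ut (x, z) < 0" using \<delta>(2)[of z] z t h by (auto simp: dist_real_def)
  ultimately have "h * l < 0" using h by (simp add: mult_pos_neg)
  then show False using z(4) u u_nonneg[of "t + h" x] t h by simp
qed

lemma sin_cos_eigen:
  "((\<lambda>t. sin (real m * t)) has_real_derivative real m * cos (real m * t)) (at t)"
  "((\<lambda>t. real m * cos (real m * t)) has_real_derivative - (real m)\<^sup>2 * sin (real m * t)) (at t)"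
  "((\<lambda>t. cos (real m * t)) has_real_derivative - real m * sin (real m * t)) (at t)"
  "((\<lambda>t. - real m * sin (real m * t)) has_real_derivative - (real m)\<^sup>2 * cos (real m * t)) (at t)"
  by (auto intro!: derivative_eq_intros simp: power2_eq_square)

text \<open>A period that starts on a hyperplane where \<open>u\<close> vanishes; the normal derivative there and both
values at the end of the period are still unknown.\<close>
context
  fixes T :: real
  assumes T: "T \<ge> 0" and T_per: "\<And>t. g (T + t) = g t" and T_zero: "\<And>x. u (x, T) = 0"
begin

abbreviation cos_moment where "cos_moment m \<equiv> moment u T (\<lambda>t. cos (real m * t))"
abbreviation sin_moment where "sin_moment m \<equiv> moment u T (\<lambda>t. sin (real m * t))"

lemma sin_rhs: "moment_rhs T (\<lambda>t. sin (real m * t)) (\<lambda>t. real m * cos (real m * t)) ((real m)\<^sup>2) x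
    = pi * fourier_sin g m + ((real m)\<^sup>2 - 1) * sin_moment m x + real m * u (x, T + 2*pi)"
  unfolding moment_rhs_def T_per fourier_sin_def cos_sin_nat_2pi T_zero by simp

lemma cos_rhs: "moment_rhs T (\<lambda>t. cos (real m * t)) (\<lambda>t. - real m * sin (real m * t)) ((real m)\<^sup>2) x
    = pi * fourier_cos g m + ((real m)\<^sup>2 - 1) * cos_moment m x - (ut (x, T + 2*pi) - ut (x, T))"
  unfolding moment_rhs_def T_per fourier_cos_def cos_sin_nat_2pi T_zero by simp

lemmas sin_Liouville = moment_Liouville[OF T sin_cos_eigen(1,2) abs_sin_le_one, unfolded sin_rhs]
lemmas cos_Liouville = moment_Liouville[OF T sin_cos_eigen(3,4) abs_cos_le_one, unfolded cos_rhs]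

lemma T_next_pos: "T + 2*pi > 0" using T pi_gt_zero by (intro add_nonneg_pos) auto

text \<open>For \<open>m = 1\<close> the zero-order term cancels and the right-hand side is a sum of two nonnegative terms.\<close>
lemma first_sine:
  assumes "fourier_sin g 1 \<ge> 0"
  shows "fourier_sin g 1 = 0" "u (x, T + 2*pi) = 0"
proof -
  have nn: "u (x, T + 2*pi) \<ge> 0" for x using T_next_pos by (intro u_nonneg) simp
  obtain B where B: "\<And>x. \<bar>sin_moment 1 x\<bar> \<le> B"
    by (rule moment_bounded[OF T, of "\<lambda>t. sin (real 1 * t)"]) (auto intro!: continuous_intros)
  have "pi * fourier_sin g 1 + ((real 1)\<^sup>2 - 1) * sin_moment 1 x + real 1 * u (x, T + 2*pi) = 0" for x
  proof (rule sin_Liouville(1)[where m = B])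
    fix x
    have "0 \<le> sin_moment 1 x + B" using B[of x] by linarith
    then show "0 \<le> (sin_moment 1 x + B) * (pi * fourier_sin g 1 + ((real 1)\<^sup>2 - 1) * sin_moment 1 x + real 1 * u (x, T + 2*pi))"
      using assms nn[of x] by simp
  qed
  then have sum0: "pi * fourier_sin g 1 + u (x, T + 2*pi) = 0" for x by simp
  show z: "fourier_sin g 1 = 0" using sum0[of 0] nn[of 0] assms
    by (simp add: add_nonneg_eq_0_iff)
  show "u (x, T + 2*pi) = 0" using sum0[of x] z by simp
qed

text \<open>At \<open>T + 2\<pi>\<close> the function \<open>u\<close> attains its minimum \<open>0\<close> in the interior, so of the boundary terms only
\<open>u\<^sub>t(x, T) \<ge> 0\<close> remains.\<close>
lemma first_cosine:
  assumes "fourier_sin g 1 \<ge> 0" "fourier_cos g 1 \<ge> 0"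
  shows "fourier_cos g 1 = 0" "ut (x, T) = 0" "ut (x, T + 2*pi) = 0"
    "moment (ux i) T (\<lambda>t. cos (real 1 * t)) x = 0"
proof -
  show ut1: "ut (x, T + 2*pi) = 0" for x using first_sine(2)[OF assms(1)] T_next_pos by (intro ut_zero)
  have nn: "ut (x, T) \<ge> 0" for x using T T_zero by (intro ut_nonneg)
  obtain B where B: "\<And>x. \<bar>cos_moment 1 x\<bar> \<le> B"
    by (rule moment_bounded[OF T, of "\<lambda>t. cos (real 1 * t)"]) (auto intro!: continuous_intros)
  have sg: "0 \<le> (cos_moment 1 x + B) * (pi * fourier_cos g 1 + ((real 1)\<^sup>2 - 1) * cos_moment 1 x - (ut (x, T + 2*pi) - ut (x, T)))" for x
  proof -
    have "0 \<le> cos_moment 1 x + B" using B[of x] by linarith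
    then show ?thesis using assms nn[of x] ut1[of x] by simp
  qed
  have "pi * fourier_cos g 1 + ((real 1)\<^sup>2 - 1) * cos_moment 1 x - (ut (x, T + 2*pi) - ut (x, T)) = 0" for x
    by (rule cos_Liouville(1)[OF sg])
  from this[unfolded ut1] have sum0: "pi * fourier_cos g 1 + ut (x, T) = 0" for x by simp
  show z: "fourier_cos g 1 = 0" using sum0[of 0] nn[of 0] assms
    by (simp add: add_nonneg_eq_0_iff)
  show "ut (x, T) = 0" using sum0[of x] z by simp
  show "moment (ux i) T (\<lambda>t. cos (real 1 * t)) x = 0"
    by (rule cos_Liouville(2)[OF sg])
qed

text \<open>For the order \<open>k = m + 2\<close> and with \<open>\<kappa> = k\<^sup>2 - 1 > 0\<close> the right-hand side is \<open>\<kappa> (U + p / \<kappa>)\<close>, which has the sign of the shifted moment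
\<open>U + p / \<kappa>\<close>; the Liouville theorem makes it vanish.\<close>
lemma higher_moments:
  assumes "fourier_sin g 1 \<ge> 0" "fourier_cos g 1 \<ge> 0"
  shows "fourier_cos (\<lambda>t. u (x, T + t)) (m + 2) = - (fourier_cos g (m + 2) / (real (m + 2) ^ 2 - 1))"
    "fourier_sin (\<lambda>t. u (x, T + t)) (m + 2) = - (fourier_sin g (m + 2) / (real (m + 2) ^ 2 - 1))"
proof -
  define k where "k = m + 2"
  define \<kappa> where "\<kappa> = (real k)\<^sup>2 - 1"
  have "(real k)\<^sup>2 \<ge> 2\<^sup>2" by (intro power_mono) (auto simp: k_def)
  then have \<kappa>: "\<kappa> > 0" by (simp add: \<kappa>_def)
  have sq: "0 \<le> (q + p / \<kappa>) * (p + \<kappa> * q)" for p q :: real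
  proof -
    have "(q + p / \<kappa>) * (p + \<kappa> * q) = \<kappa> * (q + p / \<kappa>)\<^sup>2"
      using \<kappa> by (simp add: field_simps power2_eq_square)
    then show ?thesis using \<kappa> by simp
  qed
  have "0 \<le> (cos_moment k x + pi * fourier_cos g k / \<kappa>) * (pi * fourier_cos g k + ((real k)\<^sup>2 - 1) * cos_moment k x - (ut (x, T + 2*pi) - ut (x, T)))" for x
    using sq[of "cos_moment k x" "pi * fourier_cos g k"] first_cosine(2,3)[OF assms, of x] by (simp add: \<kappa>_def)
  from cos_Liouville(1)[OF this, of x]
  have C: "pi * fourier_cos g k + \<kappa> * cos_moment k x = 0"
    using first_cosine(2,3)[OF assms, of x] by (simp add: \<kappa>_def)
  have "0 \<le> (sin_moment k x + pi * fourier_sin g k / \<kappa>) * (pi * fourier_sin g k + ((real k)\<^sup>2 - 1) * sin_moment k x + real k * u (x, T + 2*pi))" for x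
    using sq[of "sin_moment k x" "pi * fourier_sin g k"] first_sine(2)[OF assms(1), of x] by (simp add: \<kappa>_def)
  from sin_Liouville(1)[OF this, of x]
  have S: "pi * fourier_sin g k + \<kappa> * sin_moment k x = 0"
    using first_sine(2)[OF assms(1), of x] by (simp add: \<kappa>_def)
  have solve: "1 / pi * q = - (p / \<kappa>)" if "pi * p + \<kappa> * q = 0" for p q
  proof -
    have "\<kappa> * q = - (pi * p)" using that by linarith
    then have "q * \<kappa> = - (pi * p)" by (simp only: mult.commute)
    then have "q = - (pi * p) / \<kappa>" using \<kappa> by (subst nonzero_eq_divide_eq) auto
    then show ?thesis by simp
  qed
  show "fourier_cos (\<lambda>t. u (x, T + t)) (m + 2) = - (fourier_cos g (m + 2) / (real (m + 2) ^ 2 - 1))"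
    using solve[OF C] unfolding fourier_cos_def[of "\<lambda>t. u (x, T + t)"] moment_def \<kappa>_def k_def .
  show "fourier_sin (\<lambda>t. u (x, T + t)) (m + 2) = - (fourier_sin g (m + 2) / (real (m + 2) ^ 2 - 1))"
    using solve[OF S] unfolding fourier_sin_def[of "\<lambda>t. u (x, T + t)"] moment_def \<kappa>_def k_def .
qed

text \<open>What remains is the mean value, of order \<open>0\<close>, where the zero-order term has the wrong sign for
the Liouville theorem.  It is an affine function of the first cosine moment, whose gradient
vanishes; so its flux vanishes, and its moment equation reads \<open>0 = \<pi> c\<^sub>0 - U\<close>.\<close>
lemma u_on_period:
  assumes nn: "fourier_sin g 1 \<ge> 0" "fourier_cos g 1 \<ge> 0" and t: "t \<in> {0..2*pi}"
  shows "u (x, T + t) = resolvent_series g t"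
proof -
  let ?v = "\<lambda>x t. u (x, T + t)"
  let ?\<sigma> = "\<Sum>m. fourier_cos g (m + 2) / (real (m + 2) ^ 2 - 1)"
  have cc: "continuous_on {0..2*pi} (\<lambda>t. w (x, T + t))" if "continuous_on (UNIV \<times> {0..}) w"
    for w :: "(real^'n) \<times> real \<Rightarrow> real" and x
  proof (rule continuous_on_compose2[OF that])
    show "(\<lambda>t. (x, T + t)) ` {0..2*pi} \<subseteq> UNIV \<times> {0..}" using T by auto
  qed (intro continuous_intros)
  have der: "(?v x has_real_derivative ut (x, T + t)) (at t)" if "t \<in> {0<..<2*pi}" for x t
  proof (rule DERIV_translate[where f = "\<lambda>t. u (x, t)"])
    show "((\<lambda>t. u (x, t)) has_real_derivative ut (x, T + t)) (at (T + t))"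
      using that T by (intro u_t) simp
  qed
  have g_cont': "continuous_on {0..2*pi} g" using g_cont by (rule continuous_on_subset) simp
  have series: "fourier_cos (?v x) 0 / 2 + fourier_cos (?v x) 1 = ?\<sigma>"
    "fourier_sin (?v x) 1 = (\<Sum>m. real (m + 2) / (real (m + 2) ^ 2 - 1) * fourier_sin g (m + 2))"
    "\<And>t. t \<in> {0..2*pi} \<Longrightarrow> ?v x t = fourier_cos (?v x) 0 / 2 + fourier_cos (?v x) 1 * cos t + fourier_sin (?v x) 1 * sin t
        - (\<Sum>m. fourier_cos g (m + 2) / (real (m + 2) ^ 2 - 1) * cos (real (m + 2) * t)
               + fourier_sin g (m + 2) / (real (m + 2) ^ 2 - 1) * sin (real (m + 2) * t))" for x
  proof -
    have z: "u (x, T + 0) = 0" "u (x, T + 2*pi) = 0" "ut (x, T + 0) = 0" "ut (x, T + 2*pi) = 0"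
      using T_zero first_sine(2)[OF nn(1)] first_cosine(2,3)[OF nn] by simp_all
    note R = resolvent_fourier_series[of "?v x" "\<lambda>t. ut (x, T + t)" "fourier_cos g" "fourier_sin g",
        OF cc[OF u_cont] cc[OF ut_cont] _ z summable_fourier_squares[OF g_cont'] higher_moments[OF nn]]
    show "fourier_cos (?v x) 0 / 2 + fourier_cos (?v x) 1 = ?\<sigma>"
      by (rule R(1), erule der)
    show "fourier_sin (?v x) 1 = (\<Sum>m. real (m + 2) / (real (m + 2) ^ 2 - 1) * fourier_sin g (m + 2))"
      by (rule R(2), erule der)
    show "?v x t = fourier_cos (?v x) 0 / 2 + fourier_cos (?v x) 1 * cos t + fourier_sin (?v x) 1 * sin t
        - (\<Sum>m. fourier_cos g (m + 2) / (real (m + 2) ^ 2 - 1) * cos (real (m + 2) * t)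
               + fourier_sin g (m + 2) / (real (m + 2) ^ 2 - 1) * sin (real (m + 2) * t))"
      if "t \<in> {0..2*pi}" for t
      by (rule R(3)[OF _ that], erule der)
  qed
  have cos_c: "continuous_on UNIV (\<lambda>t. cos (real m * t))" for m by (intro continuous_intros)
  have ux0: "moment (ux i) T (\<lambda>t. cos (real 0 * t)) x = 0" for i x
  proof -
    have mean_via_cos: "cos_moment 0 x = 2 * pi * ?\<sigma> - 2 * cos_moment 1 x" for x
    proof -
      have "1 / pi * cos_moment 0 x / 2 + 1 / pi * cos_moment 1 x = ?\<sigma>"
        using series(1)[of x] unfolding fourier_cos_def[of "?v x"] moment_def .
      then have "pi * (1 / pi * cos_moment 0 x / 2 + 1 / pi * cos_moment 1 x) = pi * ?\<sigma>" by (rule arg_cong)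
      then have "cos_moment 0 x / 2 + cos_moment 1 x = pi * ?\<sigma>" by (simp add: distrib_left)
      then show ?thesis by linarith
    qed
    note D = moment_der[OF u_cont ux_cont T cos_c u_x]
    have "((\<lambda>s. cos_moment 0 (x + s *\<^sub>R axis i 1)) has_real_derivative 0 - 2 * moment (ux i) T (\<lambda>t. cos (real 1 * t)) x) (at 0)"
      unfolding mean_via_cos by (intro DERIV_diff DERIV_const DERIV_cmult D)
    then have "moment (ux i) T (\<lambda>t. cos (real 0 * t)) x = 0 - 2 * moment (ux i) T (\<lambda>t. cos (real 1 * t)) x"
      using D[of 0 x i] by (intro DERIV_unique)
    then show ?thesis using first_cosine(4)[OF nn, of i x] by simp
  qed
  have "moment_flux T (\<lambda>t. cos (real 0 * t)) i x = 0" for i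
  proof (rule DERIV_unique[OF moment_flux_der[OF T cos_c]])
    show "((\<lambda>s. \<Sum>j\<in>UNIV. a i j (x + s *\<^sub>R axis i 1) * moment (ux j) T (\<lambda>t. cos (real 0 * t)) (x + s *\<^sub>R axis i 1))
           has_real_derivative 0) (at 0)"
      unfolding ux0 by simp
  qed
  then have "pi * fourier_cos g 0 + ((real 0)\<^sup>2 - 1) * cos_moment 0 x - (ut (x, T + 2*pi) - ut (x, T)) = 0"
    using moment_equation[OF T sin_cos_eigen(3,4), of 0 x] unfolding cos_rhs by simp
  then have "cos_moment 0 x = pi * fourier_cos g 0" using first_cosine(2,3)[OF nn, of x] by simp
  then have f0: "fourier_cos (?v x) 0 = fourier_cos g 0"
    unfolding fourier_cos_def[of "?v x"] moment_def by simp
  then have f1: "fourier_cos (?v x) 1 = - (fourier_cos g 0 / 2) + ?\<sigma>"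
    using series(1)[of x] by linarith
  show ?thesis
    using series(3)[OF t, of x] unfolding f0 f1 series(2) resolvent_series_def .
qed

end

lemma u_eq_resolvent_series:
  assumes nn: "fourier_sin g 1 \<ge> 0" "fourier_cos g 1 \<ge> 0" and t: "t \<ge> 0"
  shows "u (x, t) = resolvent_series g t"
proof -
  have gT: "g (2 * pi * real n + t) = g t" for n t
  proof (induction n)
    case (Suc n)
    then show ?case using g_per[of "2 * pi * real n + t"] by (simp add: algebra_simps)
  qed simp
  have zero: "u (x, 2 * pi * real n) = 0" for n x
  proof (induction n arbitrary: x)
    case 0
    then show ?case using u_0 by simp
  next
    case (Suc n)
    have "u (x, 2 * pi * real n + 2 * pi) = 0"
      by (rule first_sine(2)[OF _ gT Suc.IH nn(1)]) simp
    then show ?case by (simp add: algebra_simps)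
  qed
  have Rn: "resolvent_series g (2 * pi * real n + s) = resolvent_series g s" for n s
  proof (induction n)
    case (Suc n)
    then show ?case using resolvent_series_periodic[of g "2 * pi * real n + s"] by (simp add: algebra_simps)
  qed simp
  define n where "n = nat \<lfloor>t / (2 * pi)\<rfloor>"
  define s where "s = t - 2 * pi * real n"
  have fl: "real n \<le> t / (2 * pi)" "t / (2 * pi) < real n + 1"
    using t by (auto simp: n_def)
  have s: "s \<in> {0..2*pi}" using fl pi_gt_zero by (auto simp: s_def field_simps)
  have "u (x, 2 * pi * real n + s) = resolvent_series g s"
    by (rule u_on_period[OF _ gT zero nn s]) simp
  then show ?thesis using Rn[of n s] by (simp add: s_def)
qed

text \<open>Since \<open>u\<close> does not depend on \<open>x\<close>, all tangential derivatives vanish and only \<open>u\<^sub>t\<^sub>t\<close> is left in the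
divergence.\<close>
lemma utt_eq:
  assumes nn: "fourier_sin g 1 \<ge> 0" "fourier_cos g 1 \<ge> 0" and t: "t > 0"
  shows "- utt (x, t) = u (x, t) - g t"
proof -
  have ux: "ux i (x, t) = 0" for i x
  proof (rule DERIV_unique[OF u_x])
    show "((\<lambda>s. u (x + s *\<^sub>R axis i 1, t)) has_real_derivative 0) (at 0)"
      using t by (simp add: u_eq_resolvent_series[OF nn])
  qed (use t in simp)
  have uxx: "uxx i j (x, t) = 0" for i j x
  proof (rule DERIV_unique[OF ux_x])
    show "((\<lambda>s. ux j (x + s *\<^sub>R axis i 1, t)) has_real_derivative 0) (at 0)"
      by (simp add: ux)
  qed (use t in simp)
  show ?thesis using equation[OF t, of x] by (simp add: ux uxx)
qed

lemma profile_solves: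
  assumes nn: "fourier_sin g 1 \<ge> 0" "fourier_cos g 1 \<ge> 0"
  shows "solves_profile g (\<lambda>t. u (x, t))"
proof -
  let ?v = "\<lambda>t. u (x, t)" and ?v' = "\<lambda>t. ut (x, t)" and ?v'' = "\<lambda>t. utt (x, t)"
  have cc: "continuous_on {0..} (\<lambda>t. w (x, t))" if "continuous_on (UNIV \<times> {0..}) w" for w :: "(real^'n) \<times> real \<Rightarrow> real"
    by (rule continuous_on_compose2[OF that]) (auto intro!: continuous_intros)
  have cl: "closure {0<..} = {0::real..}" by simp
  have pd: "partial_deriv 1 f t = D" if "(f has_real_derivative D) (at t)" for f D and t :: real
    using DERIV_translate[of f D t 0] that by (intro partial_deriv_unique) simp
  have pv: "partial_deriv 1 ?v t = ?v' t" if "t > 0" for t using pd[OF u_t[OF that]] .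
  have dpv: "(partial_deriv 1 ?v has_real_derivative ?v'' t) (at t)" if "t > 0" for t
    by (rule has_field_derivative_transform_within_open[OF ut_t[OF that] open_greaterThan[of 0]])
      (use that pv in auto)
  have pv2: "partial_deriv 1 (partial_deriv 1 ?v) t = ?v'' t" if "t > 0" for t using pd[OF dpv[OF that]] .
  have diff: "f differentiable_on {0<..}" if "\<And>t. t > 0 \<Longrightarrow> (f has_real_derivative D t) (at t)" for f D :: "real \<Rightarrow> real"
    using that by (intro differentiable_at_imp_differentiable_on) (auto simp: real_differentiable_def)
  \<comment> \<open>On the real line \<open>Basis = {1}\<close>, so the only partial derivative is the ordinary one.\<close>
  have C2: "Ck_closure 2 {0<..} ?v"
    unfolding Ck_closure_def numeral_2_eq_2 Ck_extends.simps cl Basis_real_def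
  proof (intro conjI ballI; (simp only: singleton_iff)?)
    show "continuous_on {0..} ?v" by (rule cc[OF u_cont])
    show "\<exists>h. continuous_on {0..} h \<and> (\<forall>x\<in>{0<..}. h x = ?v x)" using cc[OF u_cont] by blast
    show "?v differentiable_on {0<..}" by (rule diff[OF u_t])
    show "\<exists>h. continuous_on {0..} h \<and> (\<forall>t\<in>{0<..}. h t = partial_deriv 1 ?v t)"
      using cc[OF ut_cont] pv by (intro exI[of _ ?v']) simp
    show "partial_deriv 1 ?v differentiable_on {0<..}" by (rule diff[OF dpv])
    show "\<exists>h. continuous_on {0..} h \<and> (\<forall>t\<in>{0<..}. h t = partial_deriv 1 (partial_deriv 1 ?v) t)"
      using cc[OF utt_cont] pv2 by (intro exI[of _ ?v'']) simp
  qed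
  have dd: "deriv (deriv ?v) t = ?v'' t" if "t > 0" for t
  proof (rule DERIV_imp_deriv)
    show "(deriv ?v has_real_derivative ?v'' t) (at t)"
      by (rule has_field_derivative_transform_within_open[OF ut_t[OF that] open_greaterThan[of 0]])
        (use that DERIV_imp_deriv[OF u_t] in auto)
  qed
  have ut0: "ut (x, 0) = 0" and u1: "u (x, 2 * pi) = 0" and ut1: "ut (x, 2 * pi) = 0"
    using first_cosine(2,3)[of 0 x] first_sine(2)[of 0 x] nn u_0 by auto
  \<comment> \<open>\<open>u\<close> is the integral of \<open>ut\<close> from \<open>0\<close>, which is differentiable at the end point as well.\<close>
  have at0: "(?v has_real_derivative 0) (at 0 within {0..})"
  proof -
    have int: "integral {0..t} ?v' = ?v t" if "t \<in> {0..1}" for t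
    proof (rule integral_unique)
      have "(?v' has_integral ?v t - ?v 0) {0..t}"
      proof (rule fundamental_theorem_of_calculus_interior)
        show "continuous_on {0..t} ?v" using cc[OF u_cont] by (rule continuous_on_subset) auto
        show "(?v has_vector_derivative ?v' s) (at s)" if "s \<in> {0<..<t}" for s
          using u_t[of s x] that by (simp add: has_real_derivative_iff_has_vector_derivative)
      qed (use that in simp)
      then show "(?v' has_integral ?v t) {0..t}" using u_0 by simp
    qed
    have "((\<lambda>t. integral {0..t} ?v') has_real_derivative ?v' 0) (at 0 within {0..1})"
      using cc[OF ut_cont] by (intro integral_has_real_derivative) (auto intro: continuous_on_subset)
    then have "(?v has_real_derivative 0) (at 0 within {0..1})"
      unfolding ut0 by (rule has_field_derivative_transform_within[where d = 1]) (use int in auto)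
    then show ?thesis
      by (simp add: at_within_Icc_at_right at_within_Ici_at_right)
  qed
  show ?thesis
    unfolding solves_profile_def
    using C2 dd utt_eq[OF nn, of _ x] u_0 u1 at0 u_t[of "2*pi" x] ut1 by simp
qed

end

section \<open>Uniqueness of the profile and the theorem\<close>

text \<open>The difference \<open>z\<close> of two solutions satisfies \<open>z'' + z = 0\<close>, so \<open>z\<^sup>2 + z'\<^sup>2\<close> is constant on \<open>t > 0\<close>.  Its value is
read off at \<open>2\<pi>\<close>, an interior point, rather than at \<open>0\<close>, where the derivative is one-sided.\<close>
lemma solves_profile_unique:
  assumes v: "solves_profile g v" and w: "solves_profile g w" and t: "t \<ge> 0"
  shows "w t = v t"
proof -
  have facts: "(v has_real_derivative deriv v s) (at s) \<and> (deriv v has_real_derivative g s - v s) (at s)"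
    if "solves_profile g v" "s > 0" for v s
  proof -
    have C: "v differentiable_on {0<..}" "partial_deriv 1 v differentiable_on {0<..}"
      and eq: "- deriv (deriv v) s = v s - g s"
      using that unfolding solves_profile_def Ck_closure_def numeral_2_eq_2 Ck_extends.simps Basis_real_def by auto
    have der: "(v has_real_derivative deriv v s) (at s)" if "s > 0" for s
    proof -
      have "v differentiable (at s)"
        using C(1) that by (simp add: differentiable_on_eq_differentiable_at)
      then obtain D where D: "(v has_real_derivative D) (at s)" by (rule real_differentiableE)
      then show ?thesis unfolding DERIV_imp_deriv[OF D] .
    qed
    have pd: "partial_deriv 1 v s = deriv v s" if "s > 0" for s
      using DERIV_translate[of v "deriv v s" s 0] der[OF that] by (intro partial_deriv_unique) simp
    have "partial_deriv 1 v differentiable (at s)"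
      using C(2) \<open>s > 0\<close> by (simp add: differentiable_on_eq_differentiable_at)
    then obtain D where "(partial_deriv 1 v has_real_derivative D) (at s)" by (rule real_differentiableE)
    then have D: "(deriv v has_real_derivative D) (at s)"
      by (rule has_field_derivative_transform_within_open[OF _ open_greaterThan[of 0]])
        (use \<open>s > 0\<close> pd in auto)
    then have "D = g s - v s" using eq DERIV_imp_deriv[OF D] by simp
    then show ?thesis using der D \<open>s > 0\<close> by simp
  qed
  define e where "e s = (w s - v s)\<^sup>2 + (deriv w s - deriv v s)\<^sup>2" for s
  have e': "(e has_real_derivative 0) (at s)" if "s > 0" for s
  proof -
    note V = facts[OF v that] and W = facts[OF w that]
    have "((\<lambda>s. (w s - v s) ^ 2 + (deriv w s - deriv v s) ^ 2) has_real_derivative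
      2 * (w s - v s) * (deriv w s - deriv v s) + 2 * (deriv w s - deriv v s) * ((g s - w s) - (g s - v s))) (at s)"
      using V W by (auto intro!: derivative_eq_intros simp: algebra_simps)
    then show ?thesis unfolding e_def by (rule DERIV_cong) (simp add: algebra_simps)
  qed
  have "\<exists>k. \<forall>s\<in>{0<..}. e s = k"
  proof (rule has_field_derivative_zero_constant)
    show "(e has_field_derivative 0) (at s within {0<..})" if "s \<in> {0<..}" for s
      using e'[of s] that by (simp add: has_field_derivative_at_within)
  qed simp
  then obtain k where "\<forall>s\<in>{0<..}. e s = k" ..
  then have const: "e s = e (2*pi)" if "s > 0" for s using that by simp
  have "deriv v (2*pi) = 0" "deriv w (2*pi) = 0" "v (2*pi) = 0" "w (2*pi) = 0"
    using v w by (auto simp: solves_profile_def intro: DERIV_imp_deriv)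
  then have e0: "e (2*pi) = 0" by (simp add: e_def)
  show ?thesis
  proof (cases "t = 0")
    case True
    then show ?thesis using v w by (simp add: solves_profile_def)
  next
    case False
    then have "e t = 0" using const[of t] e0 t by simp
    then show ?thesis by (simp add: e_def sum_power2_eq_zero_iff)
  qed
qed

theorem theorem4p7:
  fixes N :: nat
    and Ahat :: "real ^ 'n \<Rightarrow> real ^ 'n ^ 'n"
    and g :: "real \<Rightarrow> real"
    and u :: "(real ^ 'n) \<times> real \<Rightarrow> real"
    and c d :: "nat \<Rightarrow> real"
  assumes dim: "N = CARD('n) + 1" and N: "N = 2 \<or> N = 3"
    and A: "admissible_matrix Ahat"
    and g_cont: "continuous_on UNIV g"
    and g_per: "\<And>t. g (t + 2 * pi) = g t"
    and c: "c = fourier_cos g" and d: "d = fourier_sin g"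
    and c1: "c 1 \<ge> 0" and d1: "d 1 \<ge> 0"
    and u_C2: "Ck_closure 2 half_space u"
    and u_eq: "\<And>x. x \<in> half_space \<Longrightarrow>
       - divergence (\<lambda>y. block_mult (Ahat (fst y)) (grad u y)) x = u x - g (snd x)"
    and u_bdry: "\<And>x. x \<in> frontier half_space \<Longrightarrow> u x = 0"
    and u_bdd: "\<And>M. M > 0 \<Longrightarrow> \<exists>C>0. \<forall>x \<in> UNIV \<times> {0..M}. 0 \<le> u x \<and> u x \<le> C"
  shows "c 1 = 0 \<and> d 1 = 0 \<and>
    (\<exists>v. (\<forall>x'. \<forall>t\<ge>0. u (x', t) = v t) \<and>
         (\<forall>t\<ge>0. v (t + 2 * pi) = v t) \<and>
         solves_profile g v \<and>
         (\<forall>w. solves_profile g w \<longrightarrow> (\<forall>t\<ge>0. w t = v t))) \<and>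
    summable (\<lambda>m. c (m + 2) / (real (m + 2) ^ 2 - 1)) \<and>
    summable (\<lambda>m. real (m + 2) / (real (m + 2) ^ 2 - 1) * d (m + 2)) \<and>
    (\<forall>t\<ge>0. summable (\<lambda>m. c (m + 2) / (real (m + 2) ^ 2 - 1) * cos (real (m + 2) * t)
                       + d (m + 2) / (real (m + 2) ^ 2 - 1) * sin (real (m + 2) * t))) \<and>
    (\<forall>x'. \<forall>t\<ge>0. u (x', t) =
        c 0 / 2
        + (- (c 0 / 2) + (\<Sum>m. c (m + 2) / (real (m + 2) ^ 2 - 1))) * cos t
        + (\<Sum>m. real (m + 2) / (real (m + 2) ^ 2 - 1) * d (m + 2)) * sin t
        - (\<Sum>m. c (m + 2) / (real (m + 2) ^ 2 - 1) * cos (real (m + 2) * t)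
               + d (m + 2) / (real (m + 2) ^ 2 - 1) * sin (real (m + 2) * t)))"
proof -
  have card: "CARD('n) \<le> 2" using dim N by linarith
  obtain ut utt ux uxx where u_cont: "continuous_on (UNIV \<times> {0..}) u" "continuous_on (UNIV \<times> {0..}) ut"
      "continuous_on (UNIV \<times> {0..}) utt"
      "\<And>i. continuous_on (UNIV \<times> {0..}) (ux i)" "\<And>i j. continuous_on (UNIV \<times> {0..}) (uxx i j)"
    and u_t: "\<And>x t. t > 0 \<Longrightarrow> ((\<lambda>t. u (x, t)) has_real_derivative ut (x, t)) (at t)"
    and ut_t: "\<And>x t. t > 0 \<Longrightarrow> ((\<lambda>t. ut (x, t)) has_real_derivative utt (x, t)) (at t)"
    and u_x: "\<And>i x t. t \<ge> 0 \<Longrightarrow> ((\<lambda>s. u (x + s *\<^sub>R axis i 1, t)) has_real_derivative ux i (x, t)) (at 0)"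
    and ux_x: "\<And>i j x t. t \<ge> 0 \<Longrightarrow> ((\<lambda>s. ux j (x + s *\<^sub>R axis i 1, t)) has_real_derivative uxx i j (x, t)) (at 0)"
    by (rule C2_half_space_derivatives[OF u_C2]) (rule that)
  obtain da K where a_cont: "\<And>i j. continuous_on UNIV (\<lambda>x. Ahat x $ i $ j)" "\<And>i j. continuous_on UNIV (da i j)"
    and a_der: "\<And>i j x. ((\<lambda>s. Ahat (x + s *\<^sub>R axis i 1) $ i $ j) has_real_derivative da i j x) (at 0)"
    and a_alg: "\<And>i j x. \<bar>Ahat x $ i $ j\<bar> \<le> K" "\<And>i j x. Ahat x $ i $ j = Ahat x $ j $ i"
    "\<And>x q. q \<noteq> (\<lambda>_. 0) \<Longrightarrow> 0 < (\<Sum>i\<in>UNIV. \<Sum>j\<in>UNIV. Ahat x $ i $ j * q i * q j)"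
    by (rule admissible_matrix_derivatives[OF A]) (rule that)
  have eq: "(\<Sum>i\<in>UNIV. \<Sum>j\<in>UNIV. da i j x * ux j (x, t) + Ahat x $ i $ j * uxx i j (x, t))
      + utt (x, t) + u (x, t) = g t" if "t > 0" for x t
  proof -
    have "divergence (\<lambda>y. block_mult (Ahat (fst y)) (grad u y)) (x, t)
      = (\<Sum>i\<in>UNIV. \<Sum>j\<in>UNIV. da i j x * ux j (x, t) + Ahat x $ i $ j * uxx i j (x, t)) + utt (x, t)"
      by (rule block_divergence_eq[OF a_der u_t ut_t u_x ux_x that]) auto
    then show ?thesis using u_eq[of "(x, t)"] that by (simp add: half_space_def)
  qed
  have u_0: "u (x, 0) = 0" for x by (rule u_bdry) (simp add: frontier_half_space)
  have u_nonneg: "0 \<le> u (x, t)" if "t \<ge> 0" for x t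
    using u_bdd[of "t + 1"] that by fastforce
  have u_upper: "\<exists>C. \<forall>x. \<forall>t\<in>{0..L}. u (x, t) \<le> C" if "L > 0" for L
    using u_bdd[OF that] by fastforce
  interpret half_space_solution "\<lambda>i j x. Ahat x $ i $ j" da K u ut utt ux uxx g
    by unfold_locales
      (fact card u_cont a_cont a_der a_alg u_t ut_t u_x ux_x eq g_cont g_per u_0 u_nonneg u_upper)+
  have nn: "fourier_sin g 1 \<ge> 0" "fourier_cos g 1 \<ge> 0" using c1 d1 c d by simp_all
  have zero: "fourier_cos g 1 = 0" "fourier_sin g 1 = 0"
    using first_cosine(1)[of 0] first_sine(1)[of 0] nn u_0 by auto
  note formula = u_eq_resolvent_series[OF nn]
  have g_cont': "continuous_on {0..2*pi} g" using g_cont by (rule continuous_on_subset) simp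
  note sq = summable_fourier_squares[OF g_cont']
  have s1: "summable (\<lambda>m. c (m + 2) / (real (m + 2) ^ 2 - 1))"
    unfolding c by (rule summable_rabs_cancel[OF summable_resolvent[OF sq(1)]])
  have s2: "summable (\<lambda>m. real (m + 2) / (real (m + 2) ^ 2 - 1) * d (m + 2))"
    using summable_rabs_cancel[OF summable_resolvent_weighted[OF sq(2)]] unfolding d by simp
  have s3: "summable (\<lambda>m. c (m + 2) / (real (m + 2) ^ 2 - 1) * cos (real (m + 2) * t)
                       + d (m + 2) / (real (m + 2) ^ 2 - 1) * sin (real (m + 2) * t))" for t
    unfolding c d by (rule summable_trig_series[OF summable_resolvent[OF sq(1)] summable_resolvent[OF sq(2)]])
  have profile: "\<exists>v. (\<forall>x'. \<forall>t\<ge>0. u (x', t) = v t) \<and> (\<forall>t\<ge>0. v (t + 2 * pi) = v t) \<and>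
         solves_profile g v \<and> (\<forall>w. solves_profile g w \<longrightarrow> (\<forall>t\<ge>0. w t = v t))"
  proof (intro exI[of _ "\<lambda>t. u (0, t)"] conjI allI impI)
    show "u (x', t) = u (0, t)" if "t \<ge> 0" for x' t using that by (simp only: formula)
    show "u (0, t + 2 * pi) = u (0, t)" if "t \<ge> 0" for t
      using that formula[of "t + 2 * pi" 0] formula[of t 0] resolvent_series_periodic[of g t] by simp
    show "solves_profile g (\<lambda>t. u (0, t))" by (rule profile_solves[OF nn])
    then show "w t = u (0, t)" if "solves_profile g w" "t \<ge> 0" for w t
      using that by (rule solves_profile_unique)
  qed
  have series: "u (x', t) =
        c 0 / 2
        + (- (c 0 / 2) + (\<Sum>m. c (m + 2) / (real (m + 2) ^ 2 - 1))) * cos t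
        + (\<Sum>m. real (m + 2) / (real (m + 2) ^ 2 - 1) * d (m + 2)) * sin t
        - (\<Sum>m. c (m + 2) / (real (m + 2) ^ 2 - 1) * cos (real (m + 2) * t)
               + d (m + 2) / (real (m + 2) ^ 2 - 1) * sin (real (m + 2) * t))" if "t \<ge> 0" for x' t
    using formula[OF that, of x'] unfolding c d resolvent_series_def .
  show ?thesis
    using zero profile s1 s2 s3 series unfolding c d by blast
qed

end
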